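(* Let $\alpha\in(0,\frac{\pi}{2})$, $m>0$ and $a>0$ be such that $$\frac{1}{\cot(\alpha)}+2ma>1 ,$$ and put $$t_0:=-\frac{\cot(\alpha)}{1+2ma\cot(\alpha)} .$$ Then there exists $\varepsilon_0>0$ such that, for every $\varepsilon\in(0,\varepsilon_0)$, with $t:=t_0\sqrt{1+\varepsilon}$, the operator $D_{V_t}$ possesses a discrete eigenvalue in the interval $(-m,m)$, and the quantity $$\int_0^\infty\int_0^\infty |V_t(x)|\;\max\left(1,\frac{1}{\cot(\alpha)}+2m\min(x,y)\right)^2\,|V_t(y)|\,dx\,dy ,$$ evaluated for the Dirac delta potential $V_t$, equals $1+\varepsilon$.
   Context: For $t\in\mathbb{R}$ and $a>0$, $V_t$ is formally the matrix-valued Dirac delta potential $$V_t(x)=t\,\delta(x-a)\begin{pmatrix}1&0\\0&0\end{pmatrix}.$$ In the double integral, $|V_t(x)|\,dx$ is understood as $|t|$ times the Dirac measure at $a$, so that the double integral is $t^2\max\big(1,\frac{1}{\cot(\alpha)}+2ma\big)^2$. Rigorously, $D_{V_t}$ is the self-adjoint operator in $L^2((0,\infty),\mathbb{C}^2)$ which acts as $$\begin{pmatrix} m & -\frac{d}{dx}\\ \frac{d}{dx} & -m\end{pmatrix}$$ on $(0,a)\cup(a,+\infty)$, and whose domain consists of the functions $\psi=(\psi_1,\psi_2)^\top\in H^1((0,a)\cup(a,\infty),\mathbb{C}^2)$ satisfying the boundary condition $\psi_1(0)\cot(\alpha)=\psi_2(0)$ and the interface condition $$\begin{pmatrix} it/2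 & -i\\ 1&0\end{pmatrix}\psi(a^+)+\begin{pmatrix} it/2 & i\\ -1&0\end{pmatrix}\psi(a^-)=\begin{pmatrix}0\\0\end{pmatrix}.$$ *)

theory Defs
  imports "HOL-Probability.Probability"
begin

section \<open>Square-integrable spinors and weak derivatives\<close>

text \<open>
  Elements of \<open>L\<^sup>2(\<Omega>, \<complex>\<^sup>2)\<close> are represented by functions; two representatives denote the same
  element iff they agree almost everywhere. The values of a representative outside \<open>\<Omega>\<close> are
  irrelevant, and all the notions below are invariant under a change of representative.
\<close>

definition L2 :: "real set \<Rightarrow> (real \<Rightarrow> complex^2) set" where
  "L2 \<Omega> = {\<psi>. \<psi> \<in> borel_measurable (lebesgue_on \<Omega>) \<and>
               integrable (lebesgue_on \<Omega>) (\<lambda>x. (norm (\<psi> x))\<^sup>2)}"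

definition L2_norm :: "real set \<Rightarrow> (real \<Rightarrow> complex^2) \<Rightarrow> real" where
  "L2_norm \<Omega> \<psi> = sqrt (LINT x|lebesgue_on \<Omega>. (norm (\<psi> x))\<^sup>2)"

definition test_functions :: "real set \<Rightarrow> (real \<Rightarrow> real) set" where
  "test_functions \<Omega> = {\<phi>. (\<forall>n x. (deriv ^^ n) \<phi> differentiable (at x)) \<and>
                          (\<exists>K. compact K \<and> K \<subseteq> \<Omega> \<and> (\<forall>x. x \<notin> K \<longrightarrow> \<phi> x = 0))}"

definition weak_deriv :: "real set \<Rightarrow> (real \<Rightarrow> complex^2) \<Rightarrow> (real \<Rightarrow> complex^2) \<Rightarrow> bool" where
  "weak_deriv \<Omega> \<psi> g \<longleftrightarrow>
     (\<forall>\<phi>\<in>test_functions \<Omega>.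
        (LINT x|lebesgue_on \<Omega>. deriv \<phi> x *\<^sub>R \<psi> x) = - (LINT x|lebesgue_on \<Omega>. \<phi> x *\<^sub>R g x))"

definition H1 :: "real set \<Rightarrow> (real \<Rightarrow> complex^2) set" where
  "H1 \<Omega> = {\<psi> \<in> L2 \<Omega>. \<exists>g\<in>L2 \<Omega>. weak_deriv \<Omega> \<psi> g}"

text \<open>
  \<open>has_trace I c \<psi> v\<close>: the continuous representative of \<open>\<psi>\<close> on the open interval \<open>I\<close> tends to \<open>v\<close>
  at the endpoint \<open>c\<close> of \<open>I\<close>. Elements of \<open>H1 I\<close> have exactly one such \<open>v\<close> at each finite endpoint.
\<close>

definition has_trace :: "real set \<Rightarrow> real \<Rightarrow> (real \<Rightarrow> complex^2) \<Rightarrow> complex^2 \<Rightarrow> bool" where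
  "has_trace I c \<psi> v \<longleftrightarrow>
     (\<exists>u. continuous_on I u \<and> (AE x in lebesgue_on I. u x = \<psi> x) \<and> (u \<longlongrightarrow> v) (at c within I))"

section \<open>Operators in \<open>L\<^sup>2((0,\<infinity>), \<complex>\<^sup>2)\<close> and their discrete spectrum\<close>

abbreviation half_line :: "real set" where
  "half_line \<equiv> {0<..}"

text \<open>An unbounded operator is given by its graph, a set of pairs \<open>(\<psi>, D \<psi>)\<close>.\<close>

type_synonym spinor_operator = "((real \<Rightarrow> complex^2) \<times> (real \<Rightarrow> complex^2)) set"

definition eigenspace :: "spinor_operator \<Rightarrow> complex \<Rightarrow> (real \<Rightarrow> complex^2) set" where
  "eigenspace D z = {\<psi>. (\<psi>, \<lambda>x. z *s \<psi> x) \<in> D}"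

definition eigenvalue :: "spinor_operator \<Rightarrow> complex \<Rightarrow> bool" where
  "eigenvalue D z \<longleftrightarrow> (\<exists>\<psi>\<in>eigenspace D z. \<not> (AE x in lebesgue_on half_line. \<psi> x = 0))"

definition finite_multiplicity :: "spinor_operator \<Rightarrow> complex \<Rightarrow> bool" where
  "finite_multiplicity D z \<longleftrightarrow>
     (\<exists>B. finite B \<and> B \<subseteq> eigenspace D z \<and>
        (\<forall>\<psi>\<in>eigenspace D z. \<exists>c. AE x in lebesgue_on half_line. \<psi> x = (\<Sum>b\<in>B. c b *s b x)))"

text \<open>
  \<open>z\<close> is in the resolvent set iff \<open>D - z\<close> is a bijection from the domain of \<open>D\<close> onto \<open>L\<^sup>2\<close> with bounded
  inverse; for a linear \<open>D\<close>, injectivity is contained in the norm bound.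
\<close>

definition resolvent_set :: "spinor_operator \<Rightarrow> complex set" where
  "resolvent_set D = {z.
     (\<forall>f\<in>L2 half_line. \<exists>\<psi>. (\<psi>, \<lambda>x. f x + z *s \<psi> x) \<in> D) \<and>
     (\<exists>C. \<forall>(\<psi>, \<phi>)\<in>D. L2_norm half_line \<psi> \<le> C * L2_norm half_line (\<lambda>x. \<phi> x - z *s \<psi> x))}"

definition spectrum :: "spinor_operator \<Rightarrow> complex set" where
  "spectrum D = - resolvent_set D"

text \<open>
  For self-adjoint operators the algebraic and geometric multiplicities of an isolated eigenvalue
  coincide, so the dimension of the eigenspace is the relevant multiplicity.
\<close>

definition discrete_eigenvalue :: "spinor_operator \<Rightarrow> complex \<Rightarrow> bool" where
  "discrete_eigenvalue D z \<longleftrightarrow>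
     eigenvalue D z \<and> finite_multiplicity D z \<and> z isolated_in spectrum D"

section \<open>The Dirac operator with a delta potential\<close>

definition matrix2 :: "complex \<Rightarrow> complex \<Rightarrow> complex \<Rightarrow> complex \<Rightarrow> complex^2^2" where
  "matrix2 p q r s = vector [vector [p, q], vector [r, s]]"

definition punctured_half_line :: "real \<Rightarrow> real set" where
  "punctured_half_line a = {0<..<a} \<union> {a<..}"

definition dirac_delta_domain :: "real \<Rightarrow> real \<Rightarrow> real \<Rightarrow> (real \<Rightarrow> complex^2) set" where
  "dirac_delta_domain \<alpha> a t = {\<psi> \<in> H1 (punctured_half_line a).
     \<exists>\<psi>0 \<psi>minus \<psi>plus.
       has_trace {0<..<a} 0 \<psi> \<psi>0 \<and> has_trace {0<..<a} a \<psi> \<psi>minus \<and> has_trace {a<..} a \<psi> \<psi>plus \<and>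
       \<psi>0 $ 1 * complex_of_real (cot \<alpha>) = \<psi>0 $ 2 \<and>
       matrix2 (\<i> * complex_of_real t / 2) (- \<i>) 1 0 *v \<psi>plus
         + matrix2 (\<i> * complex_of_real t / 2) \<i> (- 1) 0 *v \<psi>minus = 0}"

definition dirac_delta :: "real \<Rightarrow> real \<Rightarrow> real \<Rightarrow> real \<Rightarrow> spinor_operator" where
  "dirac_delta m \<alpha> a t = {(\<psi>, \<phi>).
     \<psi> \<in> dirac_delta_domain \<alpha> a t \<and> \<phi> \<in> L2 half_line \<and>
     (\<exists>g\<in>L2 (punctured_half_line a). weak_deriv (punctured_half_line a) \<psi> g \<and>
        (AE x in lebesgue_on half_line.
           \<phi> x = matrix2 (complex_of_real m) 0 0 (- complex_of_real m) *v \<psi> x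
                 + matrix2 0 (- 1) 1 0 *v g x))}"

text \<open>The measure \<open>|V\<^sub>t(x)| dx\<close>, i.e. \<open>|t|\<close> times the Dirac measure at \<open>a\<close>.\<close>

definition delta_potential_measure :: "real \<Rightarrow> real \<Rightarrow> real measure" where
  "delta_potential_measure a t = scale_measure (ennreal \<bar>t\<bar>) (return borel a)"

end

theory Submission
  imports Defs "HOL-Complex_Analysis.Conformal_Mappings" "HOL-Real_Asymp.Real_Asymp"
begin

text \<open>
Away from the points \<open>0\<close> and \<open>a\<close> the equation \<open>D \<psi> = z \<psi>\<close> is the linear system
\<open>\<psi>\<^sub>1' = (m + z) \<psi>\<^sub>2\<close>, \<open>\<psi>\<^sub>2' = (m - z) \<psi>\<^sub>1\<close> with constant coefficients. For \<open>\<bar>z\<bar> < m\<close> let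
\<open>\<kappa> = sqrt (m\<^sup>2 - z\<^sup>2)\<close>, the root with positive real part. Up to a factor there is one solution on \<open>(0, a)\<close>
that satisfies the boundary condition at \<open>0\<close>, the solution \<open>L\<close> with \<open>L(0) = (1, c)\<close> and \<open>c = cot \<alpha>\<close>,
and one square-integrable solution on \<open>(a, \<infinity>)\<close>, namely \<open>exp (-\<kappa> x) (1, -\<kappa> / (m + z))\<close>.
The interface condition says that the first component is continuous at \<open>a\<close> and that the second one
jumps by \<open>t \<psi>\<^sub>1(a)\<close>. Continuing \<open>L\<close> by the decaying solution with the same first
component, the defect in the second condition is the number \<open>mismatch\<close>; \<open>z\<close> is an eigenvalue exactly where it vanishes.

Let \<open>q = 1 / c + 2 m a\<close>, so that \<open>t\<^sub>0 = -1 / q\<close>. As the energy tends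
to \<open>m\<close> from below, the mismatch tends to \<open>-c - t (1 + 2 m a c)\<close>, which is positive precisely when
\<open>t < t\<^sub>0\<close>. At energy \<open>0\<close> it equals \<open>-(1 + t) L\<^sub>1(a) - L\<^sub>2(a)\<close>, which is negative when \<open>t > -1\<close>. The
assumption \<open>q > 1\<close> says that \<open>-1 < t\<^sub>0\<close>; hence for \<open>0 < \<epsilon> < q\<^sup>2 - 1\<close> the number
\<open>t = -sqrt (1 + \<epsilon>) / q\<close> lies between \<open>-1\<close> and \<open>t\<^sub>0\<close>, and the intermediate value theorem gives a zero
(\<open>bound_state_energy\<close>). The double integral is \<open>t\<^sup>2 q\<^sup>2 = 1 + \<epsilon>\<close>.

The mismatch is a holomorphic function on the disc \<open>\<bar>z\<bar> < m\<close> which does not vanish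
at \<open>0\<close>, so its zeros are isolated. It remains to see that \<open>z\<close> is in the resolvent set when the
mismatch is nonzero (\<open>in_resolvent_set\<close>). The combinations \<open>P = \<kappa> \<psi>\<^sub>1 + (m + z) \<psi>\<^sub>2\<close> and
\<open>Q = \<kappa> \<psi>\<^sub>1 - (m + z) \<psi>\<^sub>2\<close> turn \<open>(D - z) \<psi> = f\<close> into the decoupled equations \<open>P' = \<kappa> P + F\<close> and
\<open>Q' = -\<kappa> Q + G\<close>. Both are solved on the whole line by convolution with one-sided exponentials,
which is bounded on \<open>L\<^sup>2\<close> (\<open>convolve_L2_nn\<close>) and inverts the equation weakly by Fubini's theorem
(\<open>convolve_weak_derivative\<close>). A solution of the homogeneous system on each side then corrects the
boundary and interface conditions; the linear equation for its coefficients has the mismatch as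
its determinant (\<open>bounded_solution\<close>).

The norm bound for the resolvent and the finite multiplicity both need that weak solutions of the
homogeneous system are the classical ones (\<open>homogeneous_solution\<close>). In the variables \<open>P\<close>, \<open>Q\<close> this
reduces to the scalar equation \<open>u' = k u\<close>; multiplying by \<open>exp (-k x)\<close> reduces it further to the
lemma of du Bois-Reymond: a function with vanishing weak derivative is constant
(\<open>zero_weak_deriv_imp_const\<close>).
\<close>

section \<open>Smooth functions and bumps\<close>

definition smooth :: "(real \<Rightarrow> real) \<Rightarrow> bool" where
  "smooth f \<longleftrightarrow> (\<forall>n x. (deriv ^^ n) f differentiable (at x))"

text \<open>
Exhibiting a class of functions that is closed under differentiation avoids formulas for the higher
derivatives.
\<close>

lemma smooth_if_derivative_closed:
  assumes S: "\<And>f. f \<in> S \<Longrightarrow> \<exists>f'\<in>S. \<forall>x. (f has_real_derivative f' x) (at x)" and "f \<in> S"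
  shows "smooth f"
proof -
  have "(deriv ^^ n) f \<in> S" for n
  proof (induction n)
    case (Suc n)
    from S[OF Suc] obtain f' where "f' \<in> S" "\<forall>x. ((deriv ^^ n) f has_real_derivative f' x) (at x)"
      by blast
    moreover from this have "deriv ((deriv ^^ n) f) = f'"
      by (intro ext DERIV_imp_deriv) auto
    ultimately show ?case by simp
  qed (use assms in simp)
  then show ?thesis
    unfolding smooth_def using S real_differentiable_def by meson
qed

lemma smooth_has_deriv: "smooth f \<Longrightarrow> (f has_real_derivative deriv f x) (at x)"
  unfolding smooth_def
  by (metis funpow_0 DERIV_deriv_iff_real_differentiable)

lemma smooth_deriv: "smooth f \<Longrightarrow> smooth (deriv f)"
  unfolding smooth_def by (metis comp_apply funpow_Suc_right)

lemma smooth_primitive: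
  assumes "smooth b" "\<And>x. (f has_real_derivative b x) (at x)"
  shows "smooth f"
proof -
  have d: "deriv f = b"
    using assms(2) by (intro ext DERIV_imp_deriv) auto
  have "(deriv ^^ n) f differentiable (at x)" for n x
    using assms d by (cases n) (auto simp: smooth_def funpow_Suc_right real_differentiable_def simp del: funpow.simps(2))
  then show ?thesis by (simp add: smooth_def)
qed

lemma smooth_continuous_on: "smooth f \<Longrightarrow> continuous_on A f"
  by (meson DERIV_isCont continuous_at_imp_continuous_on smooth_has_deriv)

text \<open>
The product rule leads from a product to a sum of two products, so the class that is closed under
differentiation must contain finite sums of products.
\<close>

inductive_set smooth_products :: "(real \<Rightarrow> real) set" where
  base: "smooth f \<Longrightarrow> smooth g \<Longrightarrow> (\<lambda>x. f x * g x) \<in> smooth_products"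
| add: "f \<in> smooth_products \<Longrightarrow> g \<in> smooth_products \<Longrightarrow> (\<lambda>x. f x + g x) \<in> smooth_products"

lemma smooth_mult:
  assumes "smooth f" "smooth g"
  shows "smooth (\<lambda>x. f x * g x)"
proof (rule smooth_if_derivative_closed[of smooth_products])
  fix h assume "h \<in> smooth_products"
  then show "\<exists>h'\<in>smooth_products. \<forall>x. (h has_real_derivative h' x) (at x)"
  proof induction
    case (base f g)
    have "((\<lambda>x. f x * g x) has_real_derivative deriv f x * g x + f x * deriv g x) (at x)" for x
      using smooth_has_deriv[OF base(1), of x] smooth_has_deriv[OF base(2), of x]
      by (auto intro!: derivative_eq_intros)
    moreover have "(\<lambda>x. deriv f x * g x + f x * deriv g x) \<in> smooth_products"
      using base by (intro smooth_products.intros smooth_deriv)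
    ultimately show ?case
      by (intro bexI[of _ "\<lambda>x. deriv f x * g x + f x * deriv g x"]) auto
  next
    case (add f g)
    then obtain f' g' where *: "f' \<in> smooth_products" "\<forall>x. (f has_real_derivative f' x) (at x)"
      "g' \<in> smooth_products" "\<forall>x. (g has_real_derivative g' x) (at x)" by blast
    show ?case
      by (rule bexI[of _ "\<lambda>x. f' x + g' x"])
        (use * in \<open>auto intro!: smooth_products.add derivative_intros\<close>)
  qed
qed (intro smooth_products.base assms)

lemma smooth_affine:
  assumes "smooth g"
  shows "smooth (\<lambda>x. k * g (c * x + d))"
proof (rule smooth_if_derivative_closed[of "{\<lambda>x. k * g (c * x + d) | k g. smooth g}"])
  fix f assume "f \<in> {\<lambda>x. k * g (c * x + d) | k g. smooth g}"
  then obtain k g where f: "f = (\<lambda>x. k * g (c * x + d))" and g: "smooth g" by blast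
  have "(f has_real_derivative (k * c) * deriv g (c * x + d)) (at x)" for x
  proof -
    have "((\<lambda>x. c * x + d) has_real_derivative c) (at x)"
      by (auto intro!: derivative_eq_intros)
    from DERIV_cmult[OF DERIV_chain'[OF this smooth_has_deriv[OF g]], of k] show ?thesis
      unfolding f by (simp add: mult_ac)
  qed
  then show "\<exists>f'\<in>{\<lambda>x. k * g (c * x + d) | k g. smooth g}. \<forall>x. (f has_real_derivative f' x) (at x)"
    using smooth_deriv[OF g]
    by (intro bexI[of _ "\<lambda>x. (k * c) * deriv g (c * x + d)"]) auto
qed (use assms in blast)

lemma smooth_diff:
  assumes "smooth f" "smooth g"
  shows "smooth (\<lambda>x. f x - k * g x)"
proof (rule smooth_if_derivative_closed[of "{\<lambda>x. f x - k * g x | f g. smooth f \<and> smooth g}"])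
  fix h assume "h \<in> {\<lambda>x. f x - k * g x | f g. smooth f \<and> smooth g}"
  then obtain f g where h: "h = (\<lambda>x. f x - k * g x)" "smooth f" "smooth g" by blast
  have "(h has_real_derivative deriv f x - k * deriv g x) (at x)" for x
    unfolding h by (intro DERIV_diff DERIV_cmult smooth_has_deriv h)
  then show "\<exists>h'\<in>{\<lambda>x. f x - k * g x | f g. smooth f \<and> smooth g}.
      \<forall>x. (h has_real_derivative h' x) (at x)"
    using h smooth_deriv by (intro bexI[of _ "\<lambda>x. deriv f x - k * deriv g x"]) blast+
qed (use assms in blast)

text \<open>
These functions are the real and imaginary parts of complex exponentials, by which real test
functions are multiplied in order to solve \<open>u' = k u\<close>.
\<close>

lemma smooth_exp_trig:
  "smooth (\<lambda>x. exp (\<mu> * x) * (p * cos (\<nu> * x) + q * sin (\<nu> * x)))"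
proof (rule smooth_if_derivative_closed
    [of "{\<lambda>x. exp (\<mu> * x) * (p * cos (\<nu> * x) + q * sin (\<nu> * x)) | p q. True}"])
  fix f assume "f \<in> {\<lambda>x. exp (\<mu> * x) * (p * cos (\<nu> * x) + q * sin (\<nu> * x)) | p q. True}"
  then obtain p q where f: "f = (\<lambda>x. exp (\<mu> * x) * (p * cos (\<nu> * x) + q * sin (\<nu> * x)))"
    by blast
  have "(f has_real_derivative exp (\<mu> * x) *
      ((\<mu> * p + \<nu> * q) * cos (\<nu> * x) + (\<mu> * q - \<nu> * p) * sin (\<nu> * x))) (at x)" for x
    unfolding f by (auto intro!: derivative_eq_intros simp: algebra_simps)
  then show "\<exists>f'\<in>{\<lambda>x. exp (\<mu> * x) * (p * cos (\<nu> * x) + q * sin (\<nu> * x)) | p q. True}.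
      \<forall>x. (f has_real_derivative f' x) (at x)"
    by (intro bexI[of _ "\<lambda>x. exp (\<mu> * x) *
      ((\<mu> * p + \<nu> * q) * cos (\<nu> * x) + (\<mu> * q - \<nu> * p) * sin (\<nu> * x))"]) auto
qed blast

text \<open>
The factor \<open>y ^ k\<close> makes the induction over the coefficients of \<open>p\<close> go through.
\<close>

lemma poly_exp_decay: "((\<lambda>y::real. y ^ k * poly p y * exp (- y)) \<longlongrightarrow> 0) at_top"
proof (induction p arbitrary: k)
  case (pCons a p)
  have "((\<lambda>y. a * (y ^ k / exp y) + y ^ Suc k * poly p y * exp (- y)) \<longlongrightarrow> a * 0 + 0) at_top"
    by (intro tendsto_intros tendsto_power_div_exp_0 pCons)
  moreover have "(\<lambda>y. a * (y ^ k / exp y) + y ^ Suc k * poly p y * exp (- y)) =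
      (\<lambda>y. y ^ k * poly (pCons a p) y * exp (- y))"
    by (simp add: fun_eq_iff exp_minus field_simps)
  ultimately show ?case by simp
qed simp

text \<open>
The standard smooth function that is flat at \<open>0\<close>.
\<close>

definition flat_exp :: "real \<Rightarrow> real" where
  "flat_exp x = (if x > 0 then exp (- (1 / x)) else 0)"

text \<open>
For \<open>x > 0\<close> every derivative is a polynomial in \<open>1 / x\<close> times \<open>exp (-1 / x)\<close>, and all these functions
vanish at \<open>0\<close> to every order.
\<close>

lemma smooth_flat_exp: "smooth flat_exp"
proof -
  define e where "e p x = (if x > 0 then poly p (1 / x) * exp (- (1 / x)) else 0)"
    for p and x :: real
  have "\<exists>f'\<in>range e. \<forall>x. (e p has_real_derivative f' x) (at x)" for p
  \<comment> \<open>With \<open>y = 1 / x\<close> the derivative of \<open>p(y) exp (-y)\<close> is \<open>y\<^sup>2 (p(y) - p'(y)) exp (-y)\<close>.\<close>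
  proof (intro bexI[of _ "e (monom 1 2 * (p - pderiv p))"] allI)
    fix x :: real
    let ?q = "monom 1 2 * (p - pderiv p)"
    consider "x > 0" | "x < 0" | "x = 0" by linarith
    then show "(e p has_real_derivative e ?q x) (at x)"
    proof cases
      case 1
      have "((\<lambda>x. poly p (1 / x) * exp (- (1 / x))) has_real_derivative
          poly ?q (1 / x) * exp (- (1 / x))) (at x)"
        using 1
        by (auto intro!: derivative_eq_intros DERIV_chain'[where g = "poly p"] poly_DERIV
            simp: poly_monom field_simps power2_eq_square)
      moreover have "eventually (\<lambda>y. e p y = poly p (1 / y) * exp (- (1 / y))) (nhds x)"
        using eventually_nhds_in_open[of "{0<..}" x] 1 by (auto elim!: eventually_mono simp: e_def)
      ultimately show ?thesis
        using 1 DERIV_cong_ev[OF refl _ refl] by (fastforce simp: e_def)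
    next
      case 2
      have "((\<lambda>x. 0) has_real_derivative 0) (at x)" by simp
      moreover have "eventually (\<lambda>y. e p y = 0) (nhds x)"
        using eventually_nhds_in_open[of "{..<0}" x] 2 by (auto elim!: eventually_mono simp: e_def)
      ultimately show ?thesis
        using 2 DERIV_cong_ev[OF refl _ refl, of "e p" "\<lambda>_. 0"] by (auto simp: e_def)
    next
      case 3
      have "((\<lambda>h. e p h / h) \<longlongrightarrow> 0) (at_right 0)"
      proof -
        have "((\<lambda>h::real. (1 / h) ^ 1 * poly p (1 / h) * exp (- (1 / h))) \<longlongrightarrow> 0) (at_right 0)"
          using filterlim_compose[OF poly_exp_decay[of 1 p] filterlim_inverse_at_top_right]
          by (simp add: inverse_eq_divide)
        then show ?thesis
          by (rule Lim_transform_eventually)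
            (auto simp: e_def eventually_at_filter intro!: always_eventually)
      qed
      moreover have "((\<lambda>h. e p h / h) \<longlongrightarrow> 0) (at_left 0)"
        by (rule Lim_transform_eventually[OF tendsto_const])
          (auto simp: e_def eventually_at_filter intro!: always_eventually)
      ultimately have "((\<lambda>h. e p h / h) \<longlongrightarrow> 0) (at 0)"
        by (simp add: filterlim_split_at)
      then show ?thesis
        using 3 by (simp add: DERIV_def e_def)
    qed
  qed simp
  then have "smooth (e 1)"
    by (intro smooth_if_derivative_closed[of "range e"]) auto
  moreover have "e 1 = flat_exp" by (auto simp: e_def flat_exp_def fun_eq_iff)
  ultimately show ?thesis by simp
qed

text \<open>
The support is \<open>[s, t]\<close> for every \<open>n > 0\<close>, and as \<open>n\<close> grows the bumps increase to the indicator of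
\<open>(s, t)\<close>. Thus indicators of intervals are bounded limits of test functions supported in the same
interval.
\<close>

definition bump :: "real \<Rightarrow> real \<Rightarrow> real \<Rightarrow> real \<Rightarrow> real" where
  "bump n s t x = flat_exp (n * (x - s)) * flat_exp (n * (t - x))"

lemma smooth_bump: "smooth (bump n s t)"
proof -
  have "smooth (\<lambda>x. (1 * flat_exp (n * x + (- n * s))) * (1 * flat_exp ((- n) * x + n * t)))"
    by (intro smooth_mult smooth_affine smooth_flat_exp)
  moreover have "bump n s t = (\<lambda>x. (1 * flat_exp (n * x + (- n * s))) * (1 * flat_exp ((- n) * x + n * t)))"
    by (simp add: bump_def fun_eq_iff right_diff_distrib add.commute)
  ultimately show ?thesis by simp
qed

lemma flat_exp_bounds: "0 \<le> flat_exp x" "flat_exp x \<le> 1"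
  by (auto simp: flat_exp_def)

lemma bump_bounds: "0 \<le> bump n s t x" "bump n s t x \<le> 1"
  by (auto simp: bump_def flat_exp_bounds mult_le_one)

lemma bump_eq_0: "n > 0 \<Longrightarrow> x \<le> s \<or> x \<ge> t \<Longrightarrow> bump n s t x = 0"
  by (auto simp: bump_def flat_exp_def zero_less_mult_iff)

lemma bump_pos: "n > 0 \<Longrightarrow> s < x \<Longrightarrow> x < t \<Longrightarrow> bump n s t x > 0"
  by (auto simp: bump_def flat_exp_def zero_less_mult_iff)

lemma bump_tendsto_1:
  assumes "s < x" "x < t"
  shows "(\<lambda>n. bump (real (Suc n)) s t x) \<longlonglongrightarrow> 1"
proof -
  have "(\<lambda>n. exp (- (1 / (real (Suc n) * (x - s)))) * exp (- (1 / (real (Suc n) * (t - x)))))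
      \<longlonglongrightarrow> exp (- 0) * exp (- 0)"
  proof (intro tendsto_intros)
    have *: "(\<lambda>n. 1 / (real (Suc n) * d)) \<longlonglongrightarrow> 0" if "d > 0" for d
      using tendsto_mult[OF LIMSEQ_inverse_real_of_nat tendsto_const[of "1 / d"]]
      by (simp add: field_simps)
    show "(\<lambda>n. 1 / (real (Suc n) * (x - s))) \<longlonglongrightarrow> 0" "(\<lambda>n. 1 / (real (Suc n) * (t - x))) \<longlonglongrightarrow> 0"
      using * assms by auto
  qed
  then show ?thesis
    using assms by (simp add: bump_def flat_exp_def)
qed

section \<open>Functions with vanishing weak derivative\<close>

lemma test_functions_iff:
  "\<phi> \<in> test_functions \<Omega> \<longleftrightarrow>
    smooth \<phi> \<and> (\<exists>K. compact K \<and> K \<subseteq> \<Omega> \<and> (\<forall>x. x \<notin> K \<longrightarrow> \<phi> x = 0))"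
  by (simp add: test_functions_def smooth_def)

lemma deriv_eq_0_outside:
  assumes "compact K" "\<And>x. x \<notin> K \<Longrightarrow> \<phi> x = (0::real)" "x \<notin> K"
  shows "deriv \<phi> x = 0"
proof -
  have "open (- K)"
    using assms(1) by (simp add: compact_imp_closed open_Compl)
  then have "eventually (\<lambda>y. \<phi> y = 0) (nhds x)"
    using eventually_nhds_in_open[of "- K" x] assms(2,3) by (auto elim: eventually_mono)
  then have "(\<phi> has_real_derivative 0) (at x)"
    using DERIV_cong_ev[OF refl _ refl, of \<phi> "\<lambda>_. 0"] by auto
  then show ?thesis by (rule DERIV_imp_deriv)
qed

text \<open>
Integrals may be moved between domains as long as the integrand vanishes on the difference; test
functions and their derivatives are always cut off in this way.
\<close>

lemma lebesgue_on_supported: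
  fixes f :: "real \<Rightarrow> 'b::euclidean_space"
  assumes "S \<in> sets lebesgue" "T \<in> sets lebesgue" "S \<subseteq> T" "\<And>x. x \<in> T - S \<Longrightarrow> f x = 0"
  shows "integrable (lebesgue_on T) f \<longleftrightarrow> integrable (lebesgue_on S) f"
    and "integral\<^sup>L (lebesgue_on T) f = integral\<^sup>L (lebesgue_on S) f"
proof -
  have "(\<lambda>x. indicat_real T x *\<^sub>R f x) = (\<lambda>x. indicat_real S x *\<^sub>R f x)"
    using assms(3,4) by (auto simp: fun_eq_iff indicator_def)
  then show "integrable (lebesgue_on T) f \<longleftrightarrow> integrable (lebesgue_on S) f"
    and "integral\<^sup>L (lebesgue_on T) f = integral\<^sup>L (lebesgue_on S) f"
    using assms(1,2) by (simp_all add: integrable_restrict_space integral_restrict_space)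
qed

lemma integrable_continuous_mult:
  fixes w g :: "real \<Rightarrow> complex"
  assumes "integrable (lebesgue_on {c..d}) w" and g: "continuous_on {c..d} g"
  shows "integrable (lebesgue_on {c..d}) (\<lambda>x. g x * w x)"
proof -
  have [measurable]: "w \<in> borel_measurable (lebesgue_on {c..d})"
    using assms(1) by simp
  have [measurable]: "g \<in> borel_measurable (lebesgue_on {c..d})"
    using g by (intro continuous_imp_measurable_on_sets_lebesgue) auto
  obtain B where B: "\<forall>x\<in>{c..d}. norm (g x) \<le> B"
    using compact_imp_bounded[OF compact_continuous_image[OF g compact_Icc]]
    unfolding bounded_iff by auto
  show ?thesis
  proof (rule Bochner_Integration.integrable_bound[of _ "\<lambda>x. B * norm (w x)"])
    show "AE x in lebesgue_on {c..d}. norm (g x * w x) \<le> norm (B * norm (w x))"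
    proof (rule AE_I2)
      fix x assume "x \<in> space (lebesgue_on {c..d})"
      then have "norm (g x) \<le> B" using B by simp
      then have "norm (g x) \<le> \<bar>B\<bar>" by linarith
      then show "norm (g x * w x) \<le> norm (B * norm (w x))"
        by (simp add: norm_mult abs_mult mult_right_mono)
    qed
  qed (use assms in auto)
qed

lemma integrable_continuous_scaleR:
  fixes w :: "real \<Rightarrow> complex" and f :: "real \<Rightarrow> real"
  assumes "integrable (lebesgue_on {c..d}) w" "continuous_on {c..d} f"
  shows "integrable (lebesgue_on {c..d}) (\<lambda>x. f x *\<^sub>R w x)"
  unfolding scaleR_conv_of_real
  by (intro integrable_continuous_mult assms continuous_on_of_real)

text \<open>
The primitive starting to the left of the support is zero there, and it is zero to the right of the
support because the mean of \<open>h\<close> vanishes.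
\<close>

lemma mean_zero_is_deriv_of_test_function:
  fixes h :: "real \<Rightarrow> real"
  assumes h: "smooth h" "\<And>x. x \<notin> {c..d} \<Longrightarrow> h x = 0" and cd: "{c..d} \<subseteq> I"
    and mean: "integral\<^sup>L (lebesgue_on {c..d}) h = 0"
  shows "\<exists>\<phi>\<in>test_functions I. deriv \<phi> = h"
proof -
  have cont: "continuous_on A h" for A
    using h(1) by (rule smooth_continuous_on)
  have int: "h integrable_on {u..v}" for u v
    by (intro integrable_continuous_real cont)
  \<comment> \<open>Starting at \<open>c - 1\<close> rather than \<open>c\<close> makes every \<open>x \<ge> c\<close> an interior point.\<close>
  define \<phi> where "\<phi> x = integral {c - 1..x} h" for x
  have left: "\<phi> x = 0" if "x < c" for x
  proof -
    have "\<phi> x = integral {c - 1..x} (\<lambda>_. 0)"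
      unfolding \<phi>_def using that h(2) by (intro integral_cong) auto
    then show ?thesis by simp
  qed
  have D: "(\<phi> has_real_derivative h x) (at x)" for x
  proof (cases "x < c")
    case True
    then have "eventually (\<lambda>y. \<phi> y = 0) (nhds x)"
      using eventually_nhds_in_open[of "{..<c}" x] left by (auto elim: eventually_mono)
    then show ?thesis
      using DERIV_cong_ev[OF refl _ refl, of \<phi> "\<lambda>_. 0"] h(2) True by auto
  next
    case False
    have "(\<phi> has_real_derivative h x) (at x within {c - 1..x + 1})"
      unfolding \<phi>_def using False by (intro integral_has_real_derivative cont) auto
    then show ?thesis
      using False by (simp add: at_within_Icc_at)
  qed
  have right: "\<phi> x = 0" if "x > d" "c \<le> d" for x
  proof -
    have "\<phi> x = integral {c - 1..c} h + integral {c..d} h + integral {d..x} h"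
      unfolding \<phi>_def using that
      by (simp add: Henstock_Kurzweil_Integration.integral_combine[where c = d and b = x]
          Henstock_Kurzweil_Integration.integral_combine[where c = c and b = d] int)
    moreover have "integral {c - 1..c} h = integral {c - 1..c} (\<lambda>_. 0)"
      by (rule integral_spike[of "{c}"]) (auto simp: h(2))
    moreover have "integral {d..x} h = integral {d..x} (\<lambda>_. 0)"
      by (rule integral_spike[of "{d}"]) (auto simp: h(2))
    moreover have "integral {c..d} h = 0"
      using mean lebesgue_integral_eq_integral[OF continuous_imp_integrable_real[OF cont]] by auto
    ultimately show ?thesis by simp
  qed
  have "\<phi> x = 0" if "x \<notin> {c..d}" for x
  proof (cases "c \<le> d")
    case True
    then show ?thesis using that left right by force
  next
    case False
    then have "h = (\<lambda>_. 0)" using h(2) by (intro ext) auto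
    then show ?thesis by (simp add: \<phi>_def)
  qed
  then have "\<phi> \<in> test_functions I"
    using smooth_primitive[OF h(1) D] cd unfolding test_functions_iff
    by (blast intro: compact_Icc)
  moreover have "deriv \<phi> = h"
    using D by (intro ext DERIV_imp_deriv) auto
  ultimately show ?thesis by blast
qed

text \<open>
Almost every point is the limit of the averages of \<open>v\<close> over shrinking intervals (Lebesgue's
differentiation theorem), and these averages are zero. The differentiation theorem is about
functions on the whole line, so it is applied to the restriction of \<open>v\<close> to compact intervals, and
countably many of them, with rational endpoints, cover \<open>I\<close>.
\<close>

lemma AE_eq_if_interval_integrals_eq_0:
  fixes v :: "real \<Rightarrow> complex"
  assumes "open I"
    and loc: "\<And>c d. {c..d} \<subseteq> I \<Longrightarrow> integrable (lebesgue_on {c..d}) v"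
    and zero: "\<And>c d. {c..d} \<subseteq> I \<Longrightarrow> integral\<^sup>L (lebesgue_on {c..d}) v = 0"
  shows "AE x in lebesgue_on I. v x = 0"
proof -
  have local: "\<exists>N. negligible N \<and> (\<forall>x\<in>{s<..<t} - N. v x = 0)" if st: "{s..t} \<subseteq> I" for s t
  proof -
    define f where "f x = (if x \<in> {s..t} then v x else 0)" for x
    have "f integrable_on {s..t}"
    proof -
      have "v integrable_on {s..t}"
        using integrable_on_lebesgue_on[OF loc[OF st]] by simp
      then show ?thesis
        by (rule integrable_eq) (simp add: f_def)
    qed
    then have "f integrable_on UNIV"
      by (rule integrable_on_superset) (auto simp: f_def)
    then have f: "f integrable_on cbox a b" for a b :: real
      by (rule integrable_on_subcbox) auto
    obtain N where N: "negligible N"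
      and diff: "\<And>x e. x \<notin> N \<Longrightarrow> 0 < e \<Longrightarrow> \<exists>d>0. \<forall>h. 0 < h \<and> h < d \<longrightarrow>
          norm (integral (cbox x (x + h *\<^sub>R One)) f /\<^sub>R h ^ DIM(real) - f x) < e"
      using integrable_ccontinuous_explicit[of f] f by blast
    have "v x = 0" if x: "x \<in> {s<..<t} - N" for x
    proof (rule ccontr)
      assume "v x \<noteq> 0"
      then obtain d where d: "d > 0" "\<And>h. 0 < h \<Longrightarrow> h < d \<Longrightarrow>
          norm (integral (cbox x (x + h *\<^sub>R One)) f /\<^sub>R h ^ DIM(real) - f x) < norm (v x)"
        using diff[of x "norm (v x)"] x by auto
      define h where "h = min (d / 2) (t - x)"
      have h: "0 < h" "h < d" "x + h \<le> t"
        using d(1) x by (auto simp: h_def min_def)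
      have sub: "{x..x + h} \<subseteq> {s..t}" using x h by auto
      have "integral {x..x + h} f = integral {x..x + h} v"
        using sub by (intro integral_cong) (auto simp: f_def)
      also have "\<dots> = integral\<^sup>L (lebesgue_on {x..x + h}) v"
        by (rule lebesgue_integral_eq_integral[symmetric, OF loc[OF subset_trans[OF sub st]]]) simp
      also have "\<dots> = 0"
        by (rule zero[OF subset_trans[OF sub st]])
      finally have "norm (f x) < norm (v x)"
        using d(2)[OF h(1,2)] by (simp add: cbox_interval)
      then show False using x by (simp add: f_def)
    qed
    then show ?thesis using N by blast
  qed
  obtain N where N: "\<And>s t. {s..t} \<subseteq> I \<Longrightarrow> negligible (N s t)"
    "\<And>s t x. {s..t} \<subseteq> I \<Longrightarrow> x \<in> {s<..<t} - N s t \<Longrightarrow> v x = 0"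
    using local by metis
  define Q where "Q = {p \<in> \<rat> \<times> \<rat>. {fst p..snd p} \<subseteq> I}"
  have "countable Q"
    unfolding Q_def by (rule countable_subset[of _ "\<rat> \<times> \<rat>"]) (auto simp: countable_rat)
  then have neg: "negligible (\<Union>p\<in>Q. N (fst p) (snd p))"
    unfolding negligible_iff_null_sets
    by (intro null_sets_UN') (auto simp: Q_def N(1) simp flip: negligible_iff_null_sets)
  have "v x = 0" if "x \<in> I" "x \<notin> (\<Union>p\<in>Q. N (fst p) (snd p))" for x
  proof -
    obtain e where e: "e > 0" "ball x e \<subseteq> I"
      using \<open>open I\<close> \<open>x \<in> I\<close> open_contains_ball by blast
    obtain s where s: "s \<in> \<rat>" "x - e < s" "s < x"
      using Rats_dense_in_real[of "x - e" x] e by auto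
    obtain t where t: "t \<in> \<rat>" "x < t" "t < x + e"
      using Rats_dense_in_real[of x "x + e"] e by auto
    have sub: "{s..t} \<subseteq> I"
      using e(2) s t by (force simp: ball_def dist_real_def subset_eq)
    then have "(s, t) \<in> Q" using s t by (simp add: Q_def)
    then show ?thesis using N(2)[OF sub, of x] that(2) s t by force
  qed
  moreover have "AE x in lebesgue_on I. x \<in> I"
    by (rule AE_I2) simp
  moreover have "AE x in lebesgue_on I. x \<notin> (\<Union>p\<in>Q. N (fst p) (snd p))"
    using neg \<open>open I\<close> unfolding negligible_iff_null_sets
    by (subst AE_restrict_space_iff) (auto dest!: AE_not_in)
  ultimately show ?thesis by (auto elim: eventually_elim2)
qed

text \<open>
The lemma of du Bois-Reymond. Fix a bump \<open>\<rho>\<close> with integral \<open>r\<close>. For any other bump \<open>b\<close> with integral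
\<open>\<beta>\<close> the function \<open>b - (\<beta> / r) \<rho>\<close> has mean zero, so it is the derivative of a test function, and the
hypothesis gives \<open>\<integral> b w = \<beta> C\<close> with \<open>C = \<integral> \<rho> w / r\<close>. Letting \<open>b\<close> tend to the indicator of an
interval shows that \<open>w - C\<close> integrates to zero over every interval.
\<close>

lemma zero_weak_deriv_imp_const:
  fixes w :: "real \<Rightarrow> complex"
  assumes I: "open I" "is_interval I"
    and loc: "\<And>c d. {c..d} \<subseteq> I \<Longrightarrow> integrable (lebesgue_on {c..d}) w"
    and weak: "\<And>\<phi>. \<phi> \<in> test_functions I \<Longrightarrow> (LINT x|lebesgue_on I. deriv \<phi> x *\<^sub>R w x) = 0"
  shows "\<exists>C. AE x in lebesgue_on I. w x = C"
proof (cases "I = {}")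
  case False
  then obtain x0 e where e: "e > 0" "ball x0 e \<subseteq> I"
    using I(1) open_contains_ball by blast
  define s0 t0 where "s0 = x0 - e / 2" and "t0 = x0 + e / 2"
  have st0: "s0 < t0" "{s0..t0} \<subseteq> I"
    using e by (auto simp: s0_def t0_def ball_def dist_real_def subset_eq abs_le_iff)
  define \<rho> where "\<rho> = bump 1 s0 t0"
  define r where "r = integral\<^sup>L (lebesgue_on {s0..t0}) \<rho>"
  have cont: "continuous_on A (bump n s t)" for A n s t
    by (intro smooth_continuous_on smooth_bump)
  have leb[simp]: "I \<in> sets lebesgue"
    using I(1) by (simp add: borel_open)
  have "r > 0"
  proof -
    have "r = integral {s0..t0} \<rho>"
      unfolding r_def \<rho>_def by (intro lebesgue_integral_eq_integral continuous_imp_integrable_real cont) auto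
    moreover have "integral {s0..t0} \<rho> \<noteq> 0"
      using integral_eq_0_iff[of s0 t0 \<rho>] st0(1) bump_bounds(1) bump_pos[of 1 s0 "(s0 + t0) / 2" t0]
      by (force simp: \<rho>_def cont)
    moreover have "integral {s0..t0} \<rho> \<ge> 0"
      by (simp add: \<rho>_def bump_bounds(1) integral_nonneg integrable_continuous_real cont)
    ultimately show ?thesis by linarith
  qed
  define C where "C = (LINT x|lebesgue_on {s0..t0}. \<rho> x *\<^sub>R w x) /\<^sub>R r"
  have key: "(LINT x|lebesgue_on {s..t}. b x *\<^sub>R (w x - C)) = 0"
    if st: "{s..t} \<subseteq> I" "s \<le> t" and b: "b = bump (real (Suc n)) s t" for s t b n
  proof -
    define c d where "c = min s s0" and "d = max t t0"
    have sub: "{s..t} \<subseteq> {c..d}" "{s0..t0} \<subseteq> {c..d}" by (auto simp: c_def d_def)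
    have "s \<in> I" "t \<in> I" "s0 \<in> I" "t0 \<in> I"
      using st st0 by (auto intro: subsetD[OF st(1)] subsetD[OF st0(2)])
    then have "c \<in> I" "d \<in> I"
      unfolding c_def d_def min_def max_def by presburger+
    then have cd: "{c..d} \<subseteq> I"
      using mem_is_interval_1_I[OF I(2)] by (meson atLeastAtMost_iff subsetI)
    have b0: "b x = 0" if "x \<notin> {s..t}" for x
      using that unfolding b by (intro bump_eq_0) auto
    have \<rho>0: "\<rho> x = 0" if "x \<notin> {s0..t0}" for x
      using that unfolding \<rho>_def by (intro bump_eq_0) auto
    define \<beta> where "\<beta> = integral\<^sup>L (lebesgue_on {s..t}) b"
    define h where "h x = b x - (\<beta> / r) * \<rho> x" for x
    have contb: "continuous_on A b" "continuous_on A \<rho>" for A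
      by (simp_all add: b \<rho>_def cont)
    have intb: "integrable (lebesgue_on {c..d}) b" "integrable (lebesgue_on {c..d}) \<rho>"
      by (intro continuous_imp_integrable_real contb)+
    have ib: "integral\<^sup>L (lebesgue_on {c..d}) b = \<beta>" "integral\<^sup>L (lebesgue_on {c..d}) \<rho> = r"
      using sub b0 \<rho>0 unfolding \<beta>_def r_def by (auto intro!: lebesgue_on_supported(2))
    have h0: "h x = 0" if "x \<notin> {c..d}" for x
      using that sub b0[of x] \<rho>0[of x] by (auto simp: h_def)
    have "\<exists>\<phi>\<in>test_functions I. deriv \<phi> = h"
    proof (rule mean_zero_is_deriv_of_test_function)
      show "smooth h"
        unfolding h_def[abs_def] b \<rho>_def by (intro smooth_diff smooth_bump)
      show "integral\<^sup>L (lebesgue_on {c..d}) h = 0"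
        unfolding h_def using intb ib \<open>r > 0\<close> by simp
    qed (fact h0 cd)+
    then have "0 = (LINT x|lebesgue_on I. h x *\<^sub>R w x)"
      using weak by auto
    also have "\<dots> = (LINT x|lebesgue_on {c..d}. h x *\<^sub>R w x)"
      using cd h0 by (intro lebesgue_on_supported(2)) auto
    also have "\<dots> = (LINT x|lebesgue_on {c..d}. b x *\<^sub>R w x)
        - (LINT x|lebesgue_on {c..d}. (\<beta> / r) *\<^sub>R (\<rho> x *\<^sub>R w x))"
      unfolding h_def scaleR_diff_left scaleR_scaleR[symmetric]
      by (intro Bochner_Integration.integral_diff Bochner_Integration.integrable_scaleR_right
          integrable_continuous_scaleR loc cd contb)
    also have "(LINT x|lebesgue_on {c..d}. (\<beta> / r) *\<^sub>R (\<rho> x *\<^sub>R w x)) =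
        (\<beta> / r) *\<^sub>R (LINT x|lebesgue_on {c..d}. \<rho> x *\<^sub>R w x)"
      by (rule Bochner_Integration.integral_scaleR_right)
    also have "(LINT x|lebesgue_on {c..d}. \<rho> x *\<^sub>R w x) = (LINT x|lebesgue_on {s0..t0}. \<rho> x *\<^sub>R w x)"
      using sub \<rho>0 by (intro lebesgue_on_supported(2)) auto
    also have "(\<beta> / r) *\<^sub>R (LINT x|lebesgue_on {s0..t0}. \<rho> x *\<^sub>R w x) = \<beta> *\<^sub>R C"
      by (simp add: C_def divide_inverse)
    also have "(LINT x|lebesgue_on {c..d}. b x *\<^sub>R w x) = (LINT x|lebesgue_on {s..t}. b x *\<^sub>R w x)"
      using sub b0 by (intro lebesgue_on_supported(2)) auto
    finally have *: "(LINT x|lebesgue_on {s..t}. b x *\<^sub>R w x) = \<beta> *\<^sub>R C" by simp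
    have intb': "integrable (lebesgue_on {s..t}) b"
      by (intro continuous_imp_integrable_real contb)
    have "(LINT x|lebesgue_on {s..t}. b x *\<^sub>R (w x - C)) =
        (LINT x|lebesgue_on {s..t}. b x *\<^sub>R w x) - (LINT x|lebesgue_on {s..t}. b x *\<^sub>R C)"
      unfolding scaleR_diff_right
      by (intro Bochner_Integration.integral_diff integrable_scaleR_left intb'
          integrable_continuous_scaleR loc st contb)
    then show ?thesis
      using * intb' by (simp add: \<beta>_def)
  qed
  have "AE x in lebesgue_on I. w x - C = 0"
  proof (rule AE_eq_if_interval_integrals_eq_0[OF I(1)])
    fix s t assume st: "{s..t} \<subseteq> I"
    show int: "integrable (lebesgue_on {s..t}) (\<lambda>x. w x - C)"
      by (intro Bochner_Integration.integrable_diff loc st continuous_imp_integrable_real continuous_on_const)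
    show "(LINT x|lebesgue_on {s..t}. w x - C) = 0"
    proof (cases "s \<le> t")
      case True
      let ?b = "\<lambda>n. bump (real (Suc n)) s t"
      have meas: "?b n \<in> borel_measurable (lebesgue_on {s..t})" for n
        by (intro continuous_imp_measurable_on_sets_lebesgue cont) auto
      have m2: "(\<lambda>x. w x - C) \<in> borel_measurable (lebesgue_on {s..t})"
        using int by simp
      have "(\<lambda>n. LINT x|lebesgue_on {s..t}. ?b n x *\<^sub>R (w x - C)) \<longlonglongrightarrow> (LINT x|lebesgue_on {s..t}. w x - C)"
      proof (rule integral_dominated_convergence[where w = "\<lambda>x. norm (w x - C)"])
        have "AE x in lebesgue. x \<notin> {s, t}"
          by (intro AE_not_in) (simp add: null_sets_completionI)
        then have "AE x in lebesgue_on {s..t}. x \<notin> {s, t}"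
          by (subst AE_restrict_space_iff) auto
        moreover have "AE x in lebesgue_on {s..t}. x \<in> {s..t}"
          by (rule AE_I2) simp
        ultimately show "AE x in lebesgue_on {s..t}. (\<lambda>n. ?b n x *\<^sub>R (w x - C)) \<longlonglongrightarrow> w x - C"
        proof eventually_elim
          case (elim x)
          then have "(\<lambda>n. ?b n x *\<^sub>R (w x - C)) \<longlonglongrightarrow> 1 *\<^sub>R (w x - C)"
            by (intro tendsto_intros bump_tendsto_1) auto
          then show ?case by simp
        qed
        show "AE x in lebesgue_on {s..t}. norm (?b n x *\<^sub>R (w x - C)) \<le> norm (w x - C)" for n
          by (intro AE_I2) (simp add: bump_bounds mult_left_le_one_le)
      qed (use int meas m2 in auto)
      then show ?thesis
        unfolding key[OF st True refl] LIMSEQ_const_iff by (rule sym)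
    qed simp
  qed
  then show ?thesis by (intro exI[of _ C]) simp
qed (auto intro!: exI AE_I2)

section \<open>Scalar square-integrable functions and exponential solutions\<close>

text \<open>
Scalar counterparts of the spinor notions \<open>L2\<close> and \<open>weak_deriv\<close>: the system is solved in linear
combinations of the two components.
\<close>

definition square_integrable :: "real set \<Rightarrow> (real \<Rightarrow> complex) \<Rightarrow> bool" where
  "square_integrable \<Omega> u \<longleftrightarrow> u \<in> borel_measurable (lebesgue_on \<Omega>) \<and>
     integrable (lebesgue_on \<Omega>) (\<lambda>x. (norm (u x))\<^sup>2)"

definition weak_derivative :: "real set \<Rightarrow> (real \<Rightarrow> complex) \<Rightarrow> (real \<Rightarrow> complex) \<Rightarrow> bool" where
  "weak_derivative \<Omega> u g \<longleftrightarrow> (\<forall>\<phi>\<in>test_functions \<Omega>.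
     (LINT x|lebesgue_on \<Omega>. deriv \<phi> x *\<^sub>R u x) = - (LINT x|lebesgue_on \<Omega>. \<phi> x *\<^sub>R g x))"

lemma integrable_lebesgue_on_subset:
  fixes f :: "real \<Rightarrow> 'b::{banach, second_countable_topology}"
  assumes "integrable (lebesgue_on T) f" "S \<in> sets lebesgue" "T \<in> sets lebesgue" "S \<subseteq> T"
  shows "integrable (lebesgue_on S) f"
proof -
  have "integrable lebesgue (\<lambda>x. indicat_real T x *\<^sub>R f x)"
    using assms(1) integrable_restrict_space[of T lebesgue f] assms(3) by simp
  then have "integrable lebesgue (\<lambda>x. indicat_real S x *\<^sub>R (indicat_real T x *\<^sub>R f x))"
    by (rule integrable_mult_indicator[OF assms(2)])
  moreover have "(\<lambda>x. indicat_real S x *\<^sub>R (indicat_real T x *\<^sub>R f x)) =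
      (\<lambda>x. indicat_real S x *\<^sub>R f x)"
    using assms(4) by (auto simp: fun_eq_iff indicator_def)
  ultimately show ?thesis
    using integrable_restrict_space[of S lebesgue f] assms(2) by simp
qed

lemma square_integrable_subset:
  assumes "square_integrable T u" "S \<in> sets lebesgue" "T \<in> sets lebesgue" "S \<subseteq> T"
  shows "square_integrable S u"
  unfolding square_integrable_def
proof
  show "u \<in> borel_measurable (lebesgue_on S)"
    using assms(1) by (intro measurable_restrict_mono[OF _ assms(4)]) (simp add: square_integrable_def)
  show "integrable (lebesgue_on S) (\<lambda>x. (norm (u x))\<^sup>2)"
    using assms(1) by (intro integrable_lebesgue_on_subset[OF _ assms(2-4)]) (simp add: square_integrable_def)
qed

lemma square_integrable_imp_locally_integrable:
  assumes "square_integrable T u" "T \<in> sets lebesgue" "{c..d} \<subseteq> T"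
  shows "integrable (lebesgue_on {c..d}) u"
proof -
  have u: "square_integrable {c..d} u"
    by (rule square_integrable_subset[OF assms(1) _ assms(2,3)]) simp
  have "integrable (lebesgue_on {c..d}) (\<lambda>x. 1 + (norm (u x))\<^sup>2)"
    using u unfolding square_integrable_def
    by (intro Bochner_Integration.integrable_add[OF continuous_imp_integrable_real[OF continuous_on_const]]) simp
  then show ?thesis
  proof (rule Bochner_Integration.integrable_bound)
    show "AE x in lebesgue_on {c..d}. norm (u x) \<le> norm (1 + (norm (u x))\<^sup>2)"
    proof (rule AE_I2)
      fix x
      have "0 \<le> (norm (u x) - 1)\<^sup>2" by (rule zero_le_power2)
      then have "2 * norm (u x) \<le> 1 + (norm (u x))\<^sup>2" unfolding power2_diff by simp
      then have "norm (u x) \<le> 1 + (norm (u x))\<^sup>2"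
        using norm_ge_zero[of "u x"] by linarith
      also have "\<dots> \<le> norm (1 + (norm (u x))\<^sup>2)"
        unfolding real_norm_def by (rule abs_ge_self)
      finally show "norm (u x) \<le> norm (1 + (norm (u x))\<^sup>2)" .
    qed
  qed (use u in \<open>simp add: square_integrable_def\<close>)
qed

lemma compact_subset_interval_obtain:
  assumes "compact K" "K \<subseteq> I" "is_interval (I :: real set)"
  obtains c d where "K \<subseteq> {c..d}" "{c..d} \<subseteq> I"
proof (cases "K = {}")
  case True
  then show ?thesis using that[of 1 0] by simp
next
  case False
  obtain c where c: "c \<in> K" "\<forall>x\<in>K. c \<le> x"
    using compact_attains_inf[OF assms(1) False] by blast
  obtain d where d: "d \<in> K" "\<forall>x\<in>K. x \<le> d"
    using compact_attains_sup[OF assms(1) False] by blast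
  have "{c..d} \<subseteq> I"
    using mem_is_interval_1_I[OF assms(3), of c d] c(1) d(1) assms(2)
    by (meson atLeastAtMost_iff subset_iff)
  moreover have "K \<subseteq> {c..d}" using c d by auto
  ultimately show ?thesis using that by blast
qed

lemma test_function_mult_smooth:
  assumes "\<phi> \<in> test_functions \<Omega>" "smooth f"
  shows "(\<lambda>x. \<phi> x * f x) \<in> test_functions \<Omega>"
proof -
  obtain K where "smooth \<phi>" "compact K" "K \<subseteq> \<Omega>" "\<forall>x. x \<notin> K \<longrightarrow> \<phi> x = 0"
    using assms(1) unfolding test_functions_iff by blast
  moreover from this have "\<forall>x. x \<notin> K \<longrightarrow> \<phi> x * f x = 0" by simp
  ultimately show ?thesis
    unfolding test_functions_iff using smooth_mult[OF _ assms(2)] by blast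
qed

lemma smooth_exp_cos: "smooth (\<lambda>x. exp (\<mu> * x) * cos (\<nu> * x))"
  and smooth_exp_sin: "smooth (\<lambda>x. exp (\<mu> * x) * sin (\<nu> * x))"
  using smooth_exp_trig[of \<mu> 1 \<nu> 0] smooth_exp_trig[of \<mu> 0 \<nu> 1] by simp_all

text \<open>
The product rule for \<open>\<phi> exp (-k x)\<close> with the exponential \<open>P + j Q\<close> split into its real and imaginary
part, where \<open>-k = m + j n\<close> and \<open>j\<close> stands for the imaginary unit; \<open>a\<close> and \<open>f\<close> are the values of \<open>\<phi>'\<close>
and \<open>\<phi>\<close>.
\<close>

lemma exp_multiplier_identity:
  fixes j :: complex
  assumes "j * j = - 1" "k = - m - j * n"
  shows "a * ((P + j * Q) * U) = (a * P + f * (m * P - n * Q)) * U +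
     j * ((a * Q + f * (m * Q + n * P)) * U) + (k * (f * P * U) + k * j * (f * Q * U))"
proof -
  have "(a * P + f * (m * P - n * Q)) * U + j * ((a * Q + f * (m * Q + n * P)) * U)
      + (k * (f * P * U) + k * j * (f * Q * U)) - a * ((P + j * Q) * U)
    = - f * n * Q * U * (1 + j * j)"
    unfolding assms(2) by (simp add: algebra_simps)
  then show ?thesis using assms(1) by simp
qed

text \<open>
A weak solution of \<open>u' = k u\<close> is classical: \<open>exp (-k x) u\<close> has weak derivative zero. Test functions
are real while \<open>exp (-k x)\<close> is complex, so the equation is tested with the real and the imaginary
part of \<open>\<phi> exp (-k x)\<close> separately.
\<close>

lemma weak_derivative_scaled_imp_exp:
  fixes u :: "real \<Rightarrow> complex"
  assumes I: "open I" "is_interval I"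
    and loc: "\<And>c d. {c..d} \<subseteq> I \<Longrightarrow> integrable (lebesgue_on {c..d}) u"
    and weak: "weak_derivative I u (\<lambda>x. k * u x)"
  shows "\<exists>C. AE x in lebesgue_on I. u x = C * exp (k * of_real x)"
proof -
  define e where "e x = exp (- (k * of_real x))" for x :: real
  define \<mu> \<nu> where "\<mu> = - Re k" and "\<nu> = - Im k"
  have k: "k = of_real (- \<mu>) + \<i> * of_real (- \<nu>)"
    by (simp add: \<mu>_def \<nu>_def complex_eq_iff)
  define p where "p x = exp (\<mu> * x) * cos (\<nu> * x)" for x
  define q where "q x = exp (\<mu> * x) * sin (\<nu> * x)" for x
  have e: "e x = of_real (p x) + \<i> * of_real (q x)" for x
    by (simp add: e_def p_def q_def \<mu>_def \<nu>_def complex_eq_iff Re_exp Im_exp)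
  have smooth: "smooth p" "smooth q"
    unfolding p_def[abs_def] q_def[abs_def] by (rule smooth_exp_cos smooth_exp_sin)+
  have dp: "deriv p x = \<mu> * p x - \<nu> * q x" for x
    unfolding p_def[abs_def] q_def
    by (rule DERIV_imp_deriv) (auto intro!: derivative_eq_intros)
  have dq: "deriv q x = \<mu> * q x + \<nu> * p x" for x
    unfolding q_def[abs_def] p_def
    by (rule DERIV_imp_deriv) (auto intro!: derivative_eq_intros)
  have conte: "continuous_on A e" for A
    unfolding e_def by (intro continuous_intros)
  have leb: "I \<in> sets lebesgue" using I(1) by (simp add: borel_open)
  have "\<exists>C. AE x in lebesgue_on I. e x * u x = C"
  proof (rule zero_weak_deriv_imp_const[OF I])
    show "integrable (lebesgue_on {c..d}) (\<lambda>x. e x * u x)" if "{c..d} \<subseteq> I" for c d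
      by (intro integrable_continuous_mult loc that conte)
    fix \<phi> assume \<phi>: "\<phi> \<in> test_functions I"
    then obtain K where K: "smooth \<phi>" "compact K" "K \<subseteq> I" "\<And>x. x \<notin> K \<Longrightarrow> \<phi> x = 0"
      unfolding test_functions_iff by blast
    obtain c d where cd: "K \<subseteq> {c..d}" "{c..d} \<subseteq> I"
      using compact_subset_interval_obtain[OF K(2,3) I(2)] .
    have int: "integrable (lebesgue_on I) (\<lambda>x. f x *\<^sub>R u x)"
      if "smooth f" "\<And>x. x \<notin> K \<Longrightarrow> f x = 0" for f
    proof -
      have "integrable (lebesgue_on {c..d}) (\<lambda>x. f x *\<^sub>R u x)"
        by (intro integrable_continuous_scaleR loc cd smooth_continuous_on that)
      moreover have "f x *\<^sub>R u x = 0" if "x \<in> I - {c..d}" for x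
      proof -
        have "x \<notin> K" using that cd(1) by blast
        then show ?thesis by (simp add: \<open>\<And>x. x \<notin> K \<Longrightarrow> f x = 0\<close>)
      qed
      ultimately show ?thesis
        by (subst lebesgue_on_supported(1)[of "{c..d}" I, OF _ leb cd(2)]) auto
    qed
    define \<phi>1 where "\<phi>1 x = \<phi> x * p x" for x
    define \<phi>2 where "\<phi>2 x = \<phi> x * q x" for x
    have test: "\<phi>1 \<in> test_functions I" "\<phi>2 \<in> test_functions I"
      unfolding \<phi>1_def[abs_def] \<phi>2_def[abs_def]
      by (intro test_function_mult_smooth \<phi> smooth)+
    have sm: "smooth \<phi>1" "smooth \<phi>2"
      using test by (auto simp: test_functions_iff)
    have z: "\<phi>1 x = 0" "\<phi>2 x = 0" if "x \<notin> K" for x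
      using K(4)[OF that] by (simp_all add: \<phi>1_def \<phi>2_def)
    have z': "deriv \<phi>1 x = 0" "deriv \<phi>2 x = 0" if "x \<notin> K" for x
      using deriv_eq_0_outside[of K \<phi>1 x] deriv_eq_0_outside[of K \<phi>2 x] K(2) z that by simp_all
    have "deriv \<phi>1 x = deriv \<phi> x * p x + deriv p x * \<phi> x"
      "deriv \<phi>2 x = deriv \<phi> x * q x + deriv q x * \<phi> x" for x
      unfolding \<phi>1_def[abs_def] \<phi>2_def[abs_def]
      by (rule DERIV_imp_deriv DERIV_mult smooth_has_deriv K(1) smooth)+
    then have d: "deriv \<phi>1 x = deriv \<phi> x * p x + \<phi> x * (\<mu> * p x - \<nu> * q x)"
      "deriv \<phi>2 x = deriv \<phi> x * q x + \<phi> x * (\<mu> * q x + \<nu> * p x)" for x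
      by (simp_all only: dp dq mult.commute)
    note w = weak[unfolded weak_derivative_def, rule_format]
    have i: "integrable (lebesgue_on I) (\<lambda>x. deriv \<phi>1 x *\<^sub>R u x)"
      "integrable (lebesgue_on I) (\<lambda>x. deriv \<phi>2 x *\<^sub>R u x)"
      "integrable (lebesgue_on I) (\<lambda>x. \<phi>1 x *\<^sub>R u x)"
      "integrable (lebesgue_on I) (\<lambda>x. \<phi>2 x *\<^sub>R u x)"
      by (rule int; (intro smooth_deriv sm z z'; assumption))+
    have "(LINT x|lebesgue_on I. deriv \<phi> x *\<^sub>R (e x * u x)) =
        (LINT x|lebesgue_on I. deriv \<phi>1 x *\<^sub>R u x + \<i> * (deriv \<phi>2 x *\<^sub>R u x)
          + (k * (\<phi>1 x *\<^sub>R u x) + k * \<i> * (\<phi>2 x *\<^sub>R u x)))"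
    proof (rule Bochner_Integration.integral_cong[OF refl])
      fix x
      show "deriv \<phi> x *\<^sub>R (e x * u x) = deriv \<phi>1 x *\<^sub>R u x + \<i> * (deriv \<phi>2 x *\<^sub>R u x)
          + (k * (\<phi>1 x *\<^sub>R u x) + k * \<i> * (\<phi>2 x *\<^sub>R u x))"
        unfolding scaleR_conv_of_real d e \<phi>1_def \<phi>2_def of_real_add of_real_mult of_real_diff
        by (rule exp_multiplier_identity) (simp_all add: k)
    qed
    also have "\<dots> = (LINT x|lebesgue_on I. deriv \<phi>1 x *\<^sub>R u x)
        + \<i> * (LINT x|lebesgue_on I. deriv \<phi>2 x *\<^sub>R u x)
        + (k * (LINT x|lebesgue_on I. \<phi>1 x *\<^sub>R u x) + k * \<i> * (LINT x|lebesgue_on I. \<phi>2 x *\<^sub>R u x))"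
      using i by (simp del: mult_scaleR_right)
    also have "(LINT x|lebesgue_on I. deriv \<phi>1 x *\<^sub>R u x) = - (k * (LINT x|lebesgue_on I. \<phi>1 x *\<^sub>R u x))"
      using w[OF test(1)] i(3) by (simp flip: mult_scaleR_right)
    also have "(LINT x|lebesgue_on I. deriv \<phi>2 x *\<^sub>R u x) = - (k * (LINT x|lebesgue_on I. \<phi>2 x *\<^sub>R u x))"
      using w[OF test(2)] i(4) by (simp flip: mult_scaleR_right)
    finally show "(LINT x|lebesgue_on I. deriv \<phi> x *\<^sub>R (e x * u x)) = 0"
      by (simp add: algebra_simps)
  qed
  then obtain C where "AE x in lebesgue_on I. e x * u x = C" by blast
  then have "AE x in lebesgue_on I. u x = C * exp (k * of_real x)"
  proof eventually_elim
    case (elim x)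
    have "u x = (e x * u x) * exp (k * of_real x)"
      by (simp add: e_def exp_minus)
    then show ?case using elim by simp
  qed
  then show ?thesis by blast
qed

section \<open>Convolution with an exponentially decaying kernel\<close>

text \<open>
The mass of the dominating kernel \<open>exp (-c \<bar>x - y\<bar>)\<close>, on which all convolution estimates rest.
\<close>

lemma nn_integral_exp_abs:
  fixes c :: real
  assumes "c > 0"
  shows "(\<integral>\<^sup>+y. ennreal (exp (- c * \<bar>x - y\<bar>)) \<partial>lborel) = ennreal (2 / c)"
proof -
  have half: "(\<integral>\<^sup>+y. ennreal (exp (- c * y)) * indicator {0..} y \<partial>lborel) = ennreal (1 / c)"
  proof -
    have "(\<integral>\<^sup>+y. ennreal (exp (- c * y)) * indicator {0..} y \<partial>lborel) = ennreal (0 - (- exp (- c * 0) / c))"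
    proof (rule nn_integral_FTC_atLeast)
      show "((\<lambda>y. - exp (- c * y) / c) \<longlongrightarrow> 0) at_top"
        using assms by real_asymp
      show "DERIV (\<lambda>y. - exp (- c * y) / c) y :> exp (- c * y)" for y
        using assms by (auto intro!: derivative_eq_intros)
    qed auto
    then show ?thesis by simp
  qed
  have "(\<integral>\<^sup>+y. ennreal (exp (- c * \<bar>x - y\<bar>)) \<partial>lborel) =
      ennreal \<bar>- 1\<bar> * (\<integral>\<^sup>+y. ennreal (exp (- c * \<bar>x - (x + (- 1) * y)\<bar>)) \<partial>lborel)"
    by (rule nn_integral_real_affine) auto
  also have "\<dots> = (\<integral>\<^sup>+y. ennreal (exp (- c * \<bar>y\<bar>)) \<partial>lborel)"
    by simp
  also have "\<dots> = (\<integral>\<^sup>+y. ennreal (exp (- c * y)) * indicator {0..} y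
      + ennreal (exp (c * y)) * indicator {..0} y \<partial>lborel)"
  proof (rule nn_integral_cong_AE)
    show "AE y in lborel. ennreal (exp (- c * \<bar>y\<bar>)) = ennreal (exp (- c * y)) * indicator {0..} y
        + ennreal (exp (c * y)) * indicator {..0} y"
      using AE_lborel_singleton[of "0::real"]
      by eventually_elim (auto simp: indicator_def)
  qed
  also have "\<dots> = ennreal (1 / c) + (\<integral>\<^sup>+y. ennreal (exp (c * y)) * indicator {..0} y \<partial>lborel)"
    unfolding half[symmetric] by (rule nn_integral_add) auto
  also have "(\<integral>\<^sup>+y. ennreal (exp (c * y)) * indicator {..0} y \<partial>lborel) =
      ennreal \<bar>- 1\<bar> * (\<integral>\<^sup>+y. ennreal (exp (c * (0 + (- 1) * y))) * indicator {..0} (0 + (- 1) * y) \<partial>lborel)"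
    by (rule nn_integral_real_affine) auto
  also have "\<dots> = (\<integral>\<^sup>+y. ennreal (exp (- c * y)) * indicator {0..} y \<partial>lborel)"
    by (auto intro!: nn_integral_cong simp: indicator_def)
  finally show ?thesis
    using assms unfolding half by (simp flip: ennreal_plus)
qed

lemma ennreal_power2_le_imp_le:
  assumes "x ^ 2 \<le> ennreal r ^ 2" "0 \<le> r"
  shows "x \<le> ennreal r"
proof (cases x)
  case (real a)
  then have "ennreal (a\<^sup>2) \<le> ennreal (r\<^sup>2)"
    using assms by (simp add: ennreal_power)
  then have "a\<^sup>2 \<le> r\<^sup>2"
    using ennreal_le_iff[of "r\<^sup>2" "a\<^sup>2"] by simp
  then have "a \<le> r"
    using assms(2) by (rule power2_le_imp_le)
  then show ?thesis
    using real assms(2) by (simp add: ennreal_le_iff)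
next
  case top
  then show ?thesis
    using assms by (simp add: ennreal_power top_unique)
qed

lemma mult_le_sum_squares: "0 \<le> x \<Longrightarrow> 0 \<le> y \<Longrightarrow> x * y \<le> x\<^sup>2 + (y :: real)\<^sup>2"
  using sum_squares_bound[of x y] mult_nonneg_nonneg[of x y] by linarith

definition convolve :: "(real \<Rightarrow> complex) \<Rightarrow> (real \<Rightarrow> complex) \<Rightarrow> real \<Rightarrow> complex" where
  "convolve n F x = (LINT y|lborel. n (x - y) * F y)"

text \<open>
The kernels used later are one-sided exponentials. The estimates only need domination by a
two-sided one.
\<close>

locale exp_convolution =
  fixes n F :: "real \<Rightarrow> complex" and k :: real
  assumes n_measurable[measurable]: "n \<in> borel_measurable borel"
    and n_bound: "\<And>s. norm (n s) \<le> exp (- k * \<bar>s\<bar>)" and k_pos: "k > 0"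
    and F_measurable[measurable]: "F \<in> borel_measurable borel"
    and F_square: "integrable lborel (\<lambda>y. (norm (F y))\<^sup>2)"
begin

abbreviation majorant :: "real \<Rightarrow> ennreal" where
  "majorant x \<equiv> (\<integral>\<^sup>+y. ennreal (exp (- k * \<bar>x - y\<bar>)) * ennreal (norm (F y)) \<partial>lborel)"

definition F_sqnorm :: real where
  "F_sqnorm = (LINT y|lborel. (norm (F y))\<^sup>2)"

lemma F_sqnorm_nonneg: "F_sqnorm \<ge> 0"
  by (simp add: F_sqnorm_def)

lemma nn_integral_F_sqnorm: "(\<integral>\<^sup>+y. ennreal (norm (F y)) ^ 2 \<partial>lborel) = ennreal F_sqnorm"
  unfolding F_sqnorm_def using nn_integral_eq_integral[OF F_square]
  by (simp add: ennreal_power)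

text \<open>
Cauchy-Schwarz, the kernel and \<open>F\<close> both being square-integrable.
\<close>

lemma kernel_nn_bound:
  "majorant x ^ 2 \<le> ennreal (F_sqnorm / k)"
proof -
  have "majorant x ^ 2 \<le>
      (\<integral>\<^sup>+y. ennreal (exp (- k * \<bar>x - y\<bar>)) ^ 2 \<partial>lborel) * (\<integral>\<^sup>+y. ennreal (norm (F y)) ^ 2 \<partial>lborel)"
    by (rule Cauchy_Schwarz_nn_integral) auto
  also have "(\<integral>\<^sup>+y. ennreal (exp (- k * \<bar>x - y\<bar>)) ^ 2 \<partial>lborel) =
      (\<integral>\<^sup>+y. ennreal (exp (- (2 * k) * \<bar>x - y\<bar>)) \<partial>lborel)"
    by (simp add: ennreal_power mult.assoc flip: exp_double)
  also have "\<dots> = ennreal (1 / k)"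
    using nn_integral_exp_abs[of "2 * k" x] k_pos by simp
  finally show ?thesis
    using k_pos F_sqnorm_nonneg by (simp add: nn_integral_F_sqnorm flip: ennreal_mult)
qed

lemma kernel_nn_finite:
  "majorant x \<le> ennreal (sqrt (F_sqnorm / k))"
proof -
  have "ennreal (F_sqnorm / k) = ennreal (sqrt (F_sqnorm / k)) ^ 2"
    using F_sqnorm_nonneg k_pos by (simp add: ennreal_power)
  then have "majorant x ^ 2
      \<le> ennreal (sqrt (F_sqnorm / k)) ^ 2"
    using kernel_nn_bound[of x] by (simp only:)
  then show ?thesis
    by (rule ennreal_power2_le_imp_le) (simp add: F_sqnorm_nonneg k_pos less_imp_le)
qed

lemma dominating_integrable: "integrable lborel (\<lambda>y. exp (- k * \<bar>x - y\<bar>) * norm (F y))"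
proof (rule integrableI_bounded)
  have "(\<integral>\<^sup>+y. ennreal (norm (exp (- k * \<bar>x - y\<bar>) * norm (F y))) \<partial>lborel) =
      majorant x"
    by (simp add: ennreal_mult)
  also have "\<dots> < \<infinity>"
    using kernel_nn_finite[of x] by (auto intro: le_less_trans)
  finally show "(\<integral>\<^sup>+y. ennreal (norm (exp (- k * \<bar>x - y\<bar>) * norm (F y))) \<partial>lborel) < \<infinity>" .
qed measurable

lemma norm_kernel_le: "norm (n (x - y) * F y) \<le> exp (- k * \<bar>x - y\<bar>) * norm (F y)"
  unfolding norm_mult by (rule mult_right_mono[OF n_bound norm_ge_zero])

lemma integrable_kernel: "integrable lborel (\<lambda>y. n (x - y) * F y)"
  by (rule Bochner_Integration.integrable_bound[OF dominating_integrable[of x]])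
    (use norm_kernel_le in \<open>auto simp: abs_mult\<close>)

lemma nn_convolve_le:
  "ennreal (norm (convolve n F x)) \<le>
    majorant x"
proof -
  have "ennreal (norm (convolve n F x)) \<le> (\<integral>\<^sup>+y. ennreal (norm (n (x - y) * F y)) \<partial>lborel)"
    unfolding convolve_def by (rule integral_norm_bound_ennreal[OF integrable_kernel])
  also have "\<dots> \<le> majorant x"
    using norm_kernel_le by (intro nn_integral_mono) (simp flip: ennreal_mult)
  finally show ?thesis .
qed

lemma norm_convolve_le: "norm (convolve n F x) \<le> sqrt (F_sqnorm / k)"
proof -
  have "ennreal (norm (convolve n F x)) \<le> ennreal (sqrt (F_sqnorm / k))"
    using nn_convolve_le[of x] kernel_nn_finite[of x] by (rule order_trans)
  then show ?thesis
    using F_sqnorm_nonneg k_pos by (simp add: ennreal_le_iff)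
qed

lemma convolve_measurable[measurable]: "convolve n F \<in> borel_measurable borel"
  unfolding convolve_def[abs_def] by measurable

text \<open>
Schur's test: splitting the kernel \<open>E\<close> as \<open>E\<^sup>1\<^sup>/\<^sup>2 E\<^sup>1\<^sup>/\<^sup>2\<close>, Cauchy-Schwarz bounds the square of the
convolution by \<open>2 / k\<close> times the convolution of \<open>E\<close> with \<open>\<bar>F\<bar>\<^sup>2\<close>, and integrating the latter in \<open>x\<close>
first contributes another factor \<open>2 / k\<close>.
\<close>

lemma convolve_L2_nn:
  "(\<integral>\<^sup>+x. ennreal ((norm (convolve n F x))\<^sup>2) \<partial>lborel) \<le> ennreal ((2 / k)\<^sup>2 * F_sqnorm)"
proof -
  let ?E = "\<lambda>x y. ennreal (exp (- k * \<bar>x - y\<bar>))"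
  have "ennreal ((norm (convolve n F x))\<^sup>2) \<le>
      ennreal (2 / k) * (\<integral>\<^sup>+y. ?E x y * ennreal (norm (F y)) ^ 2 \<partial>lborel)" for x
  proof -
    let ?h = "\<lambda>y. ennreal (exp (- (k / 2) * \<bar>x - y\<bar>))"
    have h2: "?h y * ?h y = ?E x y" for y
      by (simp flip: ennreal_mult exp_add)
    have "ennreal ((norm (convolve n F x))\<^sup>2) = ennreal (norm (convolve n F x)) ^ 2"
      by (simp add: ennreal_power)
    also have "\<dots> \<le> (\<integral>\<^sup>+y. ?E x y * ennreal (norm (F y)) \<partial>lborel) ^ 2"
      by (intro power_mono nn_convolve_le) auto
    also have "(\<integral>\<^sup>+y. ?E x y * ennreal (norm (F y)) \<partial>lborel) =
        (\<integral>\<^sup>+y. ?h y * (?h y * ennreal (norm (F y))) \<partial>lborel)"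
      by (simp only: h2 mult.assoc[symmetric])
    also have "\<dots> ^ 2 \<le> (\<integral>\<^sup>+y. ?h y ^ 2 \<partial>lborel) * (\<integral>\<^sup>+y. (?h y * ennreal (norm (F y))) ^ 2 \<partial>lborel)"
      by (rule Cauchy_Schwarz_nn_integral) auto
    also have "(\<integral>\<^sup>+y. ?h y ^ 2 \<partial>lborel) = (\<integral>\<^sup>+y. ?E x y \<partial>lborel)"
      by (simp only: power2_eq_square h2)
    also have "\<dots> = ennreal (2 / k)"
      by (rule nn_integral_exp_abs[OF k_pos])
    also have "(\<integral>\<^sup>+y. (?h y * ennreal (norm (F y))) ^ 2 \<partial>lborel) =
        (\<integral>\<^sup>+y. ?E x y * ennreal (norm (F y)) ^ 2 \<partial>lborel)"
      by (simp only: power_mult_distrib power2_eq_square[of "ennreal (exp _)"] h2)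
    finally show ?thesis .
  qed
  then have "(\<integral>\<^sup>+x. ennreal ((norm (convolve n F x))\<^sup>2) \<partial>lborel) \<le>
      (\<integral>\<^sup>+x. ennreal (2 / k) * (\<integral>\<^sup>+y. ?E x y * ennreal (norm (F y)) ^ 2 \<partial>lborel) \<partial>lborel)"
    by (intro nn_integral_mono)
  also have "\<dots> = ennreal (2 / k) * (\<integral>\<^sup>+x. (\<integral>\<^sup>+y. ?E x y * ennreal (norm (F y)) ^ 2 \<partial>lborel) \<partial>lborel)"
    by (rule nn_integral_cmult) measurable
  also have "(\<integral>\<^sup>+x. (\<integral>\<^sup>+y. ?E x y * ennreal (norm (F y)) ^ 2 \<partial>lborel) \<partial>lborel) =
      (\<integral>\<^sup>+y. (\<integral>\<^sup>+x. ?E x y * ennreal (norm (F y)) ^ 2 \<partial>lborel) \<partial>lborel)"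
    by (rule lborel_pair.Fubini') measurable
  also have "\<dots> = (\<integral>\<^sup>+y. ennreal (2 / k) * ennreal (norm (F y)) ^ 2 \<partial>lborel)"
  proof (rule nn_integral_cong)
    fix y :: real
    have "(\<integral>\<^sup>+x. ?E x y * ennreal (norm (F y)) ^ 2 \<partial>lborel) =
        (\<integral>\<^sup>+x. ?E x y \<partial>lborel) * ennreal (norm (F y)) ^ 2"
      by (rule nn_integral_multc) measurable
    also have "(\<integral>\<^sup>+x. ?E x y \<partial>lborel) = ennreal (2 / k)"
      using nn_integral_exp_abs[OF k_pos, of y] by (simp add: abs_minus_commute)
    finally show "(\<integral>\<^sup>+x. ?E x y * ennreal (norm (F y)) ^ 2 \<partial>lborel) =
        ennreal (2 / k) * ennreal (norm (F y)) ^ 2" .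
  qed
  also have "\<dots> = ennreal (2 / k) * ennreal F_sqnorm"
    unfolding nn_integral_F_sqnorm[symmetric] by (rule nn_integral_cmult) measurable
  also have "ennreal (2 / k) * (ennreal (2 / k) * ennreal F_sqnorm) = ennreal ((2 / k)\<^sup>2 * F_sqnorm)"
    using k_pos F_sqnorm_nonneg by (simp add: power2_eq_square flip: ennreal_mult)
  finally show ?thesis .
qed

lemma convolve_square_integrable: "integrable lborel (\<lambda>x. (norm (convolve n F x))\<^sup>2)"
  using convolve_L2_nn by (intro integrableI_bounded) (auto intro: le_less_trans)

lemma convolve_L2_le: "(LINT x|lborel. (norm (convolve n F x))\<^sup>2) \<le> (2 / k)\<^sup>2 * F_sqnorm"
proof -
  have "ennreal (LINT x|lborel. (norm (convolve n F x))\<^sup>2) \<le> ennreal ((2 / k)\<^sup>2 * F_sqnorm)"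
    using convolve_L2_nn nn_integral_eq_integral[OF convolve_square_integrable] by simp
  then show ?thesis
    using F_sqnorm_nonneg by (simp add: ennreal_le_iff)
qed

text \<open>
Dominated convergence: a jump of the kernel at \<open>0\<close> affects only the single point \<open>y = x\<close>. If
\<open>\<bar>x' - x\<bar> < 1\<close>, the kernel centred at \<open>x'\<close> is at most \<open>exp k\<close> times the dominating kernel centred
at \<open>x\<close>.
\<close>

lemma convolve_continuous:
  assumes n_cont: "\<And>s. s \<noteq> 0 \<Longrightarrow> isCont n s"
  shows "continuous_on A (convolve n F)"
proof (rule continuous_at_imp_continuous_on, rule ballI)
  fix x
  show "isCont (convolve n F) x"
    unfolding continuous_at_sequentially comp_def
  proof (intro allI impI)
    fix X :: "nat \<Rightarrow> real" assume X: "X \<longlonglongrightarrow> x"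
    obtain M where M: "\<And>i. i \<ge> M \<Longrightarrow> \<bar>X i - x\<bar> < 1"
      using LIMSEQ_D[OF X, of 1] by auto
    have "(\<lambda>i. LINT y|lborel. n (X (i + M) - y) * F y) \<longlonglongrightarrow> (LINT y|lborel. n (x - y) * F y)"
    proof (rule integral_dominated_convergence[where w = "\<lambda>y. exp k * (exp (- k * \<bar>x - y\<bar>) * norm (F y))"])
      show "integrable lborel (\<lambda>y. exp k * (exp (- k * \<bar>x - y\<bar>) * norm (F y)))"
        by (intro integrable_mult_right dominating_integrable)
      show "AE y in lborel. norm (n (X (i + M) - y) * F y) \<le>
          exp k * (exp (- k * \<bar>x - y\<bar>) * norm (F y))" for i
      proof (rule AE_I2)
        fix y
        have "\<bar>x - y\<bar> \<le> \<bar>X (i + M) - y\<bar> + 1"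
          using M[of "i + M"] by linarith
        then have "k * \<bar>x - y\<bar> \<le> k * (\<bar>X (i + M) - y\<bar> + 1)"
          using k_pos by (intro mult_left_mono) auto
        then have "- k * \<bar>X (i + M) - y\<bar> \<le> k + - k * \<bar>x - y\<bar>"
          by (simp add: distrib_left)
        then have "exp (- k * \<bar>X (i + M) - y\<bar>) \<le> exp k * exp (- k * \<bar>x - y\<bar>)"
          by (simp flip: exp_add)
        then have "exp (- k * \<bar>X (i + M) - y\<bar>) * norm (F y) \<le> exp k * exp (- k * \<bar>x - y\<bar>) * norm (F y)"
          by (rule mult_right_mono) simp
        with norm_kernel_le[of "X (i + M)" y] show "norm (n (X (i + M) - y) * F y) \<le>
          exp k * (exp (- k * \<bar>x - y\<bar>) * norm (F y))"
          by (simp only: mult.assoc)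
      qed
      show "AE y in lborel. (\<lambda>i. n (X (i + M) - y) * F y) \<longlonglongrightarrow> n (x - y) * F y"
        using AE_lborel_singleton[of x]
      proof eventually_elim
        case (elim y)
        then have "isCont n (x - y)" by (intro n_cont) simp
        moreover have "(\<lambda>i. X (i + M) - y) \<longlonglongrightarrow> x - y"
          by (intro tendsto_intros LIMSEQ_ignore_initial_segment X)
        ultimately have "(\<lambda>i. n (X (i + M) - y)) \<longlonglongrightarrow> n (x - y)"
          by (rule isCont_tendsto_compose)
        then show ?case by (intro tendsto_intros)
      qed
    qed measurable
    then show "(\<lambda>i. convolve n F (X i)) \<longlonglongrightarrow> convolve n F x"
      unfolding convolve_def by (rule LIMSEQ_offset)
  qed
qed

lemma convolve_Fubini:
  assumes \<psi>: "continuous_on UNIV \<psi>" "compact K" "\<And>x. x \<notin> K \<Longrightarrow> \<psi> x = (0::real)"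
  shows "(LINT x|lborel. \<psi> x *\<^sub>R convolve n F x) = (LINT y|lborel. (LINT x|lborel. \<psi> x *\<^sub>R n (x - y)) * F y)"
    and "integrable lborel (\<lambda>y. (LINT x|lborel. \<psi> x *\<^sub>R n (x - y)) * F y)"
    and "integrable lborel (\<lambda>x. \<psi> x *\<^sub>R convolve n F x)"
proof -
  have [measurable]: "\<psi> \<in> borel_measurable borel"
    using \<psi>(1) by (rule borel_measurable_continuous_onI)
  have "integrable lborel (\<lambda>x. indicator K x *\<^sub>R \<psi> x)"
    using \<psi>(1) by (intro borel_integrable_compact \<psi>(2)) (auto intro: continuous_on_subset)
  moreover have "(\<lambda>x. indicator K x *\<^sub>R \<psi> x) = \<psi>"
    using \<psi>(3) by (auto simp: fun_eq_iff indicator_def)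
  ultimately have \<psi>int: "integrable lborel \<psi>" by simp
  have int: "integrable (lborel \<Otimes>\<^sub>M lborel) (\<lambda>(x, y). \<psi> x *\<^sub>R (n (x - y) * F y))"
  proof (rule integrableI_bounded)
    have "(\<integral>\<^sup>+p. ennreal (norm (case p of (x, y) \<Rightarrow> \<psi> x *\<^sub>R (n (x - y) * F y))) \<partial>(lborel \<Otimes>\<^sub>M lborel)) =
        (\<integral>\<^sup>+x. \<integral>\<^sup>+y. ennreal (norm (\<psi> x *\<^sub>R (n (x - y) * F y))) \<partial>lborel \<partial>lborel)"
      by (subst lborel.nn_integral_fst[symmetric]) auto
    also have "\<dots> \<le> (\<integral>\<^sup>+x. ennreal (norm (\<psi> x)) * ennreal (sqrt (F_sqnorm / k)) \<partial>lborel)"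
    proof (rule nn_integral_mono)
      fix x
      have "(\<integral>\<^sup>+y. ennreal (norm (\<psi> x *\<^sub>R (n (x - y) * F y))) \<partial>lborel) \<le>
          (\<integral>\<^sup>+y. ennreal (norm (\<psi> x)) * (ennreal (exp (- k * \<bar>x - y\<bar>)) * ennreal (norm (F y))) \<partial>lborel)"
        using norm_kernel_le
        by (intro nn_integral_mono) (simp add: mult_left_mono flip: ennreal_mult)
      also have "\<dots> = ennreal (norm (\<psi> x)) *
          majorant x"
        by (rule nn_integral_cmult) measurable
      also have "\<dots> \<le> ennreal (norm (\<psi> x)) * ennreal (sqrt (F_sqnorm / k))"
        by (intro mult_left_mono kernel_nn_finite) simp
      finally show "(\<integral>\<^sup>+y. ennreal (norm (\<psi> x *\<^sub>R (n (x - y) * F y))) \<partial>lborel) \<le>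
          ennreal (norm (\<psi> x)) * ennreal (sqrt (F_sqnorm / k))" .
    qed
    also have "\<dots> = (\<integral>\<^sup>+x. ennreal (norm (\<psi> x)) \<partial>lborel) * ennreal (sqrt (F_sqnorm / k))"
      by (rule nn_integral_multc) measurable
    also have "\<dots> < \<infinity>"
      using \<psi>int by (simp add: integrable_iff_bounded ennreal_mult_less_top)
    finally show "(\<integral>\<^sup>+p. ennreal (norm (case p of (x, y) \<Rightarrow> \<psi> x *\<^sub>R (n (x - y) * F y)))
        \<partial>(lborel \<Otimes>\<^sub>M lborel)) < \<infinity>" .
  qed measurable
  have eq1: "(LINT y|lborel. \<psi> x *\<^sub>R (n (x - y) * F y)) = \<psi> x *\<^sub>R convolve n F x" for x
    unfolding convolve_def by (rule Bochner_Integration.integral_scaleR_right)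
  have eq2: "(LINT x|lborel. \<psi> x *\<^sub>R (n (x - y) * F y)) = (LINT x|lborel. \<psi> x *\<^sub>R n (x - y)) * F y" for y
    by (simp only: mult_scaleR_left[symmetric] integral_mult_left_zero)
  show "(LINT x|lborel. \<psi> x *\<^sub>R convolve n F x) = (LINT y|lborel. (LINT x|lborel. \<psi> x *\<^sub>R n (x - y)) * F y)"
    using lborel_pair.Fubini_integral[OF int] by (simp only: eq1 eq2)
  show "integrable lborel (\<lambda>y. (LINT x|lborel. \<psi> x *\<^sub>R n (x - y)) * F y)"
    using lborel_pair.integrable_snd[OF int] by (simp only: eq2)
  show "integrable lborel (\<lambda>x. \<psi> x *\<^sub>R convolve n F x)"
    using lborel_pair.integrable_fst[OF int] by (simp only: eq1)
qed

text \<open>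
If the kernel is a fundamental solution of \<open>n' = c n + \<delta>\<close> in the sense of distributions, convolution
with it solves \<open>u' = c u + F\<close>; all that happens is an exchange of integrals.
\<close>

lemma convolve_weak_derivative:
  assumes fundamental: "\<And>\<phi> y. \<phi> \<in> test_functions UNIV \<Longrightarrow>
      (LINT x|lborel. deriv \<phi> x *\<^sub>R n (x - y)) = - of_real (\<phi> y) - c * (LINT x|lborel. \<phi> x *\<^sub>R n (x - y))"
    and \<phi>: "\<phi> \<in> test_functions UNIV"
  shows "(LINT x|lborel. deriv \<phi> x *\<^sub>R convolve n F x) =
    - (LINT x|lborel. \<phi> x *\<^sub>R (c * convolve n F x + F x))"
proof -
  obtain K where K: "smooth \<phi>" "compact K" "\<And>x. x \<notin> K \<Longrightarrow> \<phi> x = 0"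
    using \<phi> unfolding test_functions_iff by blast
  have cont: "continuous_on UNIV \<phi>" "continuous_on UNIV (deriv \<phi>)"
    by (intro smooth_continuous_on smooth_deriv K(1))+
  have [measurable]: "\<phi> \<in> borel_measurable borel"
    using cont(1) by (rule borel_measurable_continuous_onI)
  note Fub = convolve_Fubini[OF cont(1) K(2,3)]
  have z: "\<And>x. x \<notin> K \<Longrightarrow> deriv \<phi> x = 0"
    by (rule deriv_eq_0_outside[OF K(2,3)])
  have int: "integrable lborel (\<lambda>x. \<phi> x *\<^sub>R F x)"
  proof (rule Bochner_Integration.integrable_bound[of _ "\<lambda>x. (\<phi> x)\<^sup>2 + (norm (F x))\<^sup>2"])
    have "integrable lborel (\<lambda>x. indicator K x *\<^sub>R (\<phi> x)\<^sup>2)"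
      using cont(1) by (intro borel_integrable_compact K(2)) (auto intro!: continuous_intros intro: continuous_on_subset)
    moreover have "(\<lambda>x. indicator K x *\<^sub>R (\<phi> x)\<^sup>2) = (\<lambda>x. (\<phi> x)\<^sup>2)"
      using K(3) by (auto simp: fun_eq_iff indicator_def)
    ultimately show "integrable lborel (\<lambda>x. (\<phi> x)\<^sup>2 + (norm (F x))\<^sup>2)"
      using F_square by simp
    show "AE x in lborel. norm (\<phi> x *\<^sub>R F x) \<le> norm ((\<phi> x)\<^sup>2 + (norm (F x))\<^sup>2)"
    proof (rule AE_I2)
      fix x
      show "norm (\<phi> x *\<^sub>R F x) \<le> norm ((\<phi> x)\<^sup>2 + (norm (F x))\<^sup>2)"
        using mult_le_sum_squares[of "\<bar>\<phi> x\<bar>" "norm (F x)"] by simp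
    qed
  qed measurable
  have "(LINT x|lborel. deriv \<phi> x *\<^sub>R convolve n F x) =
      (LINT y|lborel. (LINT x|lborel. deriv \<phi> x *\<^sub>R n (x - y)) * F y)"
    by (rule convolve_Fubini(1)[OF cont(2) K(2) z])
  also have "\<dots> = (LINT y|lborel. - (\<phi> y *\<^sub>R F y) - c * ((LINT x|lborel. \<phi> x *\<^sub>R n (x - y)) * F y))"
    unfolding fundamental[OF \<phi>] by (simp only: scaleR_conv_of_real left_diff_distrib mult.assoc mult_minus_left)
  also have "\<dots> = - (LINT y|lborel. \<phi> y *\<^sub>R F y) - c * (LINT y|lborel. (LINT x|lborel. \<phi> x *\<^sub>R n (x - y)) * F y)"
    using int Fub(2) by simp
  also have "\<dots> = - (LINT y|lborel. \<phi> y *\<^sub>R F y) - c * (LINT x|lborel. \<phi> x *\<^sub>R convolve n F x)"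
    by (subst Fub(1), assumption, rule refl)
  also have "\<dots> = - (LINT x|lborel. c * (\<phi> x *\<^sub>R convolve n F x) + \<phi> x *\<^sub>R F x)"
    using int Fub(3) by (simp del: mult_scaleR_right)
  finally show "(LINT x|lborel. deriv \<phi> x *\<^sub>R convolve n F x) =
    - (LINT x|lborel. \<phi> x *\<^sub>R (c * convolve n F x + F x))"
    by (simp add: scaleR_add_right)
qed

end

section \<open>Calculus of weak derivatives and fundamental solutions\<close>

text \<open>
The problem is posed with the Lebesgue measure on \<open>\<Omega>\<close>, whereas Fubini's theorem is used for the
Borel measure on the line.
\<close>

lemma integrable_lebesgue_on_borel:
  fixes f :: "real \<Rightarrow> 'a::{banach, second_countable_topology}"
  assumes "f \<in> borel_measurable borel" "open \<Omega>" "\<And>x. x \<notin> \<Omega> \<Longrightarrow> f x = 0"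
  shows "integrable (lebesgue_on \<Omega>) f \<longleftrightarrow> integrable lborel f"
    and "integral\<^sup>L (lebesgue_on \<Omega>) f = integral\<^sup>L lborel f"
proof -
  have eq: "(\<lambda>x. indicat_real \<Omega> x *\<^sub>R f x) = f"
    using assms(3) by (auto simp: fun_eq_iff indicator_def)
  have "\<Omega> \<inter> space lebesgue \<in> sets lebesgue"
    using assms(2) by (simp add: borel_open)
  from integrable_restrict_space[OF this, of f] integral_restrict_space[OF this, of f]
  show "integrable (lebesgue_on \<Omega>) f \<longleftrightarrow> integrable lborel f"
    and "integral\<^sup>L (lebesgue_on \<Omega>) f = integral\<^sup>L lborel f"
    using assms(1) by (simp_all add: eq integrable_completion integral_completion)
qed

lemma smooth_compact_support_integrable:
  assumes u: "square_integrable \<Omega> u" and \<Omega>: "open \<Omega>"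
    and f: "smooth f" "compact K" "K \<subseteq> \<Omega>" "\<And>x. x \<notin> K \<Longrightarrow> f x = 0"
  shows "integrable (lebesgue_on \<Omega>) (\<lambda>x. f x *\<^sub>R u x)"
proof (rule Bochner_Integration.integrable_bound[of _ "\<lambda>x. (f x)\<^sup>2 + (norm (u x))\<^sup>2"])
  have cont: "continuous_on A f" for A by (rule smooth_continuous_on[OF f(1)])
  have meas: "f \<in> borel_measurable borel"
    by (rule borel_measurable_continuous_onI[OF cont])
  have "integrable lborel (\<lambda>x. indicator K x *\<^sub>R (f x)\<^sup>2)"
    by (rule borel_integrable_compact[OF f(2)]) (intro continuous_intros cont)
  moreover have "(\<lambda>x. indicator K x *\<^sub>R (f x)\<^sup>2) = (\<lambda>x. (f x)\<^sup>2)"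
    using f(4) by (auto simp: fun_eq_iff indicator_def)
  moreover have "f x = 0" if "x \<notin> \<Omega>" for x
  proof -
    have "x \<notin> K" using f(3) that by blast
    then show ?thesis by (rule f(4))
  qed
  ultimately have "integrable (lebesgue_on \<Omega>) (\<lambda>x. (f x)\<^sup>2)"
    using meas by (subst integrable_lebesgue_on_borel(1)[OF _ \<Omega>]) auto
  then show "integrable (lebesgue_on \<Omega>) (\<lambda>x. (f x)\<^sup>2 + (norm (u x))\<^sup>2)"
    using u by (simp add: square_integrable_def)
  have "f \<in> borel_measurable (lebesgue_on \<Omega>)"
    using meas by (simp add: measurable_completion measurable_restrict_space1)
  then show "(\<lambda>x. f x *\<^sub>R u x) \<in> borel_measurable (lebesgue_on \<Omega>)"
    using u by (intro borel_measurable_scaleR) (simp_all add: square_integrable_def)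
  show "AE x in lebesgue_on \<Omega>. norm (f x *\<^sub>R u x) \<le> norm ((f x)\<^sup>2 + (norm (u x))\<^sup>2)"
  proof (rule AE_I2)
    fix x
    show "norm (f x *\<^sub>R u x) \<le> norm ((f x)\<^sup>2 + (norm (u x))\<^sup>2)"
      using mult_le_sum_squares[of "\<bar>f x\<bar>" "norm (u x)"] by simp
  qed
qed

lemma test_function_integrable:
  assumes "square_integrable \<Omega> u" "open \<Omega>" "\<phi> \<in> test_functions \<Omega>"
  shows "integrable (lebesgue_on \<Omega>) (\<lambda>x. \<phi> x *\<^sub>R u x)"
    and "integrable (lebesgue_on \<Omega>) (\<lambda>x. deriv \<phi> x *\<^sub>R u x)"
proof -
  obtain K where K: "smooth \<phi>" "compact K" "K \<subseteq> \<Omega>" "\<And>x. x \<notin> K \<Longrightarrow> \<phi> x = 0"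
    using assms(3) unfolding test_functions_iff by blast
  show "integrable (lebesgue_on \<Omega>) (\<lambda>x. \<phi> x *\<^sub>R u x)"
    by (rule smooth_compact_support_integrable[OF assms(1,2) K])
  show "integrable (lebesgue_on \<Omega>) (\<lambda>x. deriv \<phi> x *\<^sub>R u x)"
    by (rule smooth_compact_support_integrable[OF assms(1,2) smooth_deriv[OF K(1)] K(2,3)])
      (rule deriv_eq_0_outside[OF K(2,4)])
qed

lemma norm_sum_power2_le: "(norm (x + y))\<^sup>2 \<le> 2 * (norm x)\<^sup>2 + 2 * (norm (y :: complex))\<^sup>2"
proof -
  have "(norm (x + y))\<^sup>2 \<le> (norm x + norm y)\<^sup>2"
    by (intro power_mono norm_triangle_ineq) auto
  also have "\<dots> \<le> 2 * (norm x)\<^sup>2 + 2 * (norm y)\<^sup>2"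
    using zero_le_power2[of "norm x - norm y"] unfolding power2_diff power2_sum by linarith
  finally show ?thesis .
qed

lemma square_integrable_linear:
  assumes u: "square_integrable \<Omega> u" and v: "square_integrable \<Omega> v"
  shows "square_integrable \<Omega> (\<lambda>x. A * u x + B * v x)"
    and "(LINT x|lebesgue_on \<Omega>. (norm (A * u x + B * v x))\<^sup>2) \<le>
      2 * (norm A)\<^sup>2 * (LINT x|lebesgue_on \<Omega>. (norm (u x))\<^sup>2) +
      2 * (norm B)\<^sup>2 * (LINT x|lebesgue_on \<Omega>. (norm (v x))\<^sup>2)"
proof -
  have [measurable]: "u \<in> borel_measurable (lebesgue_on \<Omega>)" "v \<in> borel_measurable (lebesgue_on \<Omega>)"
    using u v by (simp_all add: square_integrable_def)
  have i: "integrable (lebesgue_on \<Omega>) (\<lambda>x. (norm (u x))\<^sup>2)" "integrable (lebesgue_on \<Omega>) (\<lambda>x. (norm (v x))\<^sup>2)"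
    using u v by (simp_all add: square_integrable_def)
  let ?b = "\<lambda>x. 2 * (norm A)\<^sup>2 * (norm (u x))\<^sup>2 + 2 * (norm B)\<^sup>2 * (norm (v x))\<^sup>2"
  have b: "integrable (lebesgue_on \<Omega>) ?b"
    using i by simp
  have le: "(norm (A * u x + B * v x))\<^sup>2 \<le> ?b x" for x
    using norm_sum_power2_le[of "A * u x" "B * v x"]
    by (simp add: norm_mult power_mult_distrib mult.assoc)
  have int: "integrable (lebesgue_on \<Omega>) (\<lambda>x. (norm (A * u x + B * v x))\<^sup>2)"
  proof (rule Bochner_Integration.integrable_bound[OF b])
    show "AE x in lebesgue_on \<Omega>. norm ((norm (A * u x + B * v x))\<^sup>2) \<le> norm (?b x)"
      using le by (intro AE_I2) (auto intro: order_trans[OF _ abs_ge_self])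
  qed measurable
  then show "square_integrable \<Omega> (\<lambda>x. A * u x + B * v x)"
    by (simp add: square_integrable_def)
  have "(LINT x|lebesgue_on \<Omega>. (norm (A * u x + B * v x))\<^sup>2) \<le> (LINT x|lebesgue_on \<Omega>. ?b x)"
    by (rule integral_mono[OF int b le])
  also have "\<dots> = 2 * (norm A)\<^sup>2 * (LINT x|lebesgue_on \<Omega>. (norm (u x))\<^sup>2) +
      2 * (norm B)\<^sup>2 * (LINT x|lebesgue_on \<Omega>. (norm (v x))\<^sup>2)"
    using i by simp
  finally show "(LINT x|lebesgue_on \<Omega>. (norm (A * u x + B * v x))\<^sup>2) \<le> \<dots>" .
qed

lemma weak_derivative_linear:
  assumes \<Omega>: "open \<Omega>"
    and sq: "square_integrable \<Omega> u" "square_integrable \<Omega> v" "square_integrable \<Omega> g" "square_integrable \<Omega> h"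
    and w: "weak_derivative \<Omega> u g" "weak_derivative \<Omega> v h"
  shows "weak_derivative \<Omega> (\<lambda>x. A * u x + B * v x) (\<lambda>x. A * g x + B * h x)"
  unfolding weak_derivative_def
proof
  fix \<phi> assume \<phi>: "\<phi> \<in> test_functions \<Omega>"
  have lin: "(LINT x|lebesgue_on \<Omega>. f x *\<^sub>R (A * p x + B * q x)) =
      A * (LINT x|lebesgue_on \<Omega>. f x *\<^sub>R p x) + B * (LINT x|lebesgue_on \<Omega>. f x *\<^sub>R q x)"
    if "integrable (lebesgue_on \<Omega>) (\<lambda>x. f x *\<^sub>R p x)" "integrable (lebesgue_on \<Omega>) (\<lambda>x. f x *\<^sub>R q x)"
    for f :: "real \<Rightarrow> real" and p q :: "real \<Rightarrow> complex"
    using that unfolding scaleR_add_right mult_scaleR_right[symmetric]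
    by (simp del: mult_scaleR_right)
  have "(LINT x|lebesgue_on \<Omega>. deriv \<phi> x *\<^sub>R u x) = - (LINT x|lebesgue_on \<Omega>. \<phi> x *\<^sub>R g x)"
    "(LINT x|lebesgue_on \<Omega>. deriv \<phi> x *\<^sub>R v x) = - (LINT x|lebesgue_on \<Omega>. \<phi> x *\<^sub>R h x)"
    using w \<phi> by (simp_all add: weak_derivative_def)
  then show "(LINT x|lebesgue_on \<Omega>. deriv \<phi> x *\<^sub>R (A * u x + B * v x)) =
      - (LINT x|lebesgue_on \<Omega>. \<phi> x *\<^sub>R (A * g x + B * h x))"
    by (simp add: lin test_function_integrable[OF _ \<Omega> \<phi>] sq)
qed

lemma weak_derivative_cong_AE:
  assumes "weak_derivative \<Omega> u g" and \<Omega>: "open \<Omega>"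
    and "square_integrable \<Omega> g" "square_integrable \<Omega> g'" "AE x in lebesgue_on \<Omega>. g x = g' x"
  shows "weak_derivative \<Omega> u g'"
  unfolding weak_derivative_def
proof
  fix \<phi> assume \<phi>: "\<phi> \<in> test_functions \<Omega>"
  have "(LINT x|lebesgue_on \<Omega>. \<phi> x *\<^sub>R g x) = (LINT x|lebesgue_on \<Omega>. \<phi> x *\<^sub>R g' x)"
    using test_function_integrable(1)[OF assms(3) \<Omega> \<phi>] test_function_integrable(1)[OF assms(4) \<Omega> \<phi>] assms(5)
    by (intro integral_cong_AE) (auto elim: eventually_mono)
  then show "(LINT x|lebesgue_on \<Omega>. deriv \<phi> x *\<^sub>R u x) = - (LINT x|lebesgue_on \<Omega>. \<phi> x *\<^sub>R g' x)"
    using assms(1) \<phi> by (simp add: weak_derivative_def)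
qed

lemma test_functions_mono: "\<Omega> \<subseteq> \<Omega>' \<Longrightarrow> test_functions \<Omega> \<subseteq> test_functions \<Omega>'"
  by (rule subsetI) (meson test_functions_iff subset_trans)

lemma weak_derivative_subset:
  assumes "weak_derivative T u g" "S \<subseteq> T" "S \<in> sets lebesgue" "T \<in> sets lebesgue"
  shows "weak_derivative S u g"
  unfolding weak_derivative_def
proof
  fix \<phi> assume \<phi>: "\<phi> \<in> test_functions S"
  then obtain K where K: "smooth \<phi>" "compact K" "K \<subseteq> S" "\<And>x. x \<notin> K \<Longrightarrow> \<phi> x = 0"
    unfolding test_functions_iff by blast
  have out: "x \<notin> K" if "x \<in> T - S" for x using that K(3) by blast
  have "(LINT x|lebesgue_on T. deriv \<phi> x *\<^sub>R u x) = (LINT x|lebesgue_on S. deriv \<phi> x *\<^sub>R u x)"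
    using deriv_eq_0_outside[OF K(2,4)] out
    by (intro lebesgue_on_supported(2)[OF assms(3,4,2)]) simp
  moreover have "(LINT x|lebesgue_on T. \<phi> x *\<^sub>R g x) = (LINT x|lebesgue_on S. \<phi> x *\<^sub>R g x)"
    using K(4) out by (intro lebesgue_on_supported(2)[OF assms(3,4,2)]) simp
  moreover have "\<phi> \<in> test_functions T"
    using test_functions_mono[OF assms(2)] \<phi> by blast
  ultimately show "(LINT x|lebesgue_on S. deriv \<phi> x *\<^sub>R u x) = - (LINT x|lebesgue_on S. \<phi> x *\<^sub>R g x)"
    using assms(1) by (simp add: weak_derivative_def)
qed

lemma integration_by_parts_smooth:
  fixes h h' :: "real \<Rightarrow> complex"
  assumes \<phi>: "smooth \<phi>" and "c \<le> d"
    and h: "\<And>x. (h has_vector_derivative h' x) (at x)" "continuous_on UNIV h'"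
  shows "integrable lborel (\<lambda>x. indicator {c..d} x *\<^sub>R (deriv \<phi> x *\<^sub>R h x))"
    and "integrable lborel (\<lambda>x. indicator {c..d} x *\<^sub>R (\<phi> x *\<^sub>R h' x))"
    and "(LINT x|lborel. indicator {c..d} x *\<^sub>R (deriv \<phi> x *\<^sub>R h x)) =
      \<phi> d *\<^sub>R h d - \<phi> c *\<^sub>R h c - (LINT x|lborel. indicator {c..d} x *\<^sub>R (\<phi> x *\<^sub>R h' x))"
proof -
  have ch: "continuous_on A h" for A
    using h(1) by (meson continuous_at_imp_continuous_on has_vector_derivative_continuous)
  have ch': "continuous_on A h'" for A
    using h(2) by (rule continuous_on_subset) simp
  note cont = ch ch' smooth_continuous_on[OF \<phi>] smooth_continuous_on[OF smooth_deriv[OF \<phi>]]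
  show 1: "integrable lborel (\<lambda>x. indicator {c..d} x *\<^sub>R (deriv \<phi> x *\<^sub>R h x))"
    and 2: "integrable lborel (\<lambda>x. indicator {c..d} x *\<^sub>R (\<phi> x *\<^sub>R h' x))"
    by (intro borel_integrable_compact compact_Icc continuous_on_scaleR cont)+
  have "(LINT x|lborel. indicator {c..d} x *\<^sub>R (\<phi> x *\<^sub>R h' x + deriv \<phi> x *\<^sub>R h x)) =
      \<phi> d *\<^sub>R h d - \<phi> c *\<^sub>R h c"
  proof (rule integral_FTC_Icc[OF \<open>c \<le> d\<close>])
    show "((\<lambda>x. \<phi> x *\<^sub>R h x) has_vector_derivative \<phi> x *\<^sub>R h' x + deriv \<phi> x *\<^sub>R h x) (at x within {c..d})" for x
      using has_vector_derivative_scaleR[OF smooth_has_deriv[OF \<phi>] h(1), of x]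
      by (rule has_vector_derivative_at_within)
    show "continuous_on {c..d} (\<lambda>x. \<phi> x *\<^sub>R h' x + deriv \<phi> x *\<^sub>R h x)"
      by (intro continuous_on_add continuous_on_scaleR cont)
  qed
  then show "(LINT x|lborel. indicator {c..d} x *\<^sub>R (deriv \<phi> x *\<^sub>R h x)) =
      \<phi> d *\<^sub>R h d - \<phi> c *\<^sub>R h c - (LINT x|lborel. indicator {c..d} x *\<^sub>R (\<phi> x *\<^sub>R h' x))"
    using 1 2 by (simp add: scaleR_add_right algebra_simps)
qed

lemma has_vector_derivative_exp_mult:
  "((\<lambda>x::real. exp (k * of_real x + b :: complex)) has_vector_derivative k * exp (k * of_real x + b)) (at x)"
  by (rule has_vector_derivative_real_field[where f = "\<lambda>w. exp (k * w + b)"])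
    (auto intro!: derivative_eq_intros)

text \<open>
The fundamental solutions of \<open>n' = k n + \<delta>\<close> and \<open>n' = - k n + \<delta>\<close> that decay on both sides when
\<open>Re k > 0\<close>: the first one lives on the left of the origin, the second one on the right.
\<close>

definition left_kernel :: "complex \<Rightarrow> real \<Rightarrow> complex" where
  "left_kernel k s = (if s \<le> 0 then - exp (k * of_real s) else 0)"

definition right_kernel :: "complex \<Rightarrow> real \<Rightarrow> complex" where
  "right_kernel k s = (if s \<ge> 0 then exp (- (k * of_real s)) else 0)"

lemma test_function_cutoff:
  assumes "\<phi> \<in> test_functions \<Omega>"
  obtains R where "R > 0" "\<bar>y\<bar> < R" "\<And>x. \<bar>x\<bar> \<ge> R \<Longrightarrow> \<phi> x = 0" "\<And>x. \<bar>x\<bar> \<ge> R \<Longrightarrow> deriv \<phi> x = 0"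
proof -
  obtain K where K: "compact K" "\<And>x. x \<notin> K \<Longrightarrow> \<phi> x = 0"
    using assms unfolding test_functions_iff by blast
  obtain b where b: "\<And>x. x \<in> K \<Longrightarrow> \<bar>x\<bar> \<le> b"
    using compact_imp_bounded[OF K(1)] unfolding bounded_iff by auto
  define R where "R = \<bar>b\<bar> + \<bar>y\<bar> + 1"
  have "x \<notin> K" if "\<bar>x\<bar> \<ge> R" for x
    using b[of x] that by (auto simp: R_def)
  then show ?thesis
    using that[of R] K(2) deriv_eq_0_outside[OF K] by (simp add: R_def)
qed

lemma left_kernel_fundamental:
  assumes "\<phi> \<in> test_functions UNIV"
  shows "(LINT x|lborel. deriv \<phi> x *\<^sub>R left_kernel k (x - y)) =
    - of_real (\<phi> y) - k * (LINT x|lborel. \<phi> x *\<^sub>R left_kernel k (x - y))"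
proof -
  obtain R where R: "R > 0" "\<bar>y\<bar> < R" "\<And>x. \<bar>x\<bar> \<ge> R \<Longrightarrow> \<phi> x = 0" "\<And>x. \<bar>x\<bar> \<ge> R \<Longrightarrow> deriv \<phi> x = 0"
    using test_function_cutoff[OF assms, of y] by metis
  have supp: "\<forall>x. \<bar>x\<bar> \<ge> R \<longrightarrow> \<phi> x = 0" "\<forall>x. \<bar>x\<bar> \<ge> R \<longrightarrow> deriv \<phi> x = 0"
    using R by blast+
  have sm: "smooth \<phi>" using assms by (simp add: test_functions_iff)
  define h where "h x = exp (k * of_real x + - (k * of_real y))" for x :: real
  have ker: "f x *\<^sub>R left_kernel k (x - y) = - (indicator {- R..y} x *\<^sub>R (f x *\<^sub>R h x))"
    if "\<forall>x. \<bar>x\<bar> \<ge> R \<longrightarrow> f x = 0" for f :: "real \<Rightarrow> real" and x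
    using that[rule_format, of x] by (auto simp: left_kernel_def h_def indicator_def algebra_simps)
  have "(LINT x|lborel. indicator {- R..y} x *\<^sub>R (deriv \<phi> x *\<^sub>R h x)) =
      \<phi> y *\<^sub>R h y - \<phi> (- R) *\<^sub>R h (- R) - (LINT x|lborel. indicator {- R..y} x *\<^sub>R (\<phi> x *\<^sub>R (k * h x)))"
  proof (rule integration_by_parts_smooth[OF sm])
    show "(h has_vector_derivative k * h x) (at x)" for x
      unfolding h_def[abs_def] by (rule has_vector_derivative_exp_mult)
    show "continuous_on UNIV (\<lambda>x. k * h x)"
      unfolding h_def[abs_def] by (intro continuous_intros)
  qed (use R in auto)
  also have "\<phi> (- R) = 0" using R by simp
  also have "h y = 1" by (simp add: h_def)
  also have "(\<lambda>x. indicat_real {- R..y} x *\<^sub>R (\<phi> x *\<^sub>R (k * h x))) =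
      (\<lambda>x. k * (indicat_real {- R..y} x *\<^sub>R (\<phi> x *\<^sub>R h x)))"
    by (simp add: fun_eq_iff)
  finally show ?thesis
    unfolding ker[OF supp(1)] ker[OF supp(2)]
    by (simp add: scaleR_conv_of_real)
qed

lemma right_kernel_fundamental:
  assumes "\<phi> \<in> test_functions UNIV"
  shows "(LINT x|lborel. deriv \<phi> x *\<^sub>R right_kernel k (x - y)) =
    - of_real (\<phi> y) - (- k) * (LINT x|lborel. \<phi> x *\<^sub>R right_kernel k (x - y))"
proof -
  obtain R where R: "R > 0" "\<bar>y\<bar> < R" "\<And>x. \<bar>x\<bar> \<ge> R \<Longrightarrow> \<phi> x = 0" "\<And>x. \<bar>x\<bar> \<ge> R \<Longrightarrow> deriv \<phi> x = 0"
    using test_function_cutoff[OF assms, of y] by metis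
  have supp: "\<forall>x. \<bar>x\<bar> \<ge> R \<longrightarrow> \<phi> x = 0" "\<forall>x. \<bar>x\<bar> \<ge> R \<longrightarrow> deriv \<phi> x = 0"
    using R by blast+
  have sm: "smooth \<phi>" using assms by (simp add: test_functions_iff)
  define h where "h x = exp (- k * of_real x + k * of_real y)" for x :: real
  have ker: "f x *\<^sub>R right_kernel k (x - y) = indicator {y..R} x *\<^sub>R (f x *\<^sub>R h x)"
    if "\<forall>x. \<bar>x\<bar> \<ge> R \<longrightarrow> f x = 0" for f :: "real \<Rightarrow> real" and x
    using that[rule_format, of x] by (auto simp: right_kernel_def h_def indicator_def algebra_simps)
  have "(LINT x|lborel. indicator {y..R} x *\<^sub>R (deriv \<phi> x *\<^sub>R h x)) =
      \<phi> R *\<^sub>R h R - \<phi> y *\<^sub>R h y - (LINT x|lborel. indicator {y..R} x *\<^sub>R (\<phi> x *\<^sub>R (- k * h x)))"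
  proof (rule integration_by_parts_smooth[OF sm])
    show "(h has_vector_derivative - k * h x) (at x)" for x
      unfolding h_def[abs_def] by (rule has_vector_derivative_exp_mult)
    show "continuous_on UNIV (\<lambda>x. - k * h x)"
      unfolding h_def[abs_def] by (intro continuous_intros)
  qed (use R in auto)
  also have "\<phi> R = 0" using R by simp
  also have "h y = 1" by (simp add: h_def)
  also have "(\<lambda>x. indicat_real {y..R} x *\<^sub>R (\<phi> x *\<^sub>R (- k * h x))) =
      (\<lambda>x. - k * (indicat_real {y..R} x *\<^sub>R (\<phi> x *\<^sub>R h x)))"
    by (simp add: fun_eq_iff)
  finally show ?thesis
    unfolding ker[OF supp(1)] ker[OF supp(2)]
    by (simp add: scaleR_conv_of_real)
qed

lemma kernel_bounds:
  assumes "Re k > 0"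
  shows "norm (left_kernel k s) \<le> exp (- Re k * \<bar>s\<bar>)" "norm (right_kernel k s) \<le> exp (- Re k * \<bar>s\<bar>)"
  by (auto simp: left_kernel_def right_kernel_def norm_exp_eq_Re)

lemma kernel_measurable[measurable]:
  "left_kernel k \<in> borel_measurable borel" "right_kernel k \<in> borel_measurable borel"
  unfolding left_kernel_def[abs_def] right_kernel_def[abs_def] by measurable

lemma kernel_continuous:
  assumes "s \<noteq> 0"
  shows "isCont (left_kernel k) s" "isCont (right_kernel k) s"
proof -
  consider "s < 0" | "s > 0" using assms by linarith
  then have "isCont (left_kernel k) s \<and> isCont (right_kernel k) s"
  proof cases
    case 1
    have ev: "eventually (\<lambda>x. x < 0) (nhds s)"
      using eventually_nhds_in_open[of "{..<0}" s] 1 by simp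
    have "isCont (\<lambda>x::real. - exp (k * of_real x)) s" by (intro continuous_intros)
    moreover have "eventually (\<lambda>x. left_kernel k x = - exp (k * of_real x)) (nhds s)"
      using ev by eventually_elim (simp add: left_kernel_def)
    moreover have "eventually (\<lambda>x. right_kernel k x = 0) (nhds s)"
      using ev by eventually_elim (simp add: right_kernel_def)
    ultimately show ?thesis
      using isCont_cong[of "left_kernel k" _ s] isCont_cong[of "right_kernel k" "\<lambda>_. 0" s] by simp
  next
    case 2
    have ev: "eventually (\<lambda>x. x > 0) (nhds s)"
      using eventually_nhds_in_open[of "{0<..}" s] 2 by simp
    have "isCont (\<lambda>x::real. exp (- (k * of_real x))) s" by (intro continuous_intros)
    moreover have "eventually (\<lambda>x. right_kernel k x = exp (- (k * of_real x))) (nhds s)"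
      using ev by eventually_elim (simp add: right_kernel_def)
    moreover have "eventually (\<lambda>x. left_kernel k x = 0) (nhds s)"
      using ev by eventually_elim (simp add: left_kernel_def)
    ultimately show ?thesis
      using isCont_cong[of "right_kernel k" _ s] isCont_cong[of "left_kernel k" "\<lambda>_. 0" s] by simp
  qed
  then show "isCont (left_kernel k) s" "isCont (right_kernel k) s" by auto
qed

section \<open>Spinors, traces and the punctured half-line\<close>

lemma norm_vec2_power2: "(norm (v :: complex^2))\<^sup>2 = (norm (v $ 1))\<^sup>2 + (norm (v $ 2))\<^sup>2"
  by (simp add: norm_vec_def L2_set_def sum_2)

lemma matrix2_mult_nth [simp]:
  "(matrix2 p q r s *v v) $ 1 = p * v $ 1 + q * v $ 2"
  "(matrix2 p q r s *v v) $ 2 = r * v $ 1 + s * v $ 2"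
  by (simp_all add: matrix2_def matrix_vector_mult_def sum_2)

lemma vec2_eq_iff: "(v :: complex^2) = w \<longleftrightarrow> v $ 1 = w $ 1 \<and> v $ 2 = w $ 2"
  by (simp add: vec_eq_iff forall_2)

lemma continuous_on_vec2:
  assumes "continuous_on A u" "continuous_on A v"
  shows "continuous_on A (\<lambda>x. vector [u x, v x] :: complex^2)"
proof -
  have 1: "continuous_on A (\<lambda>x. \<chi> i::2. if i = 1 then u x else v x)"
  proof (rule continuous_on_vec_lambda)
    show "continuous_on A (\<lambda>x. if i = 1 then u x else v x)" for i :: 2
      using assms by (cases "i = 1") simp_all
  qed
  have 2: "(\<lambda>x. \<chi> i::2. if i = 1 then u x else v x) = (\<lambda>x. vector [u x, v x] :: complex^2)"
    by (simp add: fun_eq_iff vec_eq_iff forall_2)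
  show ?thesis using 1 unfolding 2 .
qed

lemma measurable_vec2_iff:
  fixes f :: "'a \<Rightarrow> complex^2"
  shows "f \<in> borel_measurable M \<longleftrightarrow>
    (\<lambda>x. f x $ 1) \<in> borel_measurable M \<and> (\<lambda>x. f x $ 2) \<in> borel_measurable M"
proof
  assume f: "f \<in> borel_measurable M"
  have c: "(\<lambda>v::complex^2. v $ i) \<in> borel_measurable borel" for i
    by (intro borel_measurable_continuous_onI continuous_intros)
  show "(\<lambda>x. f x $ 1) \<in> borel_measurable M \<and> (\<lambda>x. f x $ 2) \<in> borel_measurable M"
    using measurable_compose[OF f c] by blast
next
  assume f: "(\<lambda>x. f x $ 1) \<in> borel_measurable M \<and> (\<lambda>x. f x $ 2) \<in> borel_measurable M"
  have 1: "(\<lambda>p :: complex \<times> complex. vector [fst p, snd p] :: complex^2) \<in> borel_measurable borel"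
    by (intro borel_measurable_continuous_onI continuous_on_vec2 continuous_intros)
  have 2: "(\<lambda>x. (f x $ 1, f x $ 2)) \<in> borel_measurable M"
    using f by (intro borel_measurable_Pair) auto
  have "(\<lambda>x. vector [f x $ 1, f x $ 2] :: complex^2) \<in> borel_measurable M"
    using measurable_compose[OF 2 1] by simp
  moreover have "(\<lambda>x. vector [f x $ 1, f x $ 2]) = f"
    by (simp add: fun_eq_iff vec2_eq_iff)
  ultimately show "f \<in> borel_measurable M" by simp
qed

lemma L2_iff:
  "\<psi> \<in> L2 \<Omega> \<longleftrightarrow> square_integrable \<Omega> (\<lambda>x. \<psi> x $ 1) \<and> square_integrable \<Omega> (\<lambda>x. \<psi> x $ 2)"
proof
  assume \<psi>: "\<psi> \<in> L2 \<Omega>"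
  then have m: "(\<lambda>x. \<psi> x $ 1) \<in> borel_measurable (lebesgue_on \<Omega>)"
    "(\<lambda>x. \<psi> x $ 2) \<in> borel_measurable (lebesgue_on \<Omega>)"
    using measurable_vec2_iff by (auto simp: L2_def)
  have i: "integrable (lebesgue_on \<Omega>) (\<lambda>x. (norm (\<psi> x))\<^sup>2)"
    using \<psi> by (simp add: L2_def)
  have "integrable (lebesgue_on \<Omega>) (\<lambda>x. (norm (\<psi> x $ 1))\<^sup>2)"
    by (rule Bochner_Integration.integrable_bound[OF i])
      (use m(1) in measurable, auto intro!: AE_I2 simp: norm_vec2_power2)
  moreover have "integrable (lebesgue_on \<Omega>) (\<lambda>x. (norm (\<psi> x $ 2))\<^sup>2)"
    by (rule Bochner_Integration.integrable_bound[OF i])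
      (use m(2) in measurable, auto intro!: AE_I2 simp: norm_vec2_power2)
  ultimately show "square_integrable \<Omega> (\<lambda>x. \<psi> x $ 1) \<and> square_integrable \<Omega> (\<lambda>x. \<psi> x $ 2)"
    using m by (simp add: square_integrable_def)
next
  assume "square_integrable \<Omega> (\<lambda>x. \<psi> x $ 1) \<and> square_integrable \<Omega> (\<lambda>x. \<psi> x $ 2)"
  then show "\<psi> \<in> L2 \<Omega>"
    unfolding L2_def square_integrable_def
    by (auto simp: norm_vec2_power2 measurable_vec2_iff[of \<psi>])
qed

definition L2_norm_scalar :: "real set \<Rightarrow> (real \<Rightarrow> complex) \<Rightarrow> real" where
  "L2_norm_scalar \<Omega> u = sqrt (LINT x|lebesgue_on \<Omega>. (norm (u x))\<^sup>2)"

lemma L2_norm_scalar_nonneg: "L2_norm_scalar \<Omega> u \<ge> 0"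
  by (simp add: L2_norm_scalar_def)

lemma L2_norm_power2:
  assumes "\<psi> \<in> L2 \<Omega>"
  shows "(L2_norm \<Omega> \<psi>)\<^sup>2 = (L2_norm_scalar \<Omega> (\<lambda>x. \<psi> x $ 1))\<^sup>2 + (L2_norm_scalar \<Omega> (\<lambda>x. \<psi> x $ 2))\<^sup>2"
proof -
  have i: "integrable (lebesgue_on \<Omega>) (\<lambda>x. (norm (\<psi> x $ 1))\<^sup>2)" "integrable (lebesgue_on \<Omega>) (\<lambda>x. (norm (\<psi> x $ 2))\<^sup>2)"
    using assms unfolding L2_iff square_integrable_def by auto
  have "(LINT x|lebesgue_on \<Omega>. (norm (\<psi> x))\<^sup>2) =
      (LINT x|lebesgue_on \<Omega>. (norm (\<psi> x $ 1))\<^sup>2) + (LINT x|lebesgue_on \<Omega>. (norm (\<psi> x $ 2))\<^sup>2)"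
    unfolding norm_vec2_power2 using i by (rule Bochner_Integration.integral_add)
  then show ?thesis
    by (simp add: L2_norm_def L2_norm_scalar_def)
qed

lemma L2_norm_le_components:
  assumes "\<psi> \<in> L2 \<Omega>"
  shows "L2_norm \<Omega> \<psi> \<le> L2_norm_scalar \<Omega> (\<lambda>x. \<psi> x $ 1) + L2_norm_scalar \<Omega> (\<lambda>x. \<psi> x $ 2)"
proof (rule power2_le_imp_le)
  show "(L2_norm \<Omega> \<psi>)\<^sup>2 \<le> (L2_norm_scalar \<Omega> (\<lambda>x. \<psi> x $ 1) + L2_norm_scalar \<Omega> (\<lambda>x. \<psi> x $ 2))\<^sup>2"
    unfolding L2_norm_power2[OF assms] power2_sum by (simp add: L2_norm_scalar_nonneg)
qed (simp add: L2_norm_scalar_nonneg)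

lemma components_le_L2_norm:
  assumes "\<psi> \<in> L2 \<Omega>"
  shows "L2_norm_scalar \<Omega> (\<lambda>x. \<psi> x $ 1) \<le> L2_norm \<Omega> \<psi>" "L2_norm_scalar \<Omega> (\<lambda>x. \<psi> x $ 2) \<le> L2_norm \<Omega> \<psi>"
proof -
  have n: "0 \<le> L2_norm \<Omega> \<psi>" by (simp add: L2_norm_def)
  show "L2_norm_scalar \<Omega> (\<lambda>x. \<psi> x $ 1) \<le> L2_norm \<Omega> \<psi>"
    by (rule power2_le_imp_le[OF _ n]) (simp add: L2_norm_power2[OF assms])
  show "L2_norm_scalar \<Omega> (\<lambda>x. \<psi> x $ 2) \<le> L2_norm \<Omega> \<psi>"
    by (rule power2_le_imp_le[OF _ n]) (simp add: L2_norm_power2[OF assms])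
qed

lemma L2_norm_scalar_linear:
  assumes "square_integrable \<Omega> u" "square_integrable \<Omega> v"
  shows "L2_norm_scalar \<Omega> (\<lambda>x. A * u x + B * v x) \<le>
    2 * (norm A * L2_norm_scalar \<Omega> u + norm B * L2_norm_scalar \<Omega> v)"
proof (rule power2_le_imp_le)
  let ?u = "L2_norm_scalar \<Omega> u" and ?v = "L2_norm_scalar \<Omega> v"
  have sq: "(L2_norm_scalar \<Omega> w)\<^sup>2 = (LINT x|lebesgue_on \<Omega>. (norm (w x))\<^sup>2)" for w
    by (simp add: L2_norm_scalar_def)
  have "(L2_norm_scalar \<Omega> (\<lambda>x. A * u x + B * v x))\<^sup>2 \<le> 2 * (norm A)\<^sup>2 * ?u\<^sup>2 + 2 * (norm B)\<^sup>2 * ?v\<^sup>2"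
    unfolding sq by (rule square_integrable_linear(2)[OF assms])
  also have "\<dots> \<le> (2 * (norm A * ?u + norm B * ?v))\<^sup>2"
  proof -
    have "0 \<le> (norm A * ?u) * (norm B * ?v)"
      by (simp add: L2_norm_scalar_nonneg)
    moreover have "0 \<le> (norm A * ?u)\<^sup>2" "0 \<le> (norm B * ?v)\<^sup>2" by (rule zero_le_power2)+
    ultimately show ?thesis
      unfolding power_mult_distrib[of 2] power2_sum by (simp add: power_mult_distrib)
  qed
  finally show "(L2_norm_scalar \<Omega> (\<lambda>x. A * u x + B * v x))\<^sup>2 \<le> (2 * (norm A * ?u + norm B * ?v))\<^sup>2" .
qed (simp add: L2_norm_scalar_nonneg)

lemma vec2_integral_nth:
  fixes f :: "real \<Rightarrow> complex^2"
  assumes "integrable M (\<lambda>x. f x $ 1)" "integrable M (\<lambda>x. f x $ 2)"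
  shows "(integral\<^sup>L M f) $ i = (LINT x|M. f x $ i)"
proof -
  have "integrable M f"
  proof (rule Bochner_Integration.integrable_bound)
    show "integrable M (\<lambda>x. norm (f x $ 1) + norm (f x $ 2))"
      using assms by simp
    show "f \<in> borel_measurable M"
      using assms by (simp add: measurable_vec2_iff)
    show "AE x in M. norm (f x) \<le> norm (norm (f x $ 1) + norm (f x $ 2))"
    proof (rule AE_I2)
      fix x
      have "norm (f x) \<le> norm (f x $ 1) + norm (f x $ 2)"
        unfolding norm_vec_def using L2_set_le_sum[of UNIV "\<lambda>i. norm (f x $ i)"] by (simp add: sum_2)
      then show "norm (f x) \<le> norm (norm (f x $ 1) + norm (f x $ 2))" by simp
    qed
  qed
  then show ?thesis
    using integral_bounded_linear[OF bounded_linear_vec_nth] by metis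
qed

lemma weak_deriv_iff:
  assumes \<Omega>: "open \<Omega>" and \<psi>: "\<psi> \<in> L2 \<Omega>" and g: "g \<in> L2 \<Omega>"
  shows "weak_deriv \<Omega> \<psi> g \<longleftrightarrow> weak_derivative \<Omega> (\<lambda>x. \<psi> x $ 1) (\<lambda>x. g x $ 1) \<and>
    weak_derivative \<Omega> (\<lambda>x. \<psi> x $ 2) (\<lambda>x. g x $ 2)"
proof -
  have nth: "(LINT x|lebesgue_on \<Omega>. deriv \<phi> x *\<^sub>R \<psi> x) $ i = (LINT x|lebesgue_on \<Omega>. deriv \<phi> x *\<^sub>R \<psi> x $ i)"
    "(LINT x|lebesgue_on \<Omega>. \<phi> x *\<^sub>R g x) $ i = (LINT x|lebesgue_on \<Omega>. \<phi> x *\<^sub>R g x $ i)"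
    if "\<phi> \<in> test_functions \<Omega>" for \<phi> i
    using \<psi> g test_function_integrable[OF _ \<Omega> that] unfolding L2_iff
    by (subst vec2_integral_nth; simp)+
  show ?thesis
    unfolding weak_deriv_def weak_derivative_def ball_conj_distrib[symmetric]
    by (rule ball_cong[OF refl]) (simp add: vec2_eq_iff nth)
qed

lemma has_traceI:
  assumes "continuous_on UNIV e" "\<And>x. x \<in> I \<Longrightarrow> \<psi> x = e x"
  shows "has_trace I c \<psi> (e c)"
  unfolding has_trace_def
proof (intro exI[of _ e] conjI)
  show "continuous_on I e" using assms(1) by (rule continuous_on_subset) simp
  show "AE x in lebesgue_on I. e x = \<psi> x" using assms(2) by (intro AE_I2) simp
  show "(e \<longlongrightarrow> e c) (at c within I)"
    using assms(1) by (meson continuous_on_eq_continuous_at continuous_within isCont_def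
        tendsto_within_subset UNIV_I open_UNIV subset_UNIV)
qed

lemma has_trace_diff:
  assumes "has_trace I c \<psi> v" "has_trace I c \<phi> w"
  shows "has_trace I c (\<lambda>x. \<psi> x - \<phi> x) (v - w)"
proof -
  obtain u1 u2 where
    "continuous_on I u1" "AE x in lebesgue_on I. u1 x = \<psi> x" "(u1 \<longlongrightarrow> v) (at c within I)"
    "continuous_on I u2" "AE x in lebesgue_on I. u2 x = \<phi> x" "(u2 \<longlongrightarrow> w) (at c within I)"
    using assms unfolding has_trace_def by blast
  then show ?thesis
    unfolding has_trace_def
    by (intro exI[of _ "\<lambda>x. u1 x - u2 x"]) (auto intro!: continuous_on_diff tendsto_diff elim: eventually_elim2)
qed

text \<open>
Two continuous functions that agree almost everywhere on an open set agree everywhere on it, so the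
boundary value can be read off from any continuous representative.
\<close>

lemma has_trace_unique:
  assumes "has_trace I c \<psi> v" and I: "open I" "at c within I \<noteq> bot"
    and e: "continuous_on UNIV e" "AE x in lebesgue_on I. \<psi> x = e x"
  shows "v = e c"
proof -
  obtain u where u: "continuous_on I u" "AE x in lebesgue_on I. u x = \<psi> x" "(u \<longlongrightarrow> v) (at c within I)"
    using assms(1) unfolding has_trace_def by blast
  have e': "continuous_on I e" using e(1) by (rule continuous_on_subset) simp
  define S where "S = {x \<in> I. u x - e x \<in> - {0}}"
  have "open S"
    unfolding S_def by (rule continuous_open_preimage[OF continuous_on_diff[OF u(1) e'] I(1), unfolded vimage_def Int_def mem_Collect_eq])
      (rule open_Compl[OF closed_singleton])
  moreover have "negligible S"
  proof -
    have "AE x in lebesgue_on I. u x = e x"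
      using u(2) e(2) by eventually_elim simp
    then have "AE x in lebesgue. x \<in> I \<longrightarrow> u x = e x"
      using I(1) by (subst (asm) AE_restrict_space_iff) (auto simp: borel_open)
    then have "AE x in lebesgue. x \<notin> S"
      by eventually_elim (simp add: S_def)
    moreover have "S \<in> sets lebesgue"
      using \<open>open S\<close> by (simp add: borel_open)
    ultimately show ?thesis
      using AE_iff_null_sets negligible_iff_null_sets by blast
  qed
  ultimately have "S = {}" using open_not_negligible by blast
  then have eq: "u x = e x" if "x \<in> I" for x
    using that by (auto simp: S_def)
  have "isCont e c" using e(1) by (simp add: continuous_on_eq_continuous_at)
  then have "(e \<longlongrightarrow> e c) (at c)" by (simp only: isCont_def)
  then have "(e \<longlongrightarrow> e c) (at c within I)"
    by (rule tendsto_within_subset) simp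
  moreover have "(e \<longlongrightarrow> v) (at c within I)"
    by (rule Lim_transform_eventually[OF u(3)]) (simp add: eventually_at_filter eq)
  ultimately show ?thesis
    using I(2) tendsto_unique by blast
qed

lemma punctured_half_line_facts:
  assumes "a > 0"
  shows "open (punctured_half_line a)" "punctured_half_line a \<subseteq> half_line"
    "half_line \<subseteq> insert a (punctured_half_line a)" "punctured_half_line a \<in> sets lebesgue"
    "0 \<notin> punctured_half_line a" "a \<notin> punctured_half_line a"
proof -
  show "open (punctured_half_line a)" by (auto simp: punctured_half_line_def)
  then show "punctured_half_line a \<in> sets lebesgue" by (simp add: borel_open)
qed (use assms in \<open>auto simp: punctured_half_line_def\<close>)

text \<open>
The eigenvalue equation is posed almost everywhere on the half-line, the weak derivative on the
half-line without the point \<open>a\<close>.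
\<close>

lemma AE_half_line_iff:
  assumes "a > 0"
  shows "(AE x in lebesgue_on half_line. P x) \<longleftrightarrow> (AE x in lebesgue_on (punctured_half_line a). P x)"
proof -
  have "AE x in lebesgue. x \<noteq> a"
    using AE_lborel_singleton[of a] by (simp add: AE_completion_iff)
  note a = this
  have "(AE x in lebesgue. x \<in> half_line \<longrightarrow> P x) \<longleftrightarrow> (AE x in lebesgue. x \<in> punctured_half_line a \<longrightarrow> P x)"
  proof
    assume "AE x in lebesgue. x \<in> half_line \<longrightarrow> P x"
    then show "AE x in lebesgue. x \<in> punctured_half_line a \<longrightarrow> P x"
      by eventually_elim (use punctured_half_line_facts(2)[OF assms] in blast)
  next
    assume "AE x in lebesgue. x \<in> punctured_half_line a \<longrightarrow> P x"
    with a show "AE x in lebesgue. x \<in> half_line \<longrightarrow> P x"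
      by eventually_elim (use punctured_half_line_facts(3)[OF assms] in blast)
  qed
  then show ?thesis
    using punctured_half_line_facts(4)[OF assms]
    by (subst (1 2) AE_restrict_space_iff) auto
qed

lemma square_integrable_half_line:
  assumes "a > 0" and u: "square_integrable (punctured_half_line a) u"
  shows "square_integrable half_line u"
proof -
  let ?P = "punctured_half_line a"
  have eq: "(\<lambda>x. if x \<in> half_line then u x else 0) =
      (\<lambda>x. if x \<in> {a} then u a else (if x \<in> ?P then u x else 0))"
    using punctured_half_line_facts[OF assms(1)] assms(1) by (auto simp: fun_eq_iff)
  have "(\<lambda>x. if x \<in> ?P then u x else 0) \<in> borel_measurable lebesgue"
    using u borel_measurable_if[OF punctured_half_line_facts(4)[OF assms(1)], of u]
    by (simp add: square_integrable_def)
  then have "(\<lambda>x. if x \<in> half_line then u x else 0) \<in> borel_measurable lebesgue"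
    unfolding eq by (rule measurable_If_set[where f = "\<lambda>_. u a", rotated]) auto
  then have m: "u \<in> borel_measurable (lebesgue_on half_line)"
    using borel_measurable_if[of half_line u] by simp
  have "integrable lebesgue (\<lambda>x. indicat_real ?P x *\<^sub>R (norm (u x))\<^sup>2)"
    using u punctured_half_line_facts[OF assms(1)]
      integrable_restrict_space[of ?P lebesgue "\<lambda>x. (norm (u x))\<^sup>2"]
    by (simp add: square_integrable_def)
  moreover have "(\<lambda>x. indicat_real half_line x *\<^sub>R (norm (u x))\<^sup>2) \<in> borel_measurable lebesgue"
  proof -
    have "(\<lambda>x. (norm (u x))\<^sup>2) \<in> borel_measurable (lebesgue_on half_line)"
      using m by measurable
    then show ?thesis
      by (subst (asm) borel_measurable_restrict_space_iff) auto
  qed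
  moreover have "AE x in lebesgue. indicat_real ?P x *\<^sub>R (norm (u x))\<^sup>2 =
      indicat_real half_line x *\<^sub>R (norm (u x))\<^sup>2"
  proof -
    have "AE x in lebesgue. x \<noteq> a"
      using AE_lborel_singleton[of a] by (simp add: AE_completion_iff)
    then show ?thesis
      by eventually_elim
        (use punctured_half_line_facts[OF assms(1)] in \<open>auto simp: indicator_def\<close>)
  qed
  ultimately have "integrable lebesgue (\<lambda>x. indicat_real half_line x *\<^sub>R (norm (u x))\<^sup>2)"
    using integrable_cong_AE[of _ lebesgue] borel_measurable_integrable by blast
  then have "integrable (lebesgue_on half_line) (\<lambda>x. (norm (u x))\<^sup>2)"
    using integrable_restrict_space[of half_line lebesgue "\<lambda>x. (norm (u x))\<^sup>2"] by simp
  with m show ?thesis by (simp add: square_integrable_def)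
qed

lemma square_integrable_punctured:
  assumes "a > 0" "square_integrable half_line u"
  shows "square_integrable (punctured_half_line a) u"
  using assms punctured_half_line_facts[OF assms(1)]
  by (intro square_integrable_subset[OF assms(2)]) auto

text \<open>
The value at \<open>a\<close> is immaterial; assigning it to the right piece is a convention.
\<close>

definition piecewise :: "real \<Rightarrow> (real \<Rightarrow> complex) \<Rightarrow> (real \<Rightarrow> complex) \<Rightarrow> real \<Rightarrow> complex" where
  "piecewise a h1 h2 x = (if x < a then h1 x else h2 x)"

lemma piecewise_measurable:
  assumes "continuous_on UNIV h1" "continuous_on UNIV h2"
  shows "piecewise a h1 h2 \<in> borel_measurable borel"
proof -
  have [measurable]: "h1 \<in> borel_measurable borel" "h2 \<in> borel_measurable borel"
    using assms by (auto intro: borel_measurable_continuous_onI)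
  show ?thesis unfolding piecewise_def[abs_def] by measurable
qed

lemma square_integrable_piecewise:
  assumes h1: "continuous_on UNIV h1" and h2: "continuous_on UNIV h2"
    and "k > 0" and bound: "\<And>x. x \<ge> a \<Longrightarrow> norm (h2 x) \<le> C * exp (- k * \<bar>x\<bar>)" and "a > 0"
  shows "square_integrable half_line (piecewise a h1 h2)"
proof -
  have mb: "piecewise a h1 h2 \<in> borel_measurable borel"
    by (rule piecewise_measurable[OF h1 h2])
  have m: "piecewise a h1 h2 \<in> borel_measurable (lebesgue_on half_line)"
    using mb by (simp add: measurable_completion measurable_restrict_space1)
  have 1: "integrable lborel (\<lambda>x. indicator {0..a} x *\<^sub>R (norm (h1 x))\<^sup>2)"
    using h1 by (intro borel_integrable_compact compact_Icc continuous_intros) (auto intro: continuous_on_subset)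
  have 2: "integrable lborel (\<lambda>x::real. exp (- (2 * k) * \<bar>x\<bar>))"
  proof (rule integrableI_bounded)
    have "(\<integral>\<^sup>+x. ennreal (exp (- (2 * k) * \<bar>0 - x\<bar>)) \<partial>lborel) < \<infinity>"
      by (subst nn_integral_exp_abs) (use \<open>k > 0\<close> in auto)
    then show "(\<integral>\<^sup>+x. ennreal (norm (exp (- (2 * k) * \<bar>x\<bar>))) \<partial>lborel) < \<infinity>"
      by simp
  qed measurable
  let ?b = "\<lambda>x. indicator {0..a} x *\<^sub>R (norm (h1 x))\<^sup>2 + C\<^sup>2 * exp (- (2 * k) * \<bar>x\<bar>)"
  have ib: "integrable lborel ?b"
    by (rule Bochner_Integration.integrable_add[OF 1 integrable_mult_right[OF 2]])
  have "integrable lebesgue ?b"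
    by (rule iffD2[OF integrable_completion[OF borel_measurable_integrable[OF ib]] ib])
  then have "integrable (lebesgue_on UNIV) ?b"
    unfolding lebesgue_on_UNIV_eq .
  then have b: "integrable (lebesgue_on half_line) ?b"
    by (rule integrable_lebesgue_on_subset[OF _ _ _ subset_UNIV]) simp_all
  have "integrable (lebesgue_on half_line) (\<lambda>x. (norm (piecewise a h1 h2 x))\<^sup>2)"
  proof (rule Bochner_Integration.integrable_bound[OF b])
    show "AE x in lebesgue_on half_line. norm ((norm (piecewise a h1 h2 x))\<^sup>2) \<le> norm (?b x)"
    proof (rule AE_I2)
      fix x assume "x \<in> space (lebesgue_on half_line)"
      then have x: "x > 0" by simp
      have "(norm (piecewise a h1 h2 x))\<^sup>2 \<le> ?b x"
      proof (cases "x < a")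
        case True
        then show ?thesis using x by (simp add: piecewise_def)
      next
        case False
        have "(norm (h2 x))\<^sup>2 \<le> (C * exp (- k * \<bar>x\<bar>))\<^sup>2"
          using bound[of x] False by (intro power_mono) auto
        also have "\<dots> = C\<^sup>2 * exp (- (2 * k) * \<bar>x\<bar>)"
          by (simp add: power_mult_distrib mult.assoc flip: exp_double)
        finally show ?thesis
          using False by (simp add: piecewise_def add_increasing)
      qed
      then show "norm ((norm (piecewise a h1 h2 x))\<^sup>2) \<le> norm (?b x)"
        unfolding real_norm_def by (auto intro: order_trans[OF _ abs_ge_self])
    qed
  qed (use m in measurable)
  with m show ?thesis by (simp add: square_integrable_def)
qed

text \<open>
A test function on the punctured half-line vanishes at \<open>0\<close> and at \<open>a\<close>, so integrating by parts on
each side leaves no boundary terms, whatever the jump at \<open>a\<close>.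
\<close>

lemma weak_derivative_piecewise:
  assumes "a > 0"
    and h1: "\<And>x. (h1 has_vector_derivative h1' x) (at x)" "continuous_on UNIV h1'"
    and h2: "\<And>x. (h2 has_vector_derivative h2' x) (at x)" "continuous_on UNIV h2'"
  shows "weak_derivative (punctured_half_line a) (piecewise a h1 h2) (piecewise a h1' h2')"
  unfolding weak_derivative_def
proof
  let ?P = "punctured_half_line a"
  note P = punctured_half_line_facts[OF \<open>a > 0\<close>]
  fix \<phi> assume \<phi>: "\<phi> \<in> test_functions ?P"
  then obtain K where K: "smooth \<phi>" "compact K" "K \<subseteq> ?P" "\<And>x. x \<notin> K \<Longrightarrow> \<phi> x = 0"
    unfolding test_functions_iff by blast
  have out: "\<phi> x = 0" "deriv \<phi> x = 0" if "x \<notin> ?P" for x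
  proof -
    have "x \<notin> K" using K(3) that by blast
    then show "\<phi> x = 0" "deriv \<phi> x = 0"
      using K(4) deriv_eq_0_outside[OF K(2), of \<phi> x] by auto
  qed
  obtain R where R: "\<bar>a\<bar> < R" "\<And>x. \<bar>x\<bar> \<ge> R \<Longrightarrow> \<phi> x = 0" "\<And>x. \<bar>x\<bar> \<ge> R \<Longrightarrow> deriv \<phi> x = 0"
    using test_function_cutoff[OF \<phi>, of a] by metis
  have ch: "continuous_on UNIV h1" "continuous_on UNIV h2"
    using h1(1) h2(1)
    by (meson continuous_at_imp_continuous_on has_vector_derivative_continuous)+
  have split: "(LINT x|lebesgue_on ?P. f x *\<^sub>R piecewise a k1 k2 x) =
      (LINT x|lborel. indicator {0..a} x *\<^sub>R (f x *\<^sub>R k1 x)) +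
      (LINT x|lborel. indicator {a..R} x *\<^sub>R (f x *\<^sub>R k2 x))"
    if f: "\<And>x. x \<notin> ?P \<Longrightarrow> f x = 0" "\<And>x. \<bar>x\<bar> \<ge> R \<Longrightarrow> f x = 0" "continuous_on UNIV f"
      and k: "continuous_on UNIV k1" "continuous_on UNIV k2"
    for f :: "real \<Rightarrow> real" and k1 k2 :: "real \<Rightarrow> complex"
  proof -
    have [measurable]: "f \<in> borel_measurable borel" "piecewise a k1 k2 \<in> borel_measurable borel"
      using f(3) k by (auto intro: borel_measurable_continuous_onI piecewise_measurable)
    have "(LINT x|lebesgue_on ?P. f x *\<^sub>R piecewise a k1 k2 x) = (LINT x|lborel. f x *\<^sub>R piecewise a k1 k2 x)"
      by (rule integrable_lebesgue_on_borel(2)[OF _ P(1)]) (measurable, simp add: f(1))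
    also have "\<dots> = (LINT x|lborel. indicator {0..a} x *\<^sub>R (f x *\<^sub>R k1 x) + indicator {a..R} x *\<^sub>R (f x *\<^sub>R k2 x))"
    proof (rule Bochner_Integration.integral_cong[OF refl])
      fix x
      consider "x \<notin> ?P" | "\<bar>x\<bar> \<ge> R" | "x \<in> ?P" "\<bar>x\<bar> < R" by linarith
      then show "f x *\<^sub>R piecewise a k1 k2 x =
          indicator {0..a} x *\<^sub>R (f x *\<^sub>R k1 x) + indicator {a..R} x *\<^sub>R (f x *\<^sub>R k2 x)"
      proof cases
        case 3
        then consider "0 < x" "x < a" | "a < x" "x < R"
          by (auto simp: punctured_half_line_def)
        then show ?thesis
          using \<open>a > 0\<close> by cases (simp_all add: piecewise_def)
      qed (simp_all add: f)
    qed
    also have "\<dots> = (LINT x|lborel. indicator {0..a} x *\<^sub>R (f x *\<^sub>R k1 x)) +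
        (LINT x|lborel. indicator {a..R} x *\<^sub>R (f x *\<^sub>R k2 x))"
      using f(3) k
      by (intro Bochner_Integration.integral_add borel_integrable_compact compact_Icc continuous_on_scaleR)
        (auto intro: continuous_on_subset)
    finally show ?thesis .
  qed
  have cont: "continuous_on UNIV \<phi>" "continuous_on UNIV (deriv \<phi>)"
    by (intro smooth_continuous_on smooth_deriv K(1))+
  have "(LINT x|lebesgue_on ?P. deriv \<phi> x *\<^sub>R piecewise a h1 h2 x) =
      (LINT x|lborel. indicator {0..a} x *\<^sub>R (deriv \<phi> x *\<^sub>R h1 x)) +
      (LINT x|lborel. indicator {a..R} x *\<^sub>R (deriv \<phi> x *\<^sub>R h2 x))"
    by (rule split[OF out(2) R(3) cont(2) ch])
  also have "(LINT x|lborel. indicator {0..a} x *\<^sub>R (deriv \<phi> x *\<^sub>R h1 x)) =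
      - (LINT x|lborel. indicator {0..a} x *\<^sub>R (\<phi> x *\<^sub>R h1' x))"
    using integration_by_parts_smooth(3)[OF K(1) _ h1, of 0 a] \<open>a > 0\<close> out(1) P(5,6) by simp
  also have "(LINT x|lborel. indicator {a..R} x *\<^sub>R (deriv \<phi> x *\<^sub>R h2 x)) =
      - (LINT x|lborel. indicator {a..R} x *\<^sub>R (\<phi> x *\<^sub>R h2' x))"
    using integration_by_parts_smooth(3)[OF K(1) _ h2, of a R] R(1) R(2)[of R] out(1) P(6) by simp
  also have "- (LINT x|lborel. indicator {0..a} x *\<^sub>R (\<phi> x *\<^sub>R h1' x))
      + - (LINT x|lborel. indicator {a..R} x *\<^sub>R (\<phi> x *\<^sub>R h2' x)) =
      - (LINT x|lebesgue_on ?P. \<phi> x *\<^sub>R piecewise a h1' h2' x)"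
    using split[OF out(1) R(2) cont(1) h1(2) h2(2)] by simp
  finally show "(LINT x|lebesgue_on ?P. deriv \<phi> x *\<^sub>R piecewise a h1 h2 x) =
      - (LINT x|lebesgue_on ?P. \<phi> x *\<^sub>R piecewise a h1' h2' x)" .
qed

text \<open>
Convolutions are formed with a Borel function on the whole line that agrees with \<open>u\<close> almost
everywhere on \<open>\<Omega>\<close> and vanishes almost everywhere outside, so no norm is lost.
\<close>

lemma borel_representative:
  assumes u: "square_integrable \<Omega> u" and \<Omega>: "open \<Omega>"
  obtains F where "F \<in> borel_measurable borel" "AE x in lebesgue_on \<Omega>. F x = u x"
    "integrable lborel (\<lambda>x. (norm (F x))\<^sup>2)"
    "(LINT x|lborel. (norm (F x))\<^sup>2) = (L2_norm_scalar \<Omega> u)\<^sup>2"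
proof -
  have leb: "\<Omega> \<in> sets lebesgue" using \<Omega> by (simp add: borel_open)
  define U where "U x = (if x \<in> \<Omega> then u x else 0)" for x
  have U: "U \<in> borel_measurable lebesgue"
    unfolding U_def[abs_def] using u borel_measurable_if[OF leb, of u]
    by (simp add: square_integrable_def)
  have "(\<lambda>x. Re (U x)) \<in> borel_measurable lebesgue" "(\<lambda>x. Im (U x)) \<in> borel_measurable lebesgue"
    using U by measurable
  then obtain A B where [measurable]: "A \<in> borel_measurable borel" "B \<in> borel_measurable borel"
    and AB: "AE x in lborel. Re (U x) = A x" "AE x in lborel. Im (U x) = B x"
    using completion_ex_borel_measurable_real by (metis measurable_lborel2)
  define F where "F x = of_real (A x) + \<i> * of_real (B x)" for x
  have F: "F \<in> borel_measurable borel"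
    unfolding F_def[abs_def] by measurable
  have ae: "AE x in lborel. U x = F x"
    using AB by eventually_elim (simp add: F_def complex_eq_iff)
  then have ae': "AE x in lebesgue. U x = F x"
    by (simp add: AE_completion_iff)
  have i: "integrable (lebesgue_on \<Omega>) (\<lambda>x. (norm (u x))\<^sup>2)"
    using u by (simp add: square_integrable_def)
  have eq: "(\<lambda>x. indicat_real \<Omega> x *\<^sub>R (norm (u x))\<^sup>2) = (\<lambda>x. (norm (U x))\<^sup>2)"
    by (auto simp: U_def fun_eq_iff indicator_def)
  have iU: "integrable lebesgue (\<lambda>x. (norm (U x))\<^sup>2)"
    "(LINT x|lebesgue_on \<Omega>. (norm (u x))\<^sup>2) = (LINT x|lebesgue. (norm (U x))\<^sup>2)"
    using i integrable_restrict_space[of \<Omega> lebesgue "\<lambda>x. (norm (u x))\<^sup>2"]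
      integral_restrict_space[of \<Omega> lebesgue "\<lambda>x. (norm (u x))\<^sup>2"] leb
    unfolding eq by simp_all
  have mF: "(\<lambda>x. (norm (F x))\<^sup>2) \<in> borel_measurable lborel"
    using F by measurable
  have mF': "(\<lambda>x. (norm (F x))\<^sup>2) \<in> borel_measurable lebesgue"
    using mF by (rule measurable_completion)
  have ae2: "AE x in lebesgue. (norm (U x))\<^sup>2 = (norm (F x))\<^sup>2"
    using ae' by eventually_elim simp
  have "integrable lebesgue (\<lambda>x. (norm (F x))\<^sup>2)"
    using iU(1) integrable_cong_AE[OF borel_measurable_integrable[OF iU(1)] mF' ae2] by simp
  then have 1: "integrable lborel (\<lambda>x. (norm (F x))\<^sup>2)"
    using integrable_completion[OF mF] by simp
  have "(LINT x|lborel. (norm (F x))\<^sup>2) = (LINT x|lebesgue. (norm (F x))\<^sup>2)"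
    using integral_completion[OF mF] by simp
  also have "\<dots> = (LINT x|lebesgue. (norm (U x))\<^sup>2)"
    by (rule integral_cong_AE[OF mF' borel_measurable_integrable[OF iU(1)]])
      (use ae2 in eventually_elim, simp)
  finally have 2: "(LINT x|lborel. (norm (F x))\<^sup>2) = (L2_norm_scalar \<Omega> u)\<^sup>2"
    by (simp add: L2_norm_scalar_def iU(2))
  have "AE x in lebesgue_on \<Omega>. F x = u x"
    using leb ae' by (subst AE_restrict_space_iff) (auto elim!: eventually_mono simp: U_def)
  with F 1 2 show ?thesis using that by blast
qed

section \<open>Solving the resolvent equation by matching\<close>

lemma square_integrable_cmult: "square_integrable \<Omega> u \<Longrightarrow> square_integrable \<Omega> (\<lambda>x. A * u x)"
  using square_integrable_linear(1)[of \<Omega> u u A 0] by simp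

lemma square_integrable_add:
  "square_integrable \<Omega> u \<Longrightarrow> square_integrable \<Omega> v \<Longrightarrow> square_integrable \<Omega> (\<lambda>x. u x + v x)"
  using square_integrable_linear(1)[of \<Omega> u v 1 1] by simp

lemma square_integrable_diff:
  "square_integrable \<Omega> u \<Longrightarrow> square_integrable \<Omega> v \<Longrightarrow> square_integrable \<Omega> (\<lambda>x. u x - v x)"
  using square_integrable_linear(1)[of \<Omega> u v 1 "- 1"] by simp

lemma L2_diff: "\<psi> \<in> L2 \<Omega> \<Longrightarrow> \<phi> \<in> L2 \<Omega> \<Longrightarrow> (\<lambda>x. \<psi> x - \<phi> x) \<in> L2 \<Omega>"
  unfolding L2_iff by (simp add: square_integrable_diff)

lemma L2_lincomb: "\<psi> \<in> L2 \<Omega> \<Longrightarrow> \<phi> \<in> L2 \<Omega> \<Longrightarrow> (\<lambda>x. \<psi> x + z *s \<phi> x) \<in> L2 \<Omega>"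
  unfolding L2_iff by (simp add: square_integrable_add square_integrable_cmult)

lemma L2_half_line:
  assumes "a > 0" "\<psi> \<in> L2 (punctured_half_line a)"
  shows "\<psi> \<in> L2 half_line"
  using assms square_integrable_half_line unfolding L2_iff by blast

lemma L2_punctured:
  assumes "a > 0" "\<psi> \<in> L2 half_line"
  shows "\<psi> \<in> L2 (punctured_half_line a)"
  using assms square_integrable_punctured unfolding L2_iff by blast

lemma weak_deriv_diff:
  assumes \<Omega>: "open \<Omega>" and L2: "\<psi> \<in> L2 \<Omega>" "\<phi> \<in> L2 \<Omega>" "g \<in> L2 \<Omega>" "h \<in> L2 \<Omega>"
    and w: "weak_deriv \<Omega> \<psi> g" "weak_deriv \<Omega> \<phi> h"
  shows "weak_deriv \<Omega> (\<lambda>x. \<psi> x - \<phi> x) (\<lambda>x. g x - h x)"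
proof -
  have "weak_derivative \<Omega> (\<lambda>x. \<psi> x $ i - \<phi> x $ i) (\<lambda>x. g x $ i - h x $ i)" if "i = 1 \<or> i = 2" for i
    using weak_derivative_linear[OF \<Omega>, of "\<lambda>x. \<psi> x $ i" "\<lambda>x. \<phi> x $ i" "\<lambda>x. g x $ i" "\<lambda>x. h x $ i" 1 "- 1"]
      L2 w that unfolding L2_iff weak_deriv_iff[OF \<Omega> L2(1,3)] weak_deriv_iff[OF \<Omega> L2(2,4)]
    by auto
  then show ?thesis
    by (simp add: weak_deriv_iff[OF \<Omega> L2_diff[OF L2(1,2)] L2_diff[OF L2(3,4)]])
qed

lemma dirac_delta_diff:
  assumes "a > 0" and D: "(\<psi>, \<phi>) \<in> dirac_delta m \<alpha> a t" "(\<psi>', \<phi>') \<in> dirac_delta m \<alpha> a t"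
  shows "(\<lambda>x. \<psi> x - \<psi>' x, \<lambda>x. \<phi> x - \<phi>' x) \<in> dirac_delta m \<alpha> a t"
proof -
  let ?P = "punctured_half_line a"
  note P = punctured_half_line_facts[OF \<open>a > 0\<close>]
  let ?A = "matrix2 (\<i> * complex_of_real t / 2) (- \<i>) 1 0"
  let ?B = "matrix2 (\<i> * complex_of_real t / 2) \<i> (- 1) 0"
  let ?M = "matrix2 (complex_of_real m) 0 0 (- complex_of_real m)"
  let ?N = "matrix2 0 (- 1) 1 0"
  obtain g v0 vm vp where 1: "\<psi> \<in> L2 ?P" "\<phi> \<in> L2 half_line" "g \<in> L2 ?P" "weak_deriv ?P \<psi> g"
    "AE x in lebesgue_on half_line. \<phi> x = ?M *v \<psi> x + ?N *v g x"
    "has_trace {0<..<a} 0 \<psi> v0" "has_trace {0<..<a} a \<psi> vm" "has_trace {a<..} a \<psi> vp"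
    "v0 $ 1 * complex_of_real (cot \<alpha>) = v0 $ 2" "?A *v vp + ?B *v vm = 0"
    using D(1) unfolding dirac_delta_def dirac_delta_domain_def H1_def by blast
  obtain g' v0' vm' vp' where 2: "\<psi>' \<in> L2 ?P" "\<phi>' \<in> L2 half_line" "g' \<in> L2 ?P" "weak_deriv ?P \<psi>' g'"
    "AE x in lebesgue_on half_line. \<phi>' x = ?M *v \<psi>' x + ?N *v g' x"
    "has_trace {0<..<a} 0 \<psi>' v0'" "has_trace {0<..<a} a \<psi>' vm'" "has_trace {a<..} a \<psi>' vp'"
    "v0' $ 1 * complex_of_real (cot \<alpha>) = v0' $ 2" "?A *v vp' + ?B *v vm' = 0"
    using D(2) unfolding dirac_delta_def dirac_delta_domain_def H1_def by blast
  have g: "(\<lambda>x. g x - g' x) \<in> L2 ?P" "weak_deriv ?P (\<lambda>x. \<psi> x - \<psi>' x) (\<lambda>x. g x - g' x)"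
    using 1 2 by (auto intro!: L2_diff weak_deriv_diff P(1))
  have "(\<lambda>x. \<psi> x - \<psi>' x) \<in> dirac_delta_domain \<alpha> a t"
    unfolding dirac_delta_domain_def H1_def mem_Collect_eq
  proof (intro conjI exI)
    show "has_trace {0<..<a} 0 (\<lambda>x. \<psi> x - \<psi>' x) (v0 - v0')" "has_trace {0<..<a} a (\<lambda>x. \<psi> x - \<psi>' x) (vm - vm')"
      "has_trace {a<..} a (\<lambda>x. \<psi> x - \<psi>' x) (vp - vp')"
      by (intro has_trace_diff 1 2)+
    show "(v0 - v0') $ 1 * complex_of_real (cot \<alpha>) = (v0 - v0') $ 2"
      using 1 2 by (simp add: left_diff_distrib)
    have "?A *v (vp - vp') + ?B *v (vm - vm') = (?A *v vp + ?B *v vm) - (?A *v vp' + ?B *v vm')"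
      by (simp add: matrix_vector_mult_diff_distrib)
    then show "?A *v (vp - vp') + ?B *v (vm - vm') = 0"
      using 1 2 by simp
    show "(\<lambda>x. \<psi> x - \<psi>' x) \<in> L2 ?P"
      by (rule L2_diff[OF 1(1) 2(1)])
    show "\<exists>g\<in>L2 ?P. weak_deriv ?P (\<lambda>x. \<psi> x - \<psi>' x) g"
      using g by blast
  qed
  moreover have "AE x in lebesgue_on half_line. \<phi> x - \<phi>' x = ?M *v (\<psi> x - \<psi>' x) + ?N *v (g x - g' x)"
    using 1(5) 2(5) by eventually_elim (simp add: matrix_vector_mult_diff_distrib)
  ultimately show ?thesis
    unfolding dirac_delta_def using g L2_diff[OF 1(2) 2(2)] by blast
qed

text \<open>
The principal square root, which has positive real part for \<open>\<bar>z\<bar> < m\<close>.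
\<close>

definition decay_rate :: "real \<Rightarrow> complex \<Rightarrow> complex" where
  "decay_rate m z = csqrt ((of_real m)\<^sup>2 - z\<^sup>2)"

text \<open>
The components of the solution of \<open>\<psi>\<^sub>1' = (m + z) \<psi>\<^sub>2\<close>, \<open>\<psi>\<^sub>2' = (m - z) \<psi>\<^sub>1\<close> with initial value
\<open>(v1, v2)\<close> at \<open>0\<close>.
\<close>

definition sol1 :: "real \<Rightarrow> complex \<Rightarrow> complex \<Rightarrow> complex \<Rightarrow> real \<Rightarrow> complex" where
  "sol1 m z v1 v2 x = cosh (decay_rate m z * of_real x) * v1
    + (of_real m + z) / decay_rate m z * sinh (decay_rate m z * of_real x) * v2"

definition sol2 :: "real \<Rightarrow> complex \<Rightarrow> complex \<Rightarrow> complex \<Rightarrow> real \<Rightarrow> complex" where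
  "sol2 m z v1 v2 x = cosh (decay_rate m z * of_real x) * v2
    + (of_real m - z) / decay_rate m z * sinh (decay_rate m z * of_real x) * v1"

text \<open>
The inner solution starts from \<open>(1, c)\<close>, as the boundary condition demands. Continuing its first
component into \<open>(a, \<infinity>)\<close> by the decaying solution forces the second component to start from
\<open>- (k / (m + z))\<close> times the common value; the mismatch is the jump of the second component minus the
jump that the interface condition prescribes.
\<close>

definition mismatch :: "real \<Rightarrow> real \<Rightarrow> real \<Rightarrow> real \<Rightarrow> complex \<Rightarrow> complex" where
  "mismatch m a c t z = - (decay_rate m z / (of_real m + z)) * sol1 m z 1 (of_real c) a
    - sol2 m z 1 (of_real c) a - of_real t * sol1 m z 1 (of_real c) a"

lemma Re_mass_gap_pos:
  assumes "norm z < m"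
  shows "Re ((of_real m)\<^sup>2 - z\<^sup>2) > 0"
proof -
  have "Re (z\<^sup>2) \<le> (norm z)\<^sup>2"
    using complex_Re_le_cmod[of "z\<^sup>2"] by (simp add: norm_power)
  also have "\<dots> < m\<^sup>2"
    using assms by (intro power_strict_mono) auto
  finally show ?thesis
    by (simp flip: of_real_power)
qed

lemma decay_rate_facts:
  assumes "norm z < m"
  shows "(decay_rate m z)\<^sup>2 = (of_real m + z) * (of_real m - z)" "Re (decay_rate m z) > 0"
    "decay_rate m z \<noteq> 0" "of_real m + z \<noteq> 0"
proof -
  show sq: "(decay_rate m z)\<^sup>2 = (of_real m + z) * (of_real m - z)"
    unfolding decay_rate_def power2_csqrt by (simp add: power2_eq_square algebra_simps)
  have "Re ((decay_rate m z)\<^sup>2) > 0"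
    unfolding decay_rate_def power2_csqrt by (rule Re_mass_gap_pos[OF assms])
  then have "(Re (decay_rate m z))\<^sup>2 > (Im (decay_rate m z))\<^sup>2" by (simp add: Re_power2)
  then have "Re (decay_rate m z) \<noteq> 0"
    using zero_le_power2[of "Im (decay_rate m z)"] by auto
  moreover have "Re (decay_rate m z) \<ge> 0"
    unfolding decay_rate_def by (rule Re_csqrt)
  ultimately show "Re (decay_rate m z) > 0" by simp
  then show "decay_rate m z \<noteq> 0" by auto
  have "norm (- z) \<noteq> norm (complex_of_real m)" using assms by auto
  then have "- z \<noteq> of_real m" by metis
  then show "of_real m + z \<noteq> 0" by (metis add_eq_0_iff2)
qed

locale dirac_problem =
  fixes m a \<alpha> t :: real and z :: complex
  assumes a_pos: "a > 0" and z_small: "norm z < m"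
begin

abbreviation "k \<equiv> decay_rate m z"
abbreviation "\<Omega> \<equiv> punctured_half_line a"
abbreviation "c \<equiv> complex_of_real (cot \<alpha>)"
abbreviation "D \<equiv> dirac_delta m \<alpha> a t"

lemmas k_facts = decay_rate_facts[OF z_small]
lemmas \<Omega>_facts = punctured_half_line_facts[OF a_pos]

lemma k_mult: "k * (k * w) = (of_real m + z) * (of_real m - z) * w"
  using k_facts(1) by (simp add: power2_eq_square mult.assoc[symmetric])

lemma sol_deriv:
  "(sol1 m z v1 v2 has_vector_derivative (of_real m + z) * sol2 m z v1 v2 x) (at x)"
  "(sol2 m z v1 v2 has_vector_derivative (of_real m - z) * sol1 m z v1 v2 x) (at x)"
proof -
  have 1: "((\<lambda>x. cosh (k * of_real x)) has_vector_derivative k * sinh (k * of_real x)) (at x)"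
    by (rule has_vector_derivative_real_field[where f = "\<lambda>w. cosh (k * w)"])
      (auto intro!: derivative_eq_intros)
  have 2: "((\<lambda>x. sinh (k * of_real x)) has_vector_derivative k * cosh (k * of_real x)) (at x)"
    by (rule has_vector_derivative_real_field[where f = "\<lambda>w. sinh (k * w)"])
      (auto intro!: derivative_eq_intros)
  have "(sol1 m z v1 v2 has_vector_derivative
      k * sinh (k * of_real x) * v1 + (of_real m + z) / k * (k * cosh (k * of_real x)) * v2) (at x)"
    unfolding sol1_def[abs_def]
    by (intro has_vector_derivative_add has_vector_derivative_mult_left has_vector_derivative_mult_right 1 2)
  moreover have "k * sinh (k * of_real x) * v1 + (of_real m + z) / k * (k * cosh (k * of_real x)) * v2 =
      (of_real m + z) * sol2 m z v1 v2 x"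
    unfolding sol2_def using k_facts(3) k_mult[of "sinh (k * of_real x) * v1"] by (simp add: field_simps)
  ultimately show "(sol1 m z v1 v2 has_vector_derivative (of_real m + z) * sol2 m z v1 v2 x) (at x)"
    by simp
  have "(sol2 m z v1 v2 has_vector_derivative
      k * sinh (k * of_real x) * v2 + (of_real m - z) / k * (k * cosh (k * of_real x)) * v1) (at x)"
    unfolding sol2_def[abs_def]
    by (intro has_vector_derivative_add has_vector_derivative_mult_left has_vector_derivative_mult_right 1 2)
  moreover have "k * sinh (k * of_real x) * v2 + (of_real m - z) / k * (k * cosh (k * of_real x)) * v1 =
      (of_real m - z) * sol1 m z v1 v2 x"
    unfolding sol1_def using k_facts(3) k_mult[of "sinh (k * of_real x) * v2"] by (simp add: field_simps)
  ultimately show "(sol2 m z v1 v2 has_vector_derivative (of_real m - z) * sol1 m z v1 v2 x) (at x)"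
    by simp
qed

lemma sol_continuous: "continuous_on A (sol1 m z v1 v2)" "continuous_on A (sol2 m z v1 v2)"
  using sol_deriv by (meson continuous_at_imp_continuous_on has_vector_derivative_continuous)+

lemma sol_0 [simp]: "sol1 m z v1 v2 0 = v1" "sol2 m z v1 v2 0 = v2"
  by (simp_all add: sol1_def sol2_def)

lemma sol_linear:
  "sol1 m z v1 v2 x = v1 * sol1 m z 1 0 x + v2 * sol1 m z 0 1 x"
  "sol2 m z v1 v2 x = v1 * sol2 m z 1 0 x + v2 * sol2 m z 0 1 x"
  by (simp_all add: sol1_def sol2_def algebra_simps)

text \<open>
The decaying exponential, normalised at the interface.
\<close>

definition tail :: "real \<Rightarrow> complex" where
  "tail x = exp (- k * of_real x + k * of_real a)"

lemma tail_a [simp]: "tail a = 1"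
  by (simp add: tail_def)

lemma tail_deriv: "((\<lambda>x. w * tail x) has_vector_derivative w * (- k * tail x)) (at x)"
  unfolding tail_def
  by (intro has_vector_derivative_mult_right has_vector_derivative_exp_mult)

lemma tail_continuous: "continuous_on A tail"
  unfolding tail_def[abs_def] by (intro continuous_intros)

lemma tail_bound: "a \<le> x \<Longrightarrow> norm (w * tail x) \<le> (norm w * exp (Re k * a)) * exp (- Re k * \<bar>x\<bar>)"
proof -
  assume "a \<le> x"
  moreover have "norm (tail x) = exp (Re k * a + - Re k * x)"
    by (simp add: tail_def norm_exp_eq_Re del: exp_diff)
  ultimately show ?thesis
    using a_pos unfolding exp_add by (simp add: norm_mult)
qed

text \<open>
Solutions of the homogeneous system on both sides of \<open>a\<close>: initial value \<open>(v1, v2)\<close> at \<open>0\<close> inside and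
the decaying solution with amplitude \<open>\<gamma>\<close> outside. Together they form a three-dimensional space, one
dimension for each of the boundary condition and the two interface conditions.
\<close>

definition hom1 :: "complex \<Rightarrow> complex \<Rightarrow> complex \<Rightarrow> real \<Rightarrow> complex" where
  "hom1 v1 v2 \<gamma> = piecewise a (sol1 m z v1 v2) (\<lambda>x. \<gamma> * tail x)"

definition hom2 :: "complex \<Rightarrow> complex \<Rightarrow> complex \<Rightarrow> real \<Rightarrow> complex" where
  "hom2 v1 v2 \<gamma> = piecewise a (sol2 m z v1 v2) (\<lambda>x. - (k / (of_real m + z)) * \<gamma> * tail x)"

lemma hom_square_integrable:
  "square_integrable half_line (hom1 v1 v2 \<gamma>)" "square_integrable half_line (hom2 v1 v2 \<gamma>)"
proof -
  note cont = sol_continuous continuous_on_mult continuous_on_const tail_continuous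
  show "square_integrable half_line (hom1 v1 v2 \<gamma>)"
    unfolding hom1_def
    by (rule square_integrable_piecewise[OF _ _ k_facts(2) tail_bound a_pos]) (intro cont | assumption)+
  show "square_integrable half_line (hom2 v1 v2 \<gamma>)"
    unfolding hom2_def
    by (rule square_integrable_piecewise[OF _ _ k_facts(2) tail_bound a_pos]) (intro cont | assumption)+
qed

lemma hom_weak_derivative:
  "weak_derivative \<Omega> (hom1 v1 v2 \<gamma>) (\<lambda>x. (of_real m + z) * hom2 v1 v2 \<gamma> x)"
  "weak_derivative \<Omega> (hom2 v1 v2 \<gamma>) (\<lambda>x. (of_real m - z) * hom1 v1 v2 \<gamma> x)"
proof -
  let ?s = "- (k / (of_real m + z)) * \<gamma>"
  have e1: "(\<lambda>x. (of_real m + z) * hom2 v1 v2 \<gamma> x) =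
      piecewise a (\<lambda>x. (of_real m + z) * sol2 m z v1 v2 x) (\<lambda>x. \<gamma> * (- k * tail x))"
    using k_facts(4) by (auto simp: fun_eq_iff hom2_def piecewise_def)
  have e2: "(\<lambda>x. (of_real m - z) * hom1 v1 v2 \<gamma> x) =
      piecewise a (\<lambda>x. (of_real m - z) * sol1 m z v1 v2 x) (\<lambda>x. ?s * (- k * tail x))"
    using k_facts(4) k_mult[of "\<gamma> * tail _"]
    by (auto simp: fun_eq_iff hom1_def piecewise_def field_simps)
  show "weak_derivative \<Omega> (hom1 v1 v2 \<gamma>) (\<lambda>x. (of_real m + z) * hom2 v1 v2 \<gamma> x)"
    unfolding e1 unfolding hom1_def
    by (intro weak_derivative_piecewise a_pos sol_deriv tail_deriv continuous_on_mult continuous_on_const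
        sol_continuous tail_continuous)
  show "weak_derivative \<Omega> (hom2 v1 v2 \<gamma>) (\<lambda>x. (of_real m - z) * hom1 v1 v2 \<gamma> x)"
    unfolding e2 unfolding hom2_def
    by (intro weak_derivative_piecewise a_pos sol_deriv tail_deriv continuous_on_mult continuous_on_const
        sol_continuous tail_continuous)
qed

lemma interface_iff:
  "matrix2 (\<i> * complex_of_real t / 2) (- \<i>) 1 0 *v p + matrix2 (\<i> * complex_of_real t / 2) \<i> (- 1) 0 *v q = 0
    \<longleftrightarrow> p $ 1 = q $ 1 \<and> p $ 2 - q $ 2 = of_real t * p $ 1"
proof -
  have "\<i> * of_real t / 2 * p1 + - \<i> * p2 + (\<i> * of_real t / 2 * q1 + \<i> * q2) = 0 \<and>
      1 * p1 + 0 * p2 + (- 1 * q1 + 0 * q2) = 0 \<longleftrightarrow> p1 = q1 \<and> p2 - q2 = of_real t * p1"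
    for p1 p2 q1 q2 :: complex
  proof (cases "p1 = q1")
    case True
    have "\<i> * of_real t / 2 * p1 + - \<i> * p2 + (\<i> * of_real t / 2 * q1 + \<i> * q2) =
        \<i> * (of_real t * p1 - (p2 - q2))"
      unfolding True by (simp add: algebra_simps)
    then show ?thesis using True by auto
  qed auto
  then show ?thesis
    unfolding vec2_eq_iff by simp
qed

text \<open>
The resolvent equation \<open>(D - z) u = f\<close> in components, with continuity across \<open>a\<close> but no condition
at \<open>0\<close> or at \<open>a\<close>.
\<close>

definition inhomogeneous_solution ::
    "(real \<Rightarrow> complex^2) \<Rightarrow> (real \<Rightarrow> complex) \<Rightarrow> (real \<Rightarrow> complex) \<Rightarrow> bool" where
  "inhomogeneous_solution f u1 u2 \<longleftrightarrow> continuous_on UNIV u1 \<and> continuous_on UNIV u2 \<and>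
     square_integrable half_line u1 \<and> square_integrable half_line u2 \<and>
     weak_derivative \<Omega> u1 (\<lambda>x. (of_real m + z) * u2 x + f x $ 2) \<and>
     weak_derivative \<Omega> u2 (\<lambda>x. (of_real m - z) * u1 x - f x $ 1)"

text \<open>
If \<open>(u1, u2)\<close> solves the inhomogeneous system on the whole half-line, without regard to boundary and
interface, a homogeneous solution whose coefficients satisfy the three matching conditions turns it
into an element of the domain.
\<close>

lemma resolvent_equation_solution:
  assumes f: "f \<in> L2 half_line"
    and sol: "inhomogeneous_solution f u1 u2"
    and bc: "(u1 0 + v1) * c = u2 0 + v2"
    and match: "\<gamma> = sol1 m z v1 v2 a"
      "- (k / (of_real m + z)) * \<gamma> - sol2 m z v1 v2 a = of_real t * (u1 a + \<gamma>)"
  shows "(\<lambda>x. vector [u1 x + hom1 v1 v2 \<gamma> x, u2 x + hom2 v1 v2 \<gamma> x],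
      \<lambda>x. f x + z *s vector [u1 x + hom1 v1 v2 \<gamma> x, u2 x + hom2 v1 v2 \<gamma> x]) \<in> D"
proof -
  have u: "continuous_on UNIV u1" "continuous_on UNIV u2"
    "square_integrable half_line u1" "square_integrable half_line u2"
    "weak_derivative \<Omega> u1 (\<lambda>x. (of_real m + z) * u2 x + f x $ 2)"
    "weak_derivative \<Omega> u2 (\<lambda>x. (of_real m - z) * u1 x - f x $ 1)"
    using sol by (simp_all add: inhomogeneous_solution_def)
  define \<psi> :: "real \<Rightarrow> complex^2" where
    "\<psi> x = vector [u1 x + hom1 v1 v2 \<gamma> x, u2 x + hom2 v1 v2 \<gamma> x]" for x
  define g :: "real \<Rightarrow> complex^2" where
    "g x = vector [(of_real m + z) * \<psi> x $ 2 + f x $ 2, (of_real m - z) * \<psi> x $ 1 - f x $ 1]" for x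
  have \<psi>_nth: "\<psi> x $ 1 = u1 x + hom1 v1 v2 \<gamma> x" "\<psi> x $ 2 = u2 x + hom2 v1 v2 \<gamma> x" for x
    by (simp_all add: \<psi>_def)
  have g_nth: "g x $ 1 = ((of_real m + z) * u2 x + f x $ 2) + (of_real m + z) * hom2 v1 v2 \<gamma> x"
    "g x $ 2 = ((of_real m - z) * u1 x - f x $ 1) + (of_real m - z) * hom1 v1 v2 \<gamma> x" for x
    by (simp_all add: g_def \<psi>_nth distrib_left)
  have fs: "square_integrable half_line (\<lambda>x. f x $ 1)" "square_integrable half_line (\<lambda>x. f x $ 2)"
    using f by (auto simp: L2_iff)
  have \<psi>L2: "\<psi> \<in> L2 half_line"
    unfolding L2_iff \<psi>_nth by (intro conjI square_integrable_add u hom_square_integrable)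
  have gL2: "g \<in> L2 half_line"
    unfolding L2_iff g_nth
    by (intro conjI square_integrable_add square_integrable_diff square_integrable_cmult u fs hom_square_integrable)
  have w: "weak_deriv \<Omega> \<psi> g"
    unfolding weak_deriv_iff[OF \<Omega>_facts(1) L2_punctured[OF a_pos \<psi>L2] L2_punctured[OF a_pos gL2]] \<psi>_nth g_nth
  proof
    note sq = square_integrable_punctured[OF a_pos]
    show "weak_derivative \<Omega> (\<lambda>x. u1 x + hom1 v1 v2 \<gamma> x)
        (\<lambda>x. (of_real m + z) * u2 x + f x $ 2 + (of_real m + z) * hom2 v1 v2 \<gamma> x)"
      using weak_derivative_linear[OF \<Omega>_facts(1) sq sq sq sq u(5) hom_weak_derivative(1), where A = 1 and B = 1] u fs
      by (simp add: square_integrable_add square_integrable_cmult hom_square_integrable)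
    show "weak_derivative \<Omega> (\<lambda>x. u2 x + hom2 v1 v2 \<gamma> x)
        (\<lambda>x. (of_real m - z) * u1 x - f x $ 1 + (of_real m - z) * hom1 v1 v2 \<gamma> x)"
      using weak_derivative_linear[OF \<Omega>_facts(1) sq sq sq sq u(6) hom_weak_derivative(2), where A = 1 and B = 1] u fs
      by (simp add: square_integrable_diff square_integrable_cmult hom_square_integrable)
  qed
  define inner :: "real \<Rightarrow> complex^2" where
    "inner x = vector [u1 x + sol1 m z v1 v2 x, u2 x + sol2 m z v1 v2 x]" for x
  define outer :: "real \<Rightarrow> complex^2" where
    "outer x = vector [u1 x + \<gamma> * tail x, u2 x + - (k / (of_real m + z)) * \<gamma> * tail x]" for x
  have cont: "continuous_on UNIV inner" "continuous_on UNIV outer"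
    unfolding inner_def[abs_def] outer_def[abs_def]
    by (intro continuous_on_vec2 continuous_on_add continuous_on_mult continuous_on_const u sol_continuous tail_continuous)+
  have eq: "\<psi> x = inner x" if "x \<in> {0<..<a}" for x
    using that by (simp add: \<psi>_def inner_def hom1_def hom2_def piecewise_def)
  have eq': "\<psi> x = outer x" if "x \<in> {a<..}" for x
    using that by (simp add: \<psi>_def outer_def hom1_def hom2_def piecewise_def)
  have "\<psi> \<in> dirac_delta_domain \<alpha> a t"
    unfolding dirac_delta_domain_def H1_def mem_Collect_eq
  proof (intro conjI exI)
    show "has_trace {0<..<a} 0 \<psi> (inner 0)" "has_trace {0<..<a} a \<psi> (inner a)"
      by (rule has_traceI[OF cont(1) eq]; assumption)+
    show "has_trace {a<..} a \<psi> (outer a)"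
      by (rule has_traceI[OF cont(2) eq'])
    show "inner 0 $ 1 * c = inner 0 $ 2"
      using bc by (simp add: inner_def)
    have "outer a $ 1 = inner a $ 1"
      using match(1) by (simp add: outer_def inner_def)
    moreover have "outer a $ 2 - inner a $ 2 = of_real t * outer a $ 1"
      using match(2) by (simp add: outer_def inner_def)
    ultimately show "matrix2 (\<i> * complex_of_real t / 2) (- \<i>) 1 0 *v outer a
        + matrix2 (\<i> * complex_of_real t / 2) \<i> (- 1) 0 *v inner a = 0"
      unfolding interface_iff by simp
    show "\<psi> \<in> L2 \<Omega>"
      by (rule L2_punctured[OF a_pos \<psi>L2])
    show "\<exists>g\<in>L2 \<Omega>. weak_deriv \<Omega> \<psi> g"
      using w L2_punctured[OF a_pos gL2] by blast
  qed
  moreover have eqn: "f x + z *s \<psi> x = matrix2 (of_real m) 0 0 (- of_real m) *v \<psi> x + matrix2 0 (- 1) 1 0 *v g x" for x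
    by (simp add: vec2_eq_iff g_def algebra_simps)
  ultimately have "(\<psi>, \<lambda>x. f x + z *s \<psi> x) \<in> D"
    unfolding dirac_delta_def
    using w L2_punctured[OF a_pos gL2] L2_lincomb[OF f \<psi>L2]
    by (intro CollectI case_prodI conjI bexI[of _ g] AE_I2)
  then show ?thesis
    unfolding \<psi>_def .
qed

end

section \<open>Uniqueness for the homogeneous equation\<close>

text \<open>
A growing exponential is bounded below on a half-line of infinite measure.
\<close>

lemma square_integrable_growing_imp_0:
  assumes p: "square_integrable {a<..} p" and ae: "AE x in lebesgue_on {a<..}. p x = P * exp (k * of_real x)"
    and "Re k > 0" "a > 0"
  shows "P = 0"
proof (rule ccontr)
  assume "P \<noteq> 0"
  have "integrable (lebesgue_on {a<..}) (\<lambda>x. (norm (p x))\<^sup>2)"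
    using p by (simp add: square_integrable_def)
  then have "integrable (lebesgue_on {a<..}) (\<lambda>x. (norm P)\<^sup>2)"
  proof (rule Bochner_Integration.integrable_bound)
    have "AE x in lebesgue_on {a<..}. x > a" by (rule AE_I2) simp
    with ae show "AE x in lebesgue_on {a<..}. norm ((norm P)\<^sup>2) \<le> norm ((norm (p x))\<^sup>2)"
    proof eventually_elim
      case (elim x)
      then have "norm P * 1 \<le> norm P * exp (Re k * x)"
        using assms by (intro mult_left_mono) auto
      then have "norm P \<le> norm (p x)"
        using elim by (simp add: norm_mult)
      then show ?case by (simp add: power_mono)
    qed
  qed simp
  then have fin: "emeasure (lebesgue_on {a<..}) {a<..} < \<infinity>"
    using \<open>P \<noteq> 0\<close> by (auto simp: integrable_iff_bounded ennreal_mult_less_top)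
  have le: "ennreal (real n) \<le> emeasure (lebesgue_on {a<..}) {a<..}" for n
  proof -
    have "ennreal (real n) = emeasure lebesgue {a<..<a + real n}" by simp
    also have "\<dots> \<le> emeasure lebesgue {a<..}"
      by (rule emeasure_mono) auto
    also have "\<dots> = emeasure (lebesgue_on {a<..}) {a<..}"
      by (subst emeasure_restrict_space) auto
    finally show ?thesis .
  qed
  obtain r where r: "emeasure (lebesgue_on {a<..}) {a<..} = ennreal r" "r \<ge> 0"
    using fin by (cases "emeasure (lebesgue_on {a<..}) {a<..}") auto
  obtain n where "r < real n" using reals_Archimedean2 by blast
  then show False using le[of n] r by (simp add: ennreal_le_iff)
qed

lemma mode_superposition:
  fixes n k :: complex
  assumes "n \<noteq> 0" "k \<noteq> 0"
  shows "(e + e') / 2 * ((P + Q) / (2 * k)) + n / k * ((e - e') / 2) * ((P - Q) / (2 * n)) =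
      (P * e + Q * e') / (2 * k)"
    and "(e + e') / 2 * ((P - Q) / (2 * n)) + k / n * ((e - e') / 2) * ((P + Q) / (2 * k)) =
      (P * e - Q * e') / (2 * n)"
  using assms by (simp_all add: field_simps)

lemma decaying_mode_second_component:
  fixes n k :: complex
  assumes "n \<noteq> 0" "k \<noteq> 0"
  shows "- (k / n) * (q / (2 * k)) = - q / (2 * n)"
  using assms by (simp add: field_simps)

context dirac_problem
begin

lemma modes_to_components:
  assumes "k * w1 + (of_real m + z) * w2 = P * e" "k * w1 - (of_real m + z) * w2 = Q * e'"
  shows "w1 = (P * e + Q * e') / (2 * k)" "w2 = (P * e - Q * e') / (2 * (of_real m + z))"
proof -
  have 1: "w1 * (2 * k) = P * e + Q * e'" and 2: "w2 * (2 * (of_real m + z)) = P * e - Q * e'"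
    unfolding assms[symmetric] by (simp_all add: algebra_simps)
  show "w1 = (P * e + Q * e') / (2 * k)"
    unfolding 1[symmetric] using k_facts(3) by simp
  show "w2 = (P * e - Q * e') / (2 * (of_real m + z))"
    unfolding 2[symmetric] using k_facts(4) by (subst nonzero_mult_div_cancel_right) (simp_all only: mult_eq_0_iff, simp)
qed

lemma homogeneous_equation_components:
  assumes "(v, \<lambda>x. z *s v x) \<in> D"
  shows "v \<in> L2 \<Omega>"
    and "weak_derivative \<Omega> (\<lambda>x. v x $ 1) (\<lambda>x. (of_real m + z) * v x $ 2)"
    and "weak_derivative \<Omega> (\<lambda>x. v x $ 2) (\<lambda>x. (of_real m - z) * v x $ 1)"
proof -
  obtain g where g: "v \<in> L2 \<Omega>" "g \<in> L2 \<Omega>" "weak_deriv \<Omega> v g"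
    "AE x in lebesgue_on half_line. z *s v x =
      matrix2 (of_real m) 0 0 (- of_real m) *v v x + matrix2 0 (- 1) 1 0 *v g x"
    using assms unfolding dirac_delta_def dirac_delta_domain_def H1_def by blast
  show "v \<in> L2 \<Omega>" by fact
  have ae: "AE x in lebesgue_on \<Omega>. g x $ 1 = (of_real m + z) * v x $ 2 \<and> g x $ 2 = (of_real m - z) * v x $ 1"
    using g(4) unfolding AE_half_line_iff[OF a_pos]
  proof eventually_elim
    case (elim x)
    then have "z * v x $ 1 = of_real m * v x $ 1 - g x $ 2" "z * v x $ 2 = - of_real m * v x $ 2 + g x $ 1"
      unfolding vec2_eq_iff by simp_all
    then show ?case by (simp add: algebra_simps)
  qed
  note w = g(3)[unfolded weak_deriv_iff[OF \<Omega>_facts(1) g(1,2)]]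
  note sq = g(1,2)[unfolded L2_iff]
  show "weak_derivative \<Omega> (\<lambda>x. v x $ 1) (\<lambda>x. (of_real m + z) * v x $ 2)"
    by (rule weak_derivative_cong_AE[OF conjunct1[OF w] \<Omega>_facts(1)])
      (use sq ae in \<open>auto intro: square_integrable_cmult elim: eventually_mono\<close>)
  show "weak_derivative \<Omega> (\<lambda>x. v x $ 2) (\<lambda>x. (of_real m - z) * v x $ 1)"
    by (rule weak_derivative_cong_AE[OF conjunct2[OF w] \<Omega>_facts(1)])
      (use sq ae in \<open>auto intro: square_integrable_cmult elim: eventually_mono\<close>)
qed

text \<open>
The combinations \<open>k v\<^sub>1 \<plusminus> (m + z) v\<^sub>2\<close> diagonalise the system, because \<open>k\<^sup>2 = (m + z) (m - z)\<close>; each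
of them weakly solves a scalar equation, with rate \<open>k\<close> for the sign \<open>+\<close> and \<open>-k\<close> for the sign \<open>-\<close>.
\<close>

lemma homogeneous_equation_modes:
  assumes v: "(v, \<lambda>x. z *s v x) \<in> D" and I: "open I" "is_interval I" "I \<subseteq> \<Omega>"
  obtains P Q where
    "AE x in lebesgue_on I. k * v x $ 1 + (of_real m + z) * v x $ 2 = P * exp (k * of_real x) \<and>
      k * v x $ 1 - (of_real m + z) * v x $ 2 = Q * exp (- (k * of_real x))"
    "square_integrable I (\<lambda>x. k * v x $ 1 + (of_real m + z) * v x $ 2)"
proof -
  note w = homogeneous_equation_components[OF v]
  have sq: "square_integrable \<Omega> (\<lambda>x. v x $ 1)" "square_integrable \<Omega> (\<lambda>x. v x $ 2)"
    using w(1) unfolding L2_iff by auto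
  have leb: "I \<in> sets lebesgue" using I(1) by (simp add: borel_open)
  have mode: "square_integrable I (\<lambda>x. k * v x $ 1 + s * (of_real m + z) * v x $ 2) \<and>
      (\<exists>C. AE x in lebesgue_on I. k * v x $ 1 + s * (of_real m + z) * v x $ 2 = C * exp (s * k * of_real x))"
    if s: "s * s = 1" for s
  proof -
    let ?p = "\<lambda>x. k * v x $ 1 + s * (of_real m + z) * v x $ 2"
    have "weak_derivative \<Omega> ?p (\<lambda>x. k * ((of_real m + z) * v x $ 2) + s * (of_real m + z) * ((of_real m - z) * v x $ 1))"
      by (intro weak_derivative_linear \<Omega>_facts(1) sq square_integrable_cmult w)
    moreover have "k * ((of_real m + z) * v x $ 2) + s * (of_real m + z) * ((of_real m - z) * v x $ 1) = s * k * ?p x" for x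
    proof -
      have "s * k * ?p x = s * (k * (k * v x $ 1)) + (s * s) * (k * ((of_real m + z) * v x $ 2))"
        by (simp add: algebra_simps)
      then show ?thesis unfolding k_mult s by (simp add: algebra_simps)
    qed
    ultimately have "weak_derivative \<Omega> ?p (\<lambda>x. s * k * ?p x)" by simp
    then have wI: "weak_derivative I ?p (\<lambda>x. s * k * ?p x)"
      by (rule weak_derivative_subset[OF _ I(3) leb \<Omega>_facts(4)])
    have "square_integrable \<Omega> ?p"
      by (intro square_integrable_linear(1) sq)
    then have sI: "square_integrable I ?p"
      by (rule square_integrable_subset[OF _ leb \<Omega>_facts(4) I(3)])
    have "\<exists>C. AE x in lebesgue_on I. ?p x = C * exp (s * k * of_real x)"
      by (rule weak_derivative_scaled_imp_exp[OF I(1,2) _ wI])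
        (rule square_integrable_imp_locally_integrable[OF sI leb])
    with sI show ?thesis by blast
  qed
  have sign: "1 * 1 = (1 :: complex)" "(- 1) * (- 1) = (1 :: complex)" by simp_all
  note signs = mult_minus1 mult_minus_left add_uminus_conv_diff mult_1_left
  obtain P where P: "AE x in lebesgue_on I. k * v x $ 1 + (of_real m + z) * v x $ 2 = P * exp (k * of_real x)"
    using conjunct2[OF mode[OF sign(1)]] unfolding signs by blast
  obtain Q where Q: "AE x in lebesgue_on I. k * v x $ 1 - (of_real m + z) * v x $ 2 = Q * exp (- (k * of_real x))"
    using conjunct2[OF mode[OF sign(2)]] unfolding signs by blast
  show ?thesis
  proof (rule that)
    show "AE x in lebesgue_on I. k * v x $ 1 + (of_real m + z) * v x $ 2 = P * exp (k * of_real x) \<and>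
      k * v x $ 1 - (of_real m + z) * v x $ 2 = Q * exp (- (k * of_real x))"
      using P Q by eventually_elim simp
    show "square_integrable I (\<lambda>x. k * v x $ 1 + (of_real m + z) * v x $ 2)"
      using conjunct1[OF mode[OF sign(1)]] unfolding signs .
  qed
qed

text \<open>
On \<open>(0, a)\<close> both exponential modes occur and the trace at \<open>0\<close> reduces them to a multiple of the
solution starting from \<open>(1, c)\<close>; on \<open>(a, \<infinity>)\<close> the growing mode is excluded by square-integrability.
The traces at \<open>a\<close> give the two remaining equations.
\<close>

lemma homogeneous_solution:
  assumes v: "(v, \<lambda>x. z *s v x) \<in> D"
  obtains w \<gamma> where
    "AE x in lebesgue_on half_line. v x = vector [hom1 w (c * w) \<gamma> x, hom2 w (c * w) \<gamma> x]"
    "\<gamma> = sol1 m z w (c * w) a" "- (k / (of_real m + z)) * \<gamma> - sol2 m z w (c * w) a = of_real t * \<gamma>"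
proof -
  have L: "{0<..<a} \<subseteq> \<Omega>" and R: "{a<..} \<subseteq> \<Omega>"
    using a_pos by (auto simp: punctured_half_line_def)
  obtain v0 vm vp where tr: "has_trace {0<..<a} 0 v v0" "has_trace {0<..<a} a v vm" "has_trace {a<..} a v vp"
    "v0 $ 1 * c = v0 $ 2"
    "matrix2 (\<i> * of_real t / 2) (- \<i>) 1 0 *v vp + matrix2 (\<i> * of_real t / 2) \<i> (- 1) 0 *v vm = 0"
    using v unfolding dirac_delta_def dirac_delta_domain_def by blast
  obtain P Q where PQ: "AE x in lebesgue_on {0<..<a}. k * v x $ 1 + (of_real m + z) * v x $ 2 = P * exp (k * of_real x) \<and>
      k * v x $ 1 - (of_real m + z) * v x $ 2 = Q * exp (- (k * of_real x))"
    and "square_integrable {0<..<a} (\<lambda>x. k * v x $ 1 + (of_real m + z) * v x $ 2)"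
    using homogeneous_equation_modes[OF v open_greaterThanLessThan is_interval_oo L] .
  obtain P' Q' where PQ': "AE x in lebesgue_on {a<..}. k * v x $ 1 + (of_real m + z) * v x $ 2 = P' * exp (k * of_real x) \<and>
      k * v x $ 1 - (of_real m + z) * v x $ 2 = Q' * exp (- (k * of_real x))"
    and sq: "square_integrable {a<..} (\<lambda>x. k * v x $ 1 + (of_real m + z) * v x $ 2)"
    using homogeneous_equation_modes[OF v open_greaterThan is_interval_oi R] .
  have "P' = 0"
    by (rule square_integrable_growing_imp_0[OF sq _ k_facts(2) a_pos]) (use PQ' in \<open>auto elim: eventually_mono\<close>)
  define w1 w2 \<gamma> where "w1 = (P + Q) / (2 * k)" and "w2 = (P - Q) / (2 * (of_real m + z))"
    and "\<gamma> = Q' * exp (- (k * of_real a)) / (2 * k)"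
  define inner :: "real \<Rightarrow> complex^2" where "inner x = vector [sol1 m z w1 w2 x, sol2 m z w1 w2 x]" for x
  define outer :: "real \<Rightarrow> complex^2" where
    "outer x = vector [\<gamma> * tail x, - (k / (of_real m + z)) * \<gamma> * tail x]" for x
  have inner: "AE x in lebesgue_on {0<..<a}. v x = inner x"
    using PQ
  proof eventually_elim
    case (elim x)
    define e e' where "e = exp (k * of_real x)" and "e' = exp (- (k * of_real x))"
    have cosh: "cosh (k * of_real x) = (e + e') / 2" and sinh: "sinh (k * of_real x) = (e - e') / 2"
      by (simp_all add: cosh_def sinh_def e_def e'_def scaleR_conv_of_real)
    have "v x $ 1 = (P * e + Q * e') / (2 * k)" "v x $ 2 = (P * e - Q * e') / (2 * (of_real m + z))"
      using modes_to_components[of "v x $ 1" "v x $ 2" P e Q e'] elim by (auto simp: e_def e'_def)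
    moreover have "sol1 m z w1 w2 x = (P * e + Q * e') / (2 * k)"
      unfolding sol1_def cosh sinh w1_def w2_def by (rule mode_superposition(1)[OF k_facts(4,3)])
    moreover have "sol2 m z w1 w2 x = (P * e - Q * e') / (2 * (of_real m + z))"
    proof -
      have "(of_real m - z) / k = k / (of_real m + z)"
        using k_mult[of 1] k_facts(3,4) by (simp add: frac_eq_eq mult.commute)
      then show ?thesis
        unfolding sol2_def cosh sinh w1_def w2_def using mode_superposition(2)[OF k_facts(4,3)] by simp
    qed
    ultimately show ?case by (simp add: vec2_eq_iff inner_def)
  qed
  have outer: "AE x in lebesgue_on {a<..}. v x = outer x"
    using PQ'
  proof eventually_elim
    case (elim x)
    have tail: "exp (- (k * of_real a)) * tail x = exp (- (k * of_real x))"
      by (simp add: tail_def flip: exp_add)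
    have "v x $ 1 = Q' * exp (- (k * of_real x)) / (2 * k)"
      "v x $ 2 = - (Q' * exp (- (k * of_real x))) / (2 * (of_real m + z))"
      using modes_to_components[of "v x $ 1" "v x $ 2" P' "exp (k * of_real x)" Q' "exp (- (k * of_real x))"]
        elim \<open>P' = 0\<close> by auto
    moreover have \<gamma>: "\<gamma> * tail x = Q' * exp (- (k * of_real x)) / (2 * k)"
      by (simp add: \<gamma>_def tail[symmetric])
    moreover have "- (k / (of_real m + z)) * \<gamma> * tail x = - (Q' * exp (- (k * of_real x))) / (2 * (of_real m + z))"
      unfolding mult.assoc \<gamma> by (rule decaying_mode_second_component[OF k_facts(4,3)])
    ultimately show ?case
      unfolding vec2_eq_iff outer_def vector_2 by simp
  qed
  have cont: "continuous_on UNIV inner" "continuous_on UNIV outer"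
    unfolding inner_def[abs_def] outer_def[abs_def]
    by (intro continuous_on_vec2 continuous_on_mult continuous_on_const sol_continuous tail_continuous)+
  have nb: "at 0 within {0<..<a} \<noteq> bot" "at a within {0<..<a} \<noteq> bot" "at a within {a<..} \<noteq> bot"
    using a_pos by (simp_all add: at_within_eq_bot_iff)
  have v0: "v0 = inner 0"
    by (rule has_trace_unique[OF tr(1) _ nb(1) cont(1) inner]) simp
  have vm: "vm = inner a"
    by (rule has_trace_unique[OF tr(2) _ nb(2) cont(1) inner]) simp
  have vp: "vp = outer a"
    by (rule has_trace_unique[OF tr(3) _ nb(3) cont(2) outer]) simp
  have "w1 * c = w2"
    using tr(4) unfolding v0 by (simp add: inner_def)
  then have "w2 = c * w1" by (simp add: mult.commute)
  have ifc: "outer a $ 1 = inner a $ 1 \<and> outer a $ 2 - inner a $ 2 = of_real t * outer a $ 1"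
    using tr(5) unfolding vm vp interface_iff .
  have i: "\<gamma> = sol1 m z w1 w2 a" "- (k / (of_real m + z)) * \<gamma> - sol2 m z w1 w2 a = of_real t * \<gamma>"
    using ifc unfolding inner_def outer_def vector_2 tail_a mult_1_right by blast+
  have "AE x in lebesgue_on \<Omega>. v x = vector [hom1 w1 w2 \<gamma> x, hom2 w1 w2 \<gamma> x]"
  proof -
    have "AE x in lebesgue. x \<in> {0<..<a} \<longrightarrow> v x = inner x" "AE x in lebesgue. x \<in> {a<..} \<longrightarrow> v x = outer x"
      using inner outer by (simp_all add: AE_restrict_space_iff)
    then have "AE x in lebesgue. x \<in> \<Omega> \<longrightarrow> v x = vector [hom1 w1 w2 \<gamma> x, hom2 w1 w2 \<gamma> x]"
      by eventually_elim
        (auto simp: punctured_half_line_def hom1_def hom2_def piecewise_def inner_def outer_def)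
    then show ?thesis
      using \<Omega>_facts(4) by (simp add: AE_restrict_space_iff)
  qed
  then have "AE x in lebesgue_on half_line. v x = vector [hom1 w1 w2 \<gamma> x, hom2 w1 w2 \<gamma> x]"
    by (simp only: AE_half_line_iff[OF a_pos])
  then show ?thesis
    using that[of w1 \<gamma>] i unfolding \<open>w2 = c * w1\<close> by blast
qed

lemma matching_mult:
  "- (k / (of_real m + z)) * sol1 m z w (c * w) a - sol2 m z w (c * w) a - of_real t * sol1 m z w (c * w) a
    = w * mismatch m a (cot \<alpha>) t z"
  by (simp add: mismatch_def sol1_def sol2_def algebra_simps)

lemma homogeneous_solution_trivial:
  assumes v: "(v, \<lambda>x. z *s v x) \<in> D" and "mismatch m a (cot \<alpha>) t z \<noteq> 0"
  shows "AE x in lebesgue_on half_line. v x = 0"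
proof -
  obtain w \<gamma> where w: "AE x in lebesgue_on half_line. v x = vector [hom1 w (c * w) \<gamma> x, hom2 w (c * w) \<gamma> x]"
    "\<gamma> = sol1 m z w (c * w) a" "- (k / (of_real m + z)) * \<gamma> - sol2 m z w (c * w) a = of_real t * \<gamma>"
    using homogeneous_solution[OF v] .
  have "w * mismatch m a (cot \<alpha>) t z = 0"
    using w(2,3) matching_mult[of w] by simp
  then have "w = 0" using assms(2) by simp
  then have "hom1 w (c * w) \<gamma> x = 0" "hom2 w (c * w) \<gamma> x = 0" for x
    using w(2) by (simp_all add: hom1_def hom2_def piecewise_def sol1_def sol2_def)
  then show ?thesis
    using w(1) by (auto elim!: eventually_mono simp: vec2_eq_iff)
qed

end

section \<open>Bounded resolvent\<close>

lemma square_integrable_lborel: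
  assumes F: "F \<in> borel_measurable borel" "integrable lborel (\<lambda>x. (norm (F x))\<^sup>2)" and S: "S \<in> sets lebesgue"
  shows "square_integrable S F" "L2_norm_scalar S F \<le> sqrt (LINT x|lborel. (norm (F x))\<^sup>2)"
proof -
  have m: "(\<lambda>x. (norm (F x))\<^sup>2) \<in> borel_measurable lborel"
    using F(1) by measurable
  have i: "integrable lebesgue (\<lambda>x. (norm (F x))\<^sup>2)"
    by (rule iffD2[OF integrable_completion[OF m] F(2)])
  then have "integrable (lebesgue_on UNIV) (\<lambda>x. (norm (F x))\<^sup>2)"
    unfolding lebesgue_on_UNIV_eq .
  then have iS: "integrable (lebesgue_on S) (\<lambda>x. (norm (F x))\<^sup>2)"
    by (rule integrable_lebesgue_on_subset[OF _ S _ subset_UNIV]) simp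
  moreover have "F \<in> borel_measurable (lebesgue_on S)"
    using F(1) by (simp add: measurable_completion measurable_restrict_space1)
  ultimately show "square_integrable S F"
    by (simp add: square_integrable_def)
  have "(LINT x|lebesgue_on S. (norm (F x))\<^sup>2) = (LINT x|lebesgue. indicat_real S x *\<^sub>R (norm (F x))\<^sup>2)"
    using S by (subst integral_restrict_space) auto
  also have "\<dots> \<le> (LINT x|lebesgue. (norm (F x))\<^sup>2)"
    by (rule integral_mono[OF integrable_mult_indicator[OF S i] i]) (simp add: indicator_def)
  also have "\<dots> = (LINT x|lborel. (norm (F x))\<^sup>2)"
    by (rule integral_completion[OF m])
  finally show "L2_norm_scalar S F \<le> sqrt (LINT x|lborel. (norm (F x))\<^sup>2)"
    by (simp add: L2_norm_scalar_def)
qed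

lemma second_component_recombination:
  fixes n k :: complex
  assumes "n \<noteq> 0" "k \<noteq> 0"
  shows "1 / (2 * n) * (k * P + (k * f2 + (- n) * f1)) + (- (1 / (2 * n))) * (- k * Q + (k * f2 + n * f1)) =
    (k * k / n) * (1 / (2 * k) * P + 1 / (2 * k) * Q) - f1"
  using assms by (simp add: field_simps)

context dirac_problem
begin

text \<open>
One constant that bounds both the \<open>L\<^sup>2\<close> norm and the values of the convolutions.
\<close>

definition gain :: real where
  "gain = 2 / Re k + 1 / sqrt (Re k)"

text \<open>
Besides the \<open>L\<^sup>2\<close> bound, a bound on the values of \<open>P\<close> is needed, at the points \<open>0\<close> and \<open>a\<close>: they
determine the homogeneous correction.
\<close>

lemma convolution_solution:
  assumes f: "square_integrable half_line f"
    and n: "n \<in> borel_measurable borel" "\<And>s. norm (n s) \<le> exp (- Re k * \<bar>s\<bar>)" "\<forall>s. s \<noteq> 0 \<longrightarrow> isCont n s"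
    and fundamental: "\<forall>\<phi>\<in>test_functions UNIV. \<forall>y.
      (LINT x|lborel. deriv \<phi> x *\<^sub>R n (x - y)) = - of_real (\<phi> y) - b * (LINT x|lborel. \<phi> x *\<^sub>R n (x - y))"
  obtains P where "continuous_on UNIV P" "square_integrable half_line P"
    "weak_derivative \<Omega> P (\<lambda>x. b * P x + f x)"
    "L2_norm_scalar half_line P \<le> gain * L2_norm_scalar half_line f"
    "\<forall>x. norm (P x) \<le> gain * L2_norm_scalar half_line f"
proof -
  let ?N = "L2_norm_scalar half_line f"
  obtain F where F: "F \<in> borel_measurable borel" "AE x in lebesgue_on half_line. F x = f x"
    "integrable lborel (\<lambda>x. (norm (F x))\<^sup>2)" "(LINT x|lborel. (norm (F x))\<^sup>2) = ?N\<^sup>2"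
    using borel_representative[OF f open_greaterThan] .
  interpret exp_convolution n F "Re k"
    by unfold_locales (use n(1,2) F(1,3) k_facts(2) in simp_all)
  have F_sqnorm: "F_sqnorm = ?N\<^sup>2" by (simp add: F_sqnorm_def F(4))
  have N: "?N \<ge> 0" by (rule L2_norm_scalar_nonneg)
  let ?P = "convolve n F"
  have sqP: "square_integrable S ?P" if "S \<in> sets lebesgue" for S
    by (rule square_integrable_lborel(1)[OF convolve_measurable convolve_square_integrable that])
  have "L2_norm_scalar half_line ?P \<le> sqrt ((2 / Re k)\<^sup>2 * F_sqnorm)"
    by (rule order_trans[OF square_integrable_lborel(2)[OF convolve_measurable convolve_square_integrable]
          real_sqrt_le_mono[OF convolve_L2_le]]) simp
  also have "\<dots> = 2 / Re k * ?N"
    using k_facts(2) N by (simp add: F_sqnorm real_sqrt_mult)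
  also have "\<dots> \<le> gain * ?N"
    using k_facts(2) N by (intro mult_right_mono) (auto simp: gain_def)
  finally have norm2: "L2_norm_scalar half_line ?P \<le> gain * ?N" .
  have norm: "norm (?P x) \<le> gain * ?N" for x
  proof -
    have "norm (?P x) \<le> sqrt (F_sqnorm / Re k)" by (rule norm_convolve_le)
    also have "\<dots> = 1 / sqrt (Re k) * ?N"
      using N by (simp add: F_sqnorm real_sqrt_divide)
    also have "\<dots> \<le> gain * ?N"
      using k_facts(2) N by (intro mult_right_mono) (auto simp: gain_def)
    finally show ?thesis .
  qed
  have sqF: "square_integrable \<Omega> F"
    by (rule square_integrable_lborel(1)[OF F(1,3) \<Omega>_facts(4)])
  have "weak_derivative \<Omega> ?P (\<lambda>x. b * ?P x + F x)"
    unfolding weak_derivative_def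
  proof
    fix \<phi> assume \<phi>: "\<phi> \<in> test_functions \<Omega>"
    then obtain K where K: "smooth \<phi>" "compact K" "K \<subseteq> \<Omega>" "\<And>x. x \<notin> K \<Longrightarrow> \<phi> x = 0"
      unfolding test_functions_iff by blast
    have out: "\<phi> x = 0" "deriv \<phi> x = 0" if "x \<notin> \<Omega>" for x
    proof -
      have "x \<notin> K" using K(3) that by blast
      then show "\<phi> x = 0" "deriv \<phi> x = 0"
        using K(4) deriv_eq_0_outside[OF K(2), of \<phi> x] by auto
    qed
    have [measurable]: "\<phi> \<in> borel_measurable borel" "deriv \<phi> \<in> borel_measurable borel"
      using K(1) by (auto intro!: borel_measurable_continuous_onI smooth_continuous_on smooth_deriv)
    have \<phi>': "\<phi> \<in> test_functions UNIV"
      using \<phi> test_functions_mono[of \<Omega> UNIV] by blast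
    have "(LINT x|lborel. deriv \<phi> x *\<^sub>R ?P x) = - (LINT x|lborel. \<phi> x *\<^sub>R (b * ?P x + F x))"
      by (rule convolve_weak_derivative[OF _ \<phi>']) (rule fundamental[rule_format])
    moreover have "(LINT x|lebesgue_on \<Omega>. deriv \<phi> x *\<^sub>R ?P x) = (LINT x|lborel. deriv \<phi> x *\<^sub>R ?P x)"
      by (rule integrable_lebesgue_on_borel(2)[OF _ \<Omega>_facts(1)]) (measurable, simp add: out)
    moreover have "(LINT x|lebesgue_on \<Omega>. \<phi> x *\<^sub>R (b * ?P x + F x)) = (LINT x|lborel. \<phi> x *\<^sub>R (b * ?P x + F x))"
      by (rule integrable_lebesgue_on_borel(2)[OF _ \<Omega>_facts(1)]) (measurable, simp add: out)
    ultimately show "(LINT x|lebesgue_on \<Omega>. deriv \<phi> x *\<^sub>R ?P x) = - (LINT x|lebesgue_on \<Omega>. \<phi> x *\<^sub>R (b * ?P x + F x))"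
      by simp
  qed
  then have "weak_derivative \<Omega> ?P (\<lambda>x. b * ?P x + f x)"
  proof (rule weak_derivative_cong_AE[OF _ \<Omega>_facts(1)])
    show "square_integrable \<Omega> (\<lambda>x. b * ?P x + F x)"
      by (intro square_integrable_add square_integrable_cmult sqP sqF \<Omega>_facts(4))
    show "square_integrable \<Omega> (\<lambda>x. b * ?P x + f x)"
      by (intro square_integrable_add square_integrable_cmult sqP \<Omega>_facts(4) square_integrable_punctured[OF a_pos f])
    show "AE x in lebesgue_on \<Omega>. b * ?P x + F x = b * ?P x + f x"
      using F(2) unfolding AE_half_line_iff[OF a_pos] by (rule eventually_mono) simp
  qed
  with norm2 norm sqP[of half_line] convolve_continuous[OF n(3)[rule_format]] show ?thesis
    by (intro that[of ?P]) auto
qed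

text \<open>
The first-order system for \<open>(u1, u2)\<close> decouples in \<open>P = k u\<^sub>1 + (m + z) u\<^sub>2\<close> and
\<open>Q = k u\<^sub>1 - (m + z) u\<^sub>2\<close>, with right-hand sides \<open>k f\<^sub>2 - (m + z) f\<^sub>1\<close> and \<open>k f\<^sub>2 + (m + z) f\<^sub>1\<close>. The
growing mode is integrated from the right, the decaying one from the left.
\<close>

lemma particular_solution:
  obtains K where "K \<ge> 0" "\<And>f. f \<in> L2 half_line \<Longrightarrow>
    \<exists>u1 u2. inhomogeneous_solution f u1 u2 \<and>
      L2_norm_scalar half_line u1 \<le> K * L2_norm half_line f \<and>
      L2_norm_scalar half_line u2 \<le> K * L2_norm half_line f \<and>
      (\<forall>x. norm (u1 x) \<le> K * L2_norm half_line f \<and> norm (u2 x) \<le> K * L2_norm half_line f)"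
proof -
  define n where "n = of_real m + z"
  have n: "n \<noteq> 0" and kk: "k * k = n * (of_real m - z)"
    using k_facts(4) k_mult[of 1] by (simp_all add: n_def)
  define K0 where "K0 = 2 * (norm k + norm n)"
  define K1 where "K1 = gain * K0"
  define A B where "A = 1 / (2 * k)" and "B = 1 / (2 * n)"
  define K where "K = 4 * (norm A + norm B) * K1"
  have K1: "K1 \<ge> 0"
    using k_facts(2) by (simp add: K1_def K0_def gain_def)
  have "K \<ge> 0" using K1 by (simp add: K_def)
  moreover have "\<exists>u1 u2. inhomogeneous_solution f u1 u2 \<and>
      L2_norm_scalar half_line u1 \<le> K * L2_norm half_line f \<and>
      L2_norm_scalar half_line u2 \<le> K * L2_norm half_line f \<and>
      (\<forall>x. norm (u1 x) \<le> K * L2_norm half_line f \<and> norm (u2 x) \<le> K * L2_norm half_line f)"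
    if f: "f \<in> L2 half_line" for f :: "real \<Rightarrow> complex^2"
  proof -
    let ?N = "L2_norm half_line f"
    have N: "?N \<ge> 0" by (simp add: L2_norm_def)
    have fs: "square_integrable half_line (\<lambda>x. f x $ 1)" "square_integrable half_line (\<lambda>x. f x $ 2)"
      using f by (auto simp: L2_iff)
    define fp fq where "fp x = k * f x $ 2 + (- n) * f x $ 1" and "fq x = k * f x $ 2 + n * f x $ 1" for x
    have sf: "square_integrable half_line fp" "square_integrable half_line fq"
      unfolding fp_def[abs_def] fq_def[abs_def] by (intro square_integrable_linear(1) fs)+
    have bound: "L2_norm_scalar half_line (\<lambda>x. k * f x $ 2 + s * f x $ 1) \<le> K0 * ?N" if "norm s = norm n" for s
    proof -
      have "L2_norm_scalar half_line (\<lambda>x. k * f x $ 2 + s * f x $ 1) \<le>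
          2 * (norm k * L2_norm_scalar half_line (\<lambda>x. f x $ 2) + norm s * L2_norm_scalar half_line (\<lambda>x. f x $ 1))"
        by (rule L2_norm_scalar_linear[OF fs(2,1)])
      also have "\<dots> \<le> 2 * (norm k * ?N + norm s * ?N)"
        by (intro mult_left_mono add_mono components_le_L2_norm[OF f]) auto
      finally show ?thesis by (simp add: K0_def that algebra_simps)
    qed
    have scale: "gain * L2_norm_scalar half_line g \<le> K1 * ?N"
      if "L2_norm_scalar half_line g \<le> K0 * ?N" for g
      unfolding K1_def mult.assoc using k_facts(2) by (intro mult_left_mono that) (auto simp: gain_def)
    have le: "gain * L2_norm_scalar half_line fp \<le> K1 * ?N"
      "gain * L2_norm_scalar half_line fq \<le> K1 * ?N"
      unfolding fp_def[abs_def] fq_def[abs_def] by (intro scale bound; simp)+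
    have kernel: "\<forall>s. s \<noteq> 0 \<longrightarrow> isCont (left_kernel k) s"
      "\<forall>\<phi>\<in>test_functions UNIV. \<forall>y. (LINT x|lborel. deriv \<phi> x *\<^sub>R left_kernel k (x - y)) =
        - of_real (\<phi> y) - k * (LINT x|lborel. \<phi> x *\<^sub>R left_kernel k (x - y))"
      "\<forall>s. s \<noteq> 0 \<longrightarrow> isCont (right_kernel k) s"
      "\<forall>\<phi>\<in>test_functions UNIV. \<forall>y. (LINT x|lborel. deriv \<phi> x *\<^sub>R right_kernel k (x - y)) =
        - of_real (\<phi> y) - (- k) * (LINT x|lborel. \<phi> x *\<^sub>R right_kernel k (x - y))"
      by (intro allI ballI impI kernel_continuous left_kernel_fundamental right_kernel_fundamental; assumption)+
    obtain P where P: "continuous_on UNIV P" "square_integrable half_line P"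
      "weak_derivative \<Omega> P (\<lambda>x. k * P x + fp x)"
      "L2_norm_scalar half_line P \<le> gain * L2_norm_scalar half_line fp"
      "\<forall>x. norm (P x) \<le> gain * L2_norm_scalar half_line fp"
      using convolution_solution[OF sf(1) kernel_measurable(1) kernel_bounds(1)[OF k_facts(2)]
          kernel(1,2)] .
    obtain Q where Q: "continuous_on UNIV Q" "square_integrable half_line Q"
      "weak_derivative \<Omega> Q (\<lambda>x. - k * Q x + fq x)"
      "L2_norm_scalar half_line Q \<le> gain * L2_norm_scalar half_line fq"
      "\<forall>x. norm (Q x) \<le> gain * L2_norm_scalar half_line fq"
      using convolution_solution[OF sf(2) kernel_measurable(2) kernel_bounds(2)[OF k_facts(2)]
          kernel(3,4)] .
    have PQ: "L2_norm_scalar half_line P \<le> K1 * ?N" "L2_norm_scalar half_line Q \<le> K1 * ?N"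
      "norm (P x) \<le> K1 * ?N" "norm (Q x) \<le> K1 * ?N" for x
      using le P(4,5) Q(4,5) by (meson order_trans)+
    define u1 u2 where "u1 x = A * P x + A * Q x" and "u2 x = B * P x + (- B) * Q x" for x
    note sqs = P(2) Q(2) sf
    have "weak_derivative \<Omega> u1 (\<lambda>x. A * (k * P x + fp x) + A * (- k * Q x + fq x))"
      unfolding u1_def[abs_def]
      by (intro weak_derivative_linear \<Omega>_facts(1) P(3) Q(3) square_integrable_punctured[OF a_pos]
          square_integrable_add square_integrable_cmult sqs)
    moreover have "A * (k * P x + fp x) + A * (- k * Q x + fq x) = n * u2 x + f x $ 2" for x
      using k_facts(3) n by (simp add: A_def B_def u2_def fp_def fq_def field_simps)
    ultimately have w1: "weak_derivative \<Omega> u1 (\<lambda>x. n * u2 x + f x $ 2)" by simp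
    have "weak_derivative \<Omega> u2 (\<lambda>x. B * (k * P x + fp x) + (- B) * (- k * Q x + fq x))"
      unfolding u2_def[abs_def]
      by (intro weak_derivative_linear \<Omega>_facts(1) P(3) Q(3) square_integrable_punctured[OF a_pos]
          square_integrable_add square_integrable_cmult sqs)
    moreover have "B * (k * P x + fp x) + (- B) * (- k * Q x + fq x) = (of_real m - z) * u1 x - f x $ 1" for x
    proof -
      have d: "of_real m - z = k * k / n" using kk n by simp
      show ?thesis
        unfolding d A_def B_def u1_def fp_def fq_def by (rule second_component_recombination[OF n k_facts(3)])
    qed
    ultimately have w2: "weak_derivative \<Omega> u2 (\<lambda>x. (of_real m - z) * u1 x - f x $ 1)" by simp
    have comb: "2 * (norm s * p + norm s' * q) \<le> K * ?N"
      if "norm s \<le> norm A + norm B" "norm s' \<le> norm A + norm B" "0 \<le> p" "0 \<le> q" "p \<le> K1 * ?N" "q \<le> K1 * ?N"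
      for s s' :: complex and p q
    proof -
      define X where "X = (norm A + norm B) * (K1 * ?N)"
      have "norm s * p \<le> X" "norm s' * q \<le> X"
        unfolding X_def using that by (intro mult_mono; simp)+
      then have "norm s * p + norm s' * q \<le> X + X" by (rule add_mono)
      then have "2 * (norm s * p + norm s' * q) \<le> 4 * X" by simp
      then show ?thesis unfolding K_def X_def mult.assoc .
    qed
    have small: "norm A \<le> norm A + norm B" "norm B \<le> norm A + norm B" "norm (- B) \<le> norm A + norm B" by simp_all
    have "L2_norm_scalar half_line u1 \<le> K * ?N"
      unfolding u1_def[abs_def]
      by (rule order_trans[OF L2_norm_scalar_linear[OF P(2) Q(2)] comb])
        (intro small PQ L2_norm_scalar_nonneg)+
    moreover have "L2_norm_scalar half_line u2 \<le> K * ?N"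
      unfolding u2_def[abs_def]
      by (rule order_trans[OF L2_norm_scalar_linear[OF P(2) Q(2)] comb])
        (intro small PQ L2_norm_scalar_nonneg)+
    moreover have "norm (s * P x + s' * Q x) \<le> K * ?N"
      if "norm s \<le> norm A + norm B" "norm s' \<le> norm A + norm B" for s s' x
    proof -
      have "norm (s * P x + s' * Q x) \<le> norm s * norm (P x) + norm s' * norm (Q x)"
        using norm_triangle_ineq[of "s * P x" "s' * Q x"] by (simp add: norm_mult)
      also have "\<dots> \<le> 2 * (norm s * norm (P x) + norm s' * norm (Q x))" by simp
      also have "\<dots> \<le> K * ?N"
        by (rule comb[OF that]) (intro PQ norm_ge_zero)+
      finally show ?thesis .
    qed
    then have "norm (u1 x) \<le> K * ?N" "norm (u2 x) \<le> K * ?N" for x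
      unfolding u1_def u2_def using small by blast+
    moreover have "continuous_on UNIV u1" "continuous_on UNIV u2"
      unfolding u1_def[abs_def] u2_def[abs_def] by (intro continuous_intros P(1) Q(1))+
    moreover have "square_integrable half_line u1" "square_integrable half_line u2"
      unfolding u1_def[abs_def] u2_def[abs_def] by (intro square_integrable_linear(1) P(2) Q(2))+
    ultimately show ?thesis
      using w1 w2 unfolding inhomogeneous_solution_def n_def by blast
  qed
  ultimately show ?thesis using that by blast
qed

lemma L2_norm_scalar_add_le:
  assumes "square_integrable S u" "square_integrable S v"
  shows "L2_norm_scalar S (\<lambda>x. u x + v x) \<le> 2 * (L2_norm_scalar S u + L2_norm_scalar S v)"
  using L2_norm_scalar_linear[OF assms, of 1 1] by simp

lemma L2_norm_scalar_comb3:
  assumes "square_integrable S p" "square_integrable S q" "square_integrable S r"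
  shows "L2_norm_scalar S (\<lambda>x. v1 * p x + (v2 * q x + g * r x)) \<le>
    4 * (norm v1 * L2_norm_scalar S p + norm v2 * L2_norm_scalar S q + norm g * L2_norm_scalar S r)"
proof -
  have "L2_norm_scalar S (\<lambda>x. v1 * p x + 1 * (v2 * q x + g * r x)) \<le>
    2 * (norm v1 * L2_norm_scalar S p + norm (1::complex) * L2_norm_scalar S (\<lambda>x. v2 * q x + g * r x))"
    by (intro L2_norm_scalar_linear assms square_integrable_linear(1))
  moreover have "L2_norm_scalar S (\<lambda>x. v2 * q x + g * r x) \<le>
      2 * (norm v2 * L2_norm_scalar S q + norm g * L2_norm_scalar S r)"
    by (intro L2_norm_scalar_linear assms)
  moreover have "0 \<le> norm v1 * L2_norm_scalar S p" by (simp add: L2_norm_scalar_nonneg)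
  ultimately show ?thesis by (simp add: algebra_simps)
qed

lemma hom_linear:
  "hom1 v1 v2 \<gamma> x = v1 * hom1 1 0 0 x + (v2 * hom1 0 1 0 x + \<gamma> * hom1 0 0 1 x)"
  "hom2 v1 v2 \<gamma> x = v1 * hom2 1 0 0 x + (v2 * hom2 0 1 0 x + \<gamma> * hom2 0 0 1 x)"
  by (simp_all add: hom1_def hom2_def piecewise_def sol1_def sol2_def algebra_simps)

text \<open>
The boundary condition fixes \<open>v2\<close> in terms of \<open>v1\<close>, continuity at \<open>a\<close> fixes the amplitude \<open>\<gamma>\<close>, and
the jump condition becomes one linear equation for \<open>v1\<close> whose coefficient is the mismatch. Every
quantity involved depends linearly and boundedly on \<open>f\<close>.
\<close>

lemma bounded_solution:
  assumes W: "mismatch m a (cot \<alpha>) t z \<noteq> 0"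
  obtains C where "\<And>f :: real \<Rightarrow> complex^2. f \<in> L2 half_line \<Longrightarrow>
    \<exists>\<psi>. (\<psi>, \<lambda>x. f x + z *s \<psi> x) \<in> D \<and> L2_norm half_line \<psi> \<le> C * L2_norm half_line f"
proof -
  obtain K where K: "K \<ge> 0" "\<And>f. f \<in> L2 half_line \<Longrightarrow>
    \<exists>u1 u2. inhomogeneous_solution f u1 u2 \<and>
      L2_norm_scalar half_line u1 \<le> K * L2_norm half_line f \<and>
      L2_norm_scalar half_line u2 \<le> K * L2_norm half_line f \<and>
      (\<forall>x. norm (u1 x) \<le> K * L2_norm half_line f \<and> norm (u2 x) \<le> K * L2_norm half_line f)"
    using particular_solution by blast
  define W where "W = mismatch m a (cot \<alpha>) t z"
  define b where "b = k / (of_real m + z) * sol1 m z 0 1 a + sol2 m z 0 1 a + of_real t * sol1 m z 0 1 a"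
  \<comment> \<open>\<open>K1\<close>, \<open>K2\<close>, \<open>K3\<close> and \<open>K4\<close> bound \<open>\<beta>\<close>, \<open>v1\<close>, \<open>v2\<close> and \<open>\<gamma>\<close> below, relative to the norm of \<open>f\<close>.\<close>
  define K1 where "K1 = norm c * K + K"
  define K2 where "K2 = (\<bar>t\<bar> * K + K1 * norm b) / norm W"
  define K3 where "K3 = norm c * K2 + K1"
  define K4 where "K4 = K2 * norm (sol1 m z 1 0 a) + K3 * norm (sol1 m z 0 1 a)"
  let ?n = "L2_norm_scalar half_line"
  define H where "H h = 4 * (K2 * ?n (h 1 0 0) + K3 * ?n (h 0 1 0) + K4 * ?n (h 0 0 (1::complex)))"
    for h :: "complex \<Rightarrow> complex \<Rightarrow> complex \<Rightarrow> real \<Rightarrow> complex"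
  define C where "C = 2 * (K + H hom1) + 2 * (K + H hom2)"
  have "W \<noteq> 0" using W by (simp add: W_def)
  have "\<exists>\<psi>. (\<psi>, \<lambda>x. f x + z *s \<psi> x) \<in> D \<and> L2_norm half_line \<psi> \<le> C * L2_norm half_line f"
    if f: "f \<in> L2 half_line" for f :: "real \<Rightarrow> complex^2"
  proof -
    let ?N = "L2_norm half_line f"
    obtain u1 u2 where sol: "inhomogeneous_solution f u1 u2"
      and u: "?n u1 \<le> K * ?N" "?n u2 \<le> K * ?N" "\<And>x. norm (u1 x) \<le> K * ?N" "\<And>x. norm (u2 x) \<le> K * ?N"
      using K(2)[OF f] by blast
    have sq: "square_integrable half_line u1" "square_integrable half_line u2"
      using sol by (simp_all add: inhomogeneous_solution_def)
    have N: "?N \<ge> 0" by (simp add: L2_norm_def)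
    define \<beta> where "\<beta> = c * u1 0 - u2 0"
    define v1 where "v1 = (of_real t * u1 a + \<beta> * b) / W"
    define v2 where "v2 = c * v1 + \<beta>"
    define \<gamma> where "\<gamma> = sol1 m z v1 v2 a"
    have bc: "(u1 0 + v1) * c = u2 0 + v2"
      by (simp add: v2_def \<beta>_def algebra_simps)
    have match: "- (k / (of_real m + z)) * \<gamma> - sol2 m z v1 v2 a = of_real t * (u1 a + \<gamma>)"
    proof -
      have "sol1 m z v1 v2 a = sol1 m z v1 (c * v1) a + \<beta> * sol1 m z 0 1 a"
        "sol2 m z v1 v2 a = sol2 m z v1 (c * v1) a + \<beta> * sol2 m z 0 1 a"
        using sol_linear[of v1 v2 a] sol_linear[of v1 "c * v1" a] by (simp_all add: v2_def algebra_simps)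
      then have "- (k / (of_real m + z)) * \<gamma> - sol2 m z v1 v2 a - of_real t * \<gamma> = v1 * W - \<beta> * b"
        using matching_mult[of v1] by (simp add: \<gamma>_def W_def b_def algebra_simps)
      also have "v1 * W = of_real t * u1 a + \<beta> * b"
        using \<open>W \<noteq> 0\<close> by (simp add: v1_def)
      finally show ?thesis by (simp add: algebra_simps)
    qed
    define \<psi> :: "real \<Rightarrow> complex^2" where "\<psi> x = vector [u1 x + hom1 v1 v2 \<gamma> x, u2 x + hom2 v1 v2 \<gamma> x]" for x
    have "(\<psi>, \<lambda>x. f x + z *s \<psi> x) \<in> D"
      unfolding \<psi>_def by (rule resolvent_equation_solution[OF f sol bc \<gamma>_def match])
    moreover have "L2_norm half_line \<psi> \<le> C * ?N"
    proof -
      have \<beta>: "norm \<beta> \<le> K1 * ?N"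
      proof -
        have "norm \<beta> \<le> norm c * norm (u1 0) + norm (u2 0)"
          unfolding \<beta>_def using norm_triangle_ineq4[of "c * u1 0" "u2 0"] by (simp add: norm_mult)
        also have "\<dots> \<le> norm c * (K * ?N) + K * ?N"
          by (intro add_mono mult_left_mono u norm_ge_zero)
        finally show ?thesis by (simp add: K1_def algebra_simps)
      qed
      have v1: "norm v1 \<le> K2 * ?N"
      proof -
        have "norm (of_real t * u1 a + \<beta> * b) \<le> \<bar>t\<bar> * norm (u1 a) + norm \<beta> * norm b"
          using norm_triangle_ineq[of "of_real t * u1 a" "\<beta> * b"] by (simp add: norm_mult)
        also have "\<dots> \<le> \<bar>t\<bar> * (K * ?N) + (K1 * ?N) * norm b"
          by (intro add_mono mult_left_mono mult_right_mono u \<beta> norm_ge_zero abs_ge_zero)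
        also have "\<dots> = (\<bar>t\<bar> * K + K1 * norm b) * ?N" by (simp add: algebra_simps)
        finally show ?thesis
          unfolding v1_def K2_def by (simp add: norm_divide divide_right_mono)
      qed
      have v2: "norm v2 \<le> K3 * ?N"
      proof -
        have "norm v2 \<le> norm c * norm v1 + norm \<beta>"
          unfolding v2_def using norm_triangle_ineq[of "c * v1" \<beta>] by (simp add: norm_mult)
        also have "\<dots> \<le> norm c * (K2 * ?N) + K1 * ?N"
          by (intro add_mono mult_left_mono v1 \<beta> norm_ge_zero)
        finally show ?thesis by (simp add: K3_def algebra_simps)
      qed
      have \<gamma>: "norm \<gamma> \<le> K4 * ?N"
      proof -
        have "norm \<gamma> \<le> norm v1 * norm (sol1 m z 1 0 a) + norm v2 * norm (sol1 m z 0 1 a)"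
          unfolding \<gamma>_def sol_linear(1)[of v1 v2]
          using norm_triangle_ineq[of "v1 * sol1 m z 1 0 a" "v2 * sol1 m z 0 1 a"] by (simp add: norm_mult)
        also have "\<dots> \<le> (K2 * ?N) * norm (sol1 m z 1 0 a) + (K3 * ?N) * norm (sol1 m z 0 1 a)"
          by (intro add_mono mult_right_mono v1 v2 norm_ge_zero)
        finally show ?thesis by (simp add: K4_def algebra_simps)
      qed
      have est: "?n (\<lambda>x. u x + h v1 v2 \<gamma> x) \<le> 2 * (K + H h) * ?N"
        if "square_integrable half_line u" "?n u \<le> K * ?N" "\<And>v1 v2 \<gamma>. square_integrable half_line (h v1 v2 \<gamma>)"
          "\<And>v1 v2 \<gamma> x. h v1 v2 \<gamma> x = v1 * h 1 0 0 x + (v2 * h 0 1 0 x + \<gamma> * h 0 0 1 x)" for u h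
      proof -
        have "?n (h v1 v2 \<gamma>) = ?n (\<lambda>x. v1 * h 1 0 0 x + (v2 * h 0 1 0 x + \<gamma> * h 0 0 1 x))"
          using that(4)[of v1 v2 \<gamma>] by (metis ext)
        also have "\<dots> \<le> 4 * (norm v1 * ?n (h 1 0 0) + norm v2 * ?n (h 0 1 0) + norm \<gamma> * ?n (h 0 0 1))"
          by (rule L2_norm_scalar_comb3[OF that(3) that(3) that(3)])
        also have "\<dots> \<le> 4 * ((K2 * ?N) * ?n (h 1 0 0) + (K3 * ?N) * ?n (h 0 1 0) + (K4 * ?N) * ?n (h 0 0 1))"
          by (intro mult_left_mono add_mono mult_right_mono v1 v2 \<gamma> L2_norm_scalar_nonneg) simp
        also have "\<dots> = H h * ?N" by (simp add: H_def algebra_simps)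
        finally have "?n (h v1 v2 \<gamma>) \<le> H h * ?N" .
        with that(2) L2_norm_scalar_add_le[OF that(1) that(3), of v1 v2 \<gamma>] show ?thesis
          by (simp add: algebra_simps)
      qed
      have "\<psi> \<in> L2 half_line"
        unfolding L2_iff \<psi>_def vector_2
        by (intro conjI square_integrable_add sq hom_square_integrable)
      then have "L2_norm half_line \<psi> \<le> ?n (\<lambda>x. u1 x + hom1 v1 v2 \<gamma> x) + ?n (\<lambda>x. u2 x + hom2 v1 v2 \<gamma> x)"
        using L2_norm_le_components[of \<psi>] unfolding \<psi>_def vector_2 by simp
      also have "\<dots> \<le> 2 * (K + H hom1) * ?N + 2 * (K + H hom2) * ?N"
        by (intro add_mono est sq u hom_square_integrable hom_linear)
      also have "\<dots> = C * ?N" by (simp add: C_def algebra_simps)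
      finally show ?thesis .
    qed
    ultimately show ?thesis by blast
  qed
  then show ?thesis using that by blast
qed

text \<open>
The norm bound for an arbitrary element of the graph follows from the bounded solution found above:
the difference of the two solves the homogeneous equation and hence vanishes almost everywhere.
\<close>

lemma in_resolvent_set:
  assumes W: "mismatch m a (cot \<alpha>) t z \<noteq> 0"
  shows "z \<in> resolvent_set D"
proof -
  obtain C where C: "\<And>f :: real \<Rightarrow> complex^2. f \<in> L2 half_line \<Longrightarrow>
    \<exists>\<psi>. (\<psi>, \<lambda>x. f x + z *s \<psi> x) \<in> D \<and> L2_norm half_line \<psi> \<le> C * L2_norm half_line f"
    using bounded_solution[OF W] by blast
  have "L2_norm half_line \<psi> \<le> C * L2_norm half_line (\<lambda>x. \<phi> x - z *s \<psi> x)" if D: "(\<psi>, \<phi>) \<in> D" for \<psi> \<phi>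
  proof -
    have \<psi>: "\<psi> \<in> L2 half_line" and \<phi>: "\<phi> \<in> L2 half_line"
      using D L2_half_line[OF a_pos] unfolding dirac_delta_def dirac_delta_domain_def H1_def by auto
    define f where "f x = \<phi> x - z *s \<psi> x" for x
    have "f = (\<lambda>x. \<phi> x + (- z) *s \<psi> x)"
      by (simp add: f_def fun_eq_iff vec2_eq_iff)
    then have f: "f \<in> L2 half_line"
      using L2_lincomb[OF \<phi> \<psi>, of "- z"] by simp
    obtain \<psi>' where \<psi>': "(\<psi>', \<lambda>x. f x + z *s \<psi>' x) \<in> D" "L2_norm half_line \<psi>' \<le> C * L2_norm half_line f"
      using C[OF f] by blast
    have "(\<lambda>x. \<psi> x - \<psi>' x, \<lambda>x. \<phi> x - (f x + z *s \<psi>' x)) \<in> D"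
      by (rule dirac_delta_diff[OF a_pos D \<psi>'(1)])
    moreover have "\<phi> x - (f x + z *s \<psi>' x) = z *s (\<psi> x - \<psi>' x)" for x
      by (simp add: f_def vec2_eq_iff algebra_simps)
    ultimately have ae: "AE x in lebesgue_on half_line. \<psi> x - \<psi>' x = 0"
      by (intro homogeneous_solution_trivial[OF _ W]) simp
    have \<psi>'L: "\<psi>' \<in> L2 half_line"
      using \<psi>'(1) L2_half_line[OF a_pos] unfolding dirac_delta_def dirac_delta_domain_def H1_def by auto
    have "L2_norm half_line \<psi> = L2_norm half_line \<psi>'"
      unfolding L2_norm_def
      by (rule arg_cong[where f = sqrt], rule integral_cong_AE)
        (use \<psi> \<psi>'L ae in \<open>auto simp: L2_def elim!: eventually_mono\<close>)
    then show ?thesis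
      using \<psi>'(2) by (simp add: f_def[abs_def])
  qed
  then show ?thesis
    unfolding resolvent_set_def using C by blast
qed

end

section \<open>The bound state and the main result\<close>

context dirac_problem
begin

definition bound_state :: "real \<Rightarrow> complex^2" where
  "bound_state x = vector [hom1 1 c (sol1 m z 1 c a) x, hom2 1 c (sol1 m z 1 c a) x]"

lemma bound_state_in_eigenspace:
  assumes W: "mismatch m a (cot \<alpha>) t z = 0"
  shows "bound_state \<in> eigenspace D z"
proof -
  have "(\<lambda>x. vector [0 + hom1 1 c (sol1 m z 1 c a) x, 0 + hom2 1 c (sol1 m z 1 c a) x],
      \<lambda>x. 0 + z *s vector [0 + hom1 1 c (sol1 m z 1 c a) x, 0 + hom2 1 c (sol1 m z 1 c a) x]) \<in> D"
    by (rule resolvent_equation_solution)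
      (use W in \<open>simp_all add: inhomogeneous_solution_def L2_def square_integrable_def weak_derivative_def mismatch_def\<close>)
  then show ?thesis
    by (simp add: eigenspace_def bound_state_def[abs_def])
qed

lemma bound_state_nonzero: "\<not> (AE x in lebesgue_on half_line. bound_state x = 0)"
proof
  assume "AE x in lebesgue_on half_line. bound_state x = 0"
  then have "AE x in lebesgue. x \<in> {0<..<a} \<longrightarrow> bound_state x = 0"
    by (subst (asm) AE_restrict_space_iff) (auto elim: eventually_mono)
  then have ae: "AE x in lebesgue_on {0<..<a}. bound_state x = (\<lambda>_. 0) x"
    by (subst AE_restrict_space_iff) auto
  define inner :: "real \<Rightarrow> complex^2" where "inner x = vector [sol1 m z 1 c x, sol2 m z 1 c x]" for x
  have cont: "continuous_on UNIV inner"
    unfolding inner_def[abs_def] by (intro continuous_on_vec2 sol_continuous)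
  have "has_trace {0<..<a} 0 bound_state (inner 0)"
    by (rule has_traceI[OF cont]) (simp add: bound_state_def inner_def hom1_def hom2_def piecewise_def)
  then have "inner 0 = 0"
    by (rule has_trace_unique[OF _ _ _ _ ae]) (use a_pos in \<open>simp_all add: at_within_eq_bot_iff\<close>)
  then have "inner 0 $ 1 = 0" by simp
  then show False by (simp add: inner_def)
qed

text \<open>
The eigenspace is one-dimensional: an eigenfunction is determined by its first component at \<open>0\<close>.
\<close>

lemma finite_multiplicity_bound_state:
  assumes W: "mismatch m a (cot \<alpha>) t z = 0"
  shows "finite_multiplicity D z"
  unfolding finite_multiplicity_def
proof (intro exI[of _ "{bound_state}"] conjI ballI)
  show "{bound_state} \<subseteq> eigenspace D z"
    using bound_state_in_eigenspace[OF W] by simp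
  fix v assume "v \<in> eigenspace D z"
  then have v: "(v, \<lambda>x. z *s v x) \<in> D" by (simp add: eigenspace_def)
  obtain w \<gamma> where w: "AE x in lebesgue_on half_line. v x = vector [hom1 w (c * w) \<gamma> x, hom2 w (c * w) \<gamma> x]"
    "\<gamma> = sol1 m z w (c * w) a" "- (k / (of_real m + z)) * \<gamma> - sol2 m z w (c * w) a = of_real t * \<gamma>"
    using homogeneous_solution[OF v] .
  have "vector [hom1 w (c * w) \<gamma> x, hom2 w (c * w) \<gamma> x] = w *s bound_state x" for x
    unfolding w(2) by (simp add: vec2_eq_iff bound_state_def hom1_def hom2_def piecewise_def
        sol1_def sol2_def algebra_simps)
  then show "\<exists>c. AE x in lebesgue_on half_line. v x = (\<Sum>b\<in>{bound_state}. c b *s b x)"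
    using w(1) by (intro exI[of _ "\<lambda>_. w"]) simp
qed simp

lemma eigenvalue_bound_state:
  assumes W: "mismatch m a (cot \<alpha>) t z = 0"
  shows "eigenvalue D z"
  using bound_state_in_eigenspace[OF W] bound_state_nonzero unfolding eigenvalue_def by blast

text \<open>
A nonzero kernel element contradicts the norm bound in the definition of the resolvent set.
\<close>

lemma in_spectrum:
  assumes W: "mismatch m a (cot \<alpha>) t z = 0"
  shows "z \<in> spectrum D"
proof (rule ccontr)
  assume "z \<notin> spectrum D"
  then obtain C where C: "\<forall>(\<psi>, \<phi>)\<in>D. L2_norm half_line \<psi> \<le> C * L2_norm half_line (\<lambda>x. \<phi> x - z *s \<psi> x)"
    by (auto simp: spectrum_def resolvent_set_def)
  have "(bound_state, \<lambda>x. z *s bound_state x) \<in> D"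
    using bound_state_in_eigenspace[OF W] by (simp add: eigenspace_def)
  then have "L2_norm half_line bound_state \<le> C * L2_norm half_line (\<lambda>x. z *s bound_state x - z *s bound_state x)"
    using bspec[OF C] by fast
  then have "L2_norm half_line bound_state \<le> 0"
    by (simp add: L2_norm_def)
  then have "(LINT x|lebesgue_on half_line. (norm (bound_state x))\<^sup>2) \<le> 0"
    by (simp add: L2_norm_def)
  moreover have "(LINT x|lebesgue_on half_line. (norm (bound_state x))\<^sup>2) \<ge> 0"
    by simp
  moreover have "integrable (lebesgue_on half_line) (\<lambda>x. (norm (bound_state x))\<^sup>2)"
  proof -
    have "bound_state \<in> L2 half_line"
      unfolding L2_iff bound_state_def vector_2 by (intro conjI hom_square_integrable)
    then show ?thesis by (simp add: L2_def)
  qed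
  ultimately have "AE x in lebesgue_on half_line. (norm (bound_state x))\<^sup>2 = 0"
    using integral_nonneg_eq_0_iff_AE[of "lebesgue_on half_line" "\<lambda>x. (norm (bound_state x))\<^sup>2"] by simp
  then show False
    using bound_state_nonzero by simp
qed

end

lemma mismatch_holomorphic: "mismatch m a c t holomorphic_on ball 0 m"
proof -
  have nonpos: "(of_real m)\<^sup>2 - z\<^sup>2 \<notin> \<real>\<^sub>\<le>\<^sub>0" if "z \<in> ball 0 m" for z :: complex
  proof -
    have "norm z < m" using that by simp
    then have "Re ((of_real m)\<^sup>2 - z\<^sup>2) > 0" by (rule Re_mass_gap_pos)
    then show ?thesis
      unfolding complex_nonpos_Reals_iff by linarith
  qed
  have k: "decay_rate m holomorphic_on ball 0 m"
    unfolding decay_rate_def[abs_def] by (intro holomorphic_intros) (rule nonpos)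
  have nz: "decay_rate m z \<noteq> 0" "of_real m + z \<noteq> 0" if "z \<in> ball 0 m" for z :: complex
    using decay_rate_facts(3,4)[of z m] that by auto
  show ?thesis
    unfolding mismatch_def[abs_def] sol1_def sol2_def cosh_def sinh_def scaleR_conv_of_real
    by (intro holomorphic_intros k nz)
qed

lemma discrete_eigenvalue_if_mismatch_0:
  assumes "a > 0" "norm z < m" and W: "mismatch m a (cot \<alpha>) t z = 0" and W0: "mismatch m a (cot \<alpha>) t 0 \<noteq> 0"
  shows "discrete_eigenvalue (dirac_delta m \<alpha> a t) z"
proof -
  interpret dirac_problem m a \<alpha> t z by unfold_locales fact+
  have "m > 0" using assms(2) norm_ge_zero[of z] by linarith
  obtain r where r: "0 < r" "ball z r \<subseteq> ball 0 m"
    "\<And>w. w \<in> ball z r - {z} \<Longrightarrow> mismatch m a (cot \<alpha>) t w \<noteq> 0"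
    using isolated_zeros[OF mismatch_holomorphic _ _ _ W _ W0] assms(2) \<open>m > 0\<close> by auto
  have "w \<in> resolvent_set D" if "w \<in> ball z r - {z}" for w
  proof -
    have norm_w: "norm w < m" using that r(2) by auto
    interpret w: dirac_problem m a \<alpha> t w by unfold_locales (rule a_pos norm_w)+
    show ?thesis by (rule w.in_resolvent_set[OF r(3)[OF that]])
  qed
  then have "ball z r \<inter> spectrum D \<subseteq> {z}"
    unfolding spectrum_def by blast
  moreover have "z \<in> ball z r \<inter> spectrum D"
    using in_spectrum[OF W] r(1) by simp
  ultimately have "ball z r \<inter> spectrum D = {z}" by blast
  then have "z isolated_in spectrum D"
    using in_spectrum[OF W] unfolding isolated_in_def by blast
  then show ?thesis
    unfolding discrete_eigenvalue_def
    using eigenvalue_bound_state[OF W] finite_multiplicity_bound_state[OF W] by blast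
qed

text \<open>
The energy is parametrised by the decay rate \<open>\<kappa>\<close>, which runs through \<open>(0, m]\<close> as the energy runs
from \<open>m\<close> down to \<open>0\<close>; the limit \<open>\<kappa> \<rightarrow> 0\<close> is the threshold.
\<close>

lemma mismatch_of_real:
  assumes "0 < \<kappa>" "\<kappa> \<le> m" and E: "E = sqrt (m\<^sup>2 - \<kappa>\<^sup>2)"
  shows "mismatch m a c t (of_real E) = of_real
    (- (\<kappa> / (m + E)) * (cosh (\<kappa> * a) + (m + E) * (sinh (\<kappa> * a) / \<kappa>) * c)
     - (c * cosh (\<kappa> * a) + (m - E) * (sinh (\<kappa> * a) / \<kappa>))
     - t * (cosh (\<kappa> * a) + (m + E) * (sinh (\<kappa> * a) / \<kappa>) * c))"
proof -
  have "\<kappa>\<^sup>2 \<le> m\<^sup>2" using assms by (intro power_mono) auto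
  then have "m\<^sup>2 - E\<^sup>2 = \<kappa>\<^sup>2" by (simp add: E)
  then have "(of_real m)\<^sup>2 - (of_real E)\<^sup>2 = (complex_of_real \<kappa>)\<^sup>2"
    by (metis of_real_diff of_real_power)
  then have k: "decay_rate m (of_real E) = of_real \<kappa>"
    unfolding decay_rate_def using assms(1) by (simp add: csqrt_square)
  have ch: "cosh (complex_of_real x) = of_real (cosh x)" "sinh (complex_of_real x) = of_real (sinh x)" for x
    by (simp_all add: cosh_def sinh_def scaleR_conv_of_real exp_of_real flip: of_real_minus)
  show ?thesis
    unfolding mismatch_def sol1_def sol2_def k
    by (simp add: ch mult.commute flip: of_real_mult of_real_add of_real_diff of_real_divide of_real_minus)
qed

text \<open>
The mismatch is negative at energy \<open>0\<close> (decay rate \<open>m\<close>), because \<open>t > -1\<close>, and it tends to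
\<open>-c - t (1 + 2 m a c) > 0\<close> at the threshold, because \<open>sinh (\<kappa> a) / \<kappa>\<close> tends to \<open>a\<close>.
\<close>

lemma bound_state_energy:
  fixes m a c t :: real
  assumes "m > 0" "a > 0" "c > 0" "- 1 < t" and t: "t * (1 + 2 * m * a * c) < - c"
  shows "\<exists>E. 0 < E \<and> E < m \<and> mismatch m a c t (of_real E) = 0" "mismatch m a c t 0 \<noteq> 0"
proof -
  define e where "e \<kappa> = sqrt (m\<^sup>2 - \<kappa>\<^sup>2)" for \<kappa>
  define l1 where "l1 \<kappa> = cosh (\<kappa> * a) + (m + e \<kappa>) * (sinh (\<kappa> * a) / \<kappa>) * c" for \<kappa>
  define l2 where "l2 \<kappa> = c * cosh (\<kappa> * a) + (m - e \<kappa>) * (sinh (\<kappa> * a) / \<kappa>)" for \<kappa>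
  define w where "w \<kappa> = - (\<kappa> / (m + e \<kappa>)) * l1 \<kappa> - l2 \<kappa> - t * l1 \<kappa>" for \<kappa>
  have mis: "mismatch m a c t (of_real (e \<kappa>)) = of_real (w \<kappa>)" if "0 < \<kappa>" "\<kappa> \<le> m" for \<kappa>
    unfolding w_def l1_def l2_def by (rule mismatch_of_real[OF that]) (simp add: e_def)
  have em: "e m = 0" by (simp add: e_def)
  have "l1 m > 0" "l2 m > 0"
    using assms by (simp_all add: l1_def l2_def em add_pos_pos)
  then have "(1 + t) * l1 m + l2 m > 0"
    using \<open>- 1 < t\<close> by (intro add_pos_pos[OF mult_pos_pos]) simp_all
  moreover have "w m = - ((1 + t) * l1 m + l2 m)"
    using \<open>m > 0\<close> by (simp add: w_def em algebra_simps)
  ultimately have wm: "w m < 0" by simp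
  show "mismatch m a c t 0 \<noteq> 0"
    using mis[of m] wm \<open>m > 0\<close> by (simp add: em)
  have sinh: "((\<lambda>\<kappa>. sinh (\<kappa> * a) / \<kappa>) \<longlongrightarrow> a) (at_right 0)"
    by real_asymp
  have e: "(e \<longlongrightarrow> m) (at_right 0)"
  proof -
    have "(e \<longlongrightarrow> sqrt (m\<^sup>2 - 0\<^sup>2)) (at_right 0)"
      unfolding e_def[abs_def] by (intro tendsto_intros)
    then show ?thesis using \<open>m > 0\<close> by simp
  qed
  have cosh: "((\<lambda>\<kappa>. cosh (\<kappa> * a)) \<longlongrightarrow> 1) (at_right 0)"
  proof -
    have "((\<lambda>\<kappa>. cosh (\<kappa> * a)) \<longlongrightarrow> cosh (0 * a)) (at_right 0)"
      by (intro tendsto_intros)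
    then show ?thesis by simp
  qed
  have l1: "(l1 \<longlongrightarrow> 1 + (m + m) * a * c) (at_right 0)"
    unfolding l1_def[abs_def] by (intro tendsto_intros sinh e cosh)
  have l2: "(l2 \<longlongrightarrow> c * 1 + (m - m) * a) (at_right 0)"
    unfolding l2_def[abs_def] by (intro tendsto_intros sinh e cosh)
  have "(w \<longlongrightarrow> - (0 / (m + m)) * (1 + (m + m) * a * c) - (c * 1 + (m - m) * a) - t * (1 + (m + m) * a * c)) (at_right 0)"
    unfolding w_def[abs_def] using \<open>m > 0\<close> by (intro tendsto_intros l1 l2 e) auto
  moreover have "- (0 / (m + m)) * (1 + (m + m) * a * c) - (c * 1 + (m - m) * a) - t * (1 + (m + m) * a * c) > 0"
    using t by (simp add: algebra_simps)
  ultimately have "eventually (\<lambda>\<kappa>. w \<kappa> > 0) (at_right 0)"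
    by (rule order_tendstoD(1))
  moreover have "eventually (\<lambda>\<kappa>. \<kappa> \<in> {0<..<m}) (at_right 0)"
    using \<open>m > 0\<close> by (rule eventually_at_right_real)
  ultimately have "eventually (\<lambda>\<kappa>. w \<kappa> > 0 \<and> \<kappa> \<in> {0<..<m}) (at_right 0)"
    by eventually_elim simp
  then obtain \<kappa>0 where \<kappa>0: "w \<kappa>0 > 0" "0 < \<kappa>0" "\<kappa>0 < m"
    using eventually_happens trivial_limit_at_right_real by force
  have me: "m + e \<kappa> \<noteq> 0" if "\<kappa> \<in> {\<kappa>0..m}" for \<kappa>
  proof -
    have "\<kappa>\<^sup>2 \<le> m\<^sup>2" using that \<kappa>0 by (intro power_mono) auto
    then have "e \<kappa> \<ge> 0" by (simp add: e_def)
    then show ?thesis using \<open>m > 0\<close> by simp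
  qed
  have ce: "continuous_on {\<kappa>0..m} e"
    unfolding e_def[abs_def] by (intro continuous_intros)
  have c1: "continuous_on {\<kappa>0..m} l1" and c2: "continuous_on {\<kappa>0..m} l2"
    unfolding l1_def[abs_def] l2_def[abs_def] using \<kappa>0 by (auto intro!: continuous_intros ce)
  have "continuous_on {\<kappa>0..m} w"
    unfolding w_def[abs_def] using me by (intro continuous_intros ce c1 c2) auto
  then obtain \<kappa> where \<kappa>: "\<kappa>0 \<le> \<kappa>" "\<kappa> \<le> m" "w \<kappa> = 0"
    using IVT2'[of w m 0 \<kappa>0] \<kappa>0 wm by auto
  have "\<kappa> < m" using \<kappa> wm by (cases "\<kappa> = m") auto
  have "\<kappa>\<^sup>2 < m\<^sup>2" "0 < \<kappa>\<^sup>2"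
    using \<open>\<kappa> < m\<close> \<kappa> \<kappa>0 by (auto intro: power_strict_mono)
  then have "e \<kappa> > 0" "e \<kappa> < m"
    using \<open>m > 0\<close> by (simp_all add: e_def real_less_lsqrt)
  moreover have "mismatch m a c t (of_real (e \<kappa>)) = 0"
    using mis[of \<kappa>] \<kappa> \<kappa>0 by simp
  ultimately show "\<exists>E. 0 < E \<and> E < m \<and> mismatch m a c t (of_real E) = 0" by blast
qed

lemma delta_potential_double_integral:
  fixes a m t b :: real
  assumes "a > 0"
  shows "(\<integral>\<^sup>+x\<in>{0<..}. (\<integral>\<^sup>+y\<in>{0<..}. ennreal ((max 1 (b + 2 * m * min x y))\<^sup>2)
      \<partial>delta_potential_measure a t) \<partial>delta_potential_measure a t) = ennreal (t\<^sup>2 * (max 1 (b + 2 * m * a))\<^sup>2)"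
proof -
  have int: "(\<integral>\<^sup>+x. f x \<partial>delta_potential_measure a t) = ennreal \<bar>t\<bar> * f a"
    if "f \<in> borel_measurable borel" for f
    using that by (simp add: delta_potential_measure_def nn_integral_scale_measure nn_integral_return)
  have inner: "(\<integral>\<^sup>+y\<in>{0<..}. ennreal ((max 1 (b + 2 * m * min x y))\<^sup>2) \<partial>delta_potential_measure a t) =
      ennreal \<bar>t\<bar> * ennreal ((max 1 (b + 2 * m * min x a))\<^sup>2)" for x
    using \<open>a > 0\<close> by (subst int) auto
  have "(\<integral>\<^sup>+x\<in>{0<..}. (\<integral>\<^sup>+y\<in>{0<..}. ennreal ((max 1 (b + 2 * m * min x y))\<^sup>2)
      \<partial>delta_potential_measure a t) \<partial>delta_potential_measure a t) =
      ennreal \<bar>t\<bar> * (ennreal \<bar>t\<bar> * ennreal ((max 1 (b + 2 * m * a))\<^sup>2))"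
    unfolding inner using \<open>a > 0\<close> by (subst int) auto
  also have "\<dots> = ennreal (\<bar>t\<bar> * (\<bar>t\<bar> * (max 1 (b + 2 * m * a))\<^sup>2))"
    by (simp add: ennreal_mult)
  also have "\<bar>t\<bar> * (\<bar>t\<bar> * (max 1 (b + 2 * m * a))\<^sup>2) = t\<^sup>2 * (max 1 (b + 2 * m * a))\<^sup>2"
    by (simp add: power2_eq_square mult.assoc[symmetric] flip: abs_mult)
  finally show ?thesis .
qed

theorem proposition4p1:
  fixes \<alpha> m a t0 :: real
  assumes "0 < \<alpha>" and "\<alpha> < pi / 2" and "0 < m" and "0 < a"
    and "1 / cot \<alpha> + 2 * m * a > 1"
    and "t0 = - (cot \<alpha> / (1 + 2 * m * a * cot \<alpha>))"
  shows "\<exists>\<epsilon>0>0. \<forall>\<epsilon>. 0 < \<epsilon> \<and> \<epsilon> < \<epsilon>0 \<longrightarrow>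
    (\<exists>E::real. - m < E \<and> E < m \<and>
       discrete_eigenvalue (dirac_delta m \<alpha> a (t0 * sqrt (1 + \<epsilon>))) (complex_of_real E)) \<and>
    (\<integral>\<^sup>+x\<in>{0<..}. (\<integral>\<^sup>+y\<in>{0<..}. ennreal ((max 1 (1 / cot \<alpha> + 2 * m * min x y))\<^sup>2)
        \<partial>delta_potential_measure a (t0 * sqrt (1 + \<epsilon>)))
      \<partial>delta_potential_measure a (t0 * sqrt (1 + \<epsilon>))) = ennreal (1 + \<epsilon>)"
proof -
  define c where "c = cot \<alpha>"
  \<comment> \<open>Here \<open>q\<close> is the value of the weight in the double integral at \<open>x = y = a\<close>.\<close>
  define q where "q = 1 / c + 2 * m * a"
  have "c > 0"
    using assms(1,2) by (simp add: c_def cot_def cos_gt_zero sin_gt_zero)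
  have "q > 1" using assms(5) by (simp add: q_def c_def)
  have cq: "1 + 2 * m * a * c = c * q"
    using \<open>c > 0\<close> by (simp add: q_def field_simps)
  then have t0: "t0 = - (1 / q)"
    using assms(6) \<open>c > 0\<close> by (simp add: c_def[symmetric])
  show ?thesis
  \<comment> \<open>The choice \<open>\<epsilon>0 = q\<^sup>2 - 1\<close> is the condition \<open>t > -1\<close>.\<close>
  proof (rule exI[of _ "q\<^sup>2 - 1"], intro conjI allI impI)
    show "q\<^sup>2 - 1 > 0"
      using \<open>q > 1\<close> by (simp add: one_less_power)
    fix \<epsilon> assume \<epsilon>: "0 < \<epsilon> \<and> \<epsilon> < q\<^sup>2 - 1"
    define t where "t = t0 * sqrt (1 + \<epsilon>)"
    have "sqrt (1 + \<epsilon>) < sqrt (q\<^sup>2)"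
      using \<epsilon> by (intro real_sqrt_less_mono) auto
    then have s: "1 < sqrt (1 + \<epsilon>)" "sqrt (1 + \<epsilon>) < q"
      using \<epsilon> \<open>q > 1\<close> by auto
    have t: "t = - (sqrt (1 + \<epsilon>) / q)" by (simp add: t_def t0)
    have "- 1 < t"
      using s \<open>q > 1\<close> by (simp add: t)
    moreover have "t * (1 + 2 * m * a * c) < - c"
      unfolding cq t using s \<open>q > 1\<close> \<open>c > 0\<close> by simp
    ultimately obtain E where E: "0 < E" "E < m" "mismatch m a c t (of_real E) = 0"
      and W0: "mismatch m a c t 0 \<noteq> 0"
      using bound_state_energy[OF assms(3,4) \<open>c > 0\<close>, of t] by blast
    have "discrete_eigenvalue (dirac_delta m \<alpha> a t) (of_real E)"
      by (rule discrete_eigenvalue_if_mismatch_0) (use E W0 assms(4) in \<open>simp_all add: c_def\<close>)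
    then show "\<exists>E::real. - m < E \<and> E < m \<and>
       discrete_eigenvalue (dirac_delta m \<alpha> a (t0 * sqrt (1 + \<epsilon>))) (complex_of_real E)"
      using E \<open>0 < m\<close> unfolding t_def by (intro exI[of _ E]) auto
    have "t\<^sup>2 * (max 1 q)\<^sup>2 = 1 + \<epsilon>"
      using \<epsilon> \<open>q > 1\<close> by (simp add: t power_divide)
    then show "(\<integral>\<^sup>+x\<in>{0<..}. (\<integral>\<^sup>+y\<in>{0<..}. ennreal ((max 1 (1 / cot \<alpha> + 2 * m * min x y))\<^sup>2)
        \<partial>delta_potential_measure a (t0 * sqrt (1 + \<epsilon>)))
      \<partial>delta_potential_measure a (t0 * sqrt (1 + \<epsilon>))) = ennreal (1 + \<epsilon>)"
      using delta_potential_double_integral[OF assms(4), where b = "1 / cot \<alpha>" and m = m and t = t]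
      by (simp only: t_def q_def c_def)
  qed
qed

end
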